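(* Let $\vec F_{3,3}$ be an anti-directed orientation of $F_{3,3}$. Then for all sufficiently large $n$, $$D(n,\vec F_{3,3})=2^{\mathrm{ex}(n,F_{3,3})}=2^{\lfloor n^2/4\rfloor+6}.$$
   Context: $F_{3,3}$ is the graph consisting of three triangles sharing exactly one common vertex (the center). An orientation of $F_{3,3}$ is anti-directed if each of the three triangles contains at least one edge directed into the center and at least one edge directed out of the center. For a directed graph $\vec H$, $D(n,\vec H)$ is the maximum, over all $n$-vertex graphs $G$, of the number of orientations of $G$ containing no copy of $\vec H$; $\mathrm{ex}(n,F)$ is the Turán number of $F$. *)

theory Defs
  imports Main
begin

definition graph_on :: "nat \<Rightarrow> nat set set \<Rightarrow> bool" where
  "graph_on n E \<longleftrightarrow> (\<forall>e\<in>E. \<exists>u v. u < n \<and> v < n \<and> u \<noteq> v \<and> e = {u, v})"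

definition orientation_of :: "'a set set \<Rightarrow> ('a \<times> 'a) set \<Rightarrow> bool" where
  "orientation_of E R \<longleftrightarrow>
     (\<forall>(u, v)\<in>R. {u, v} \<in> E) \<and>
     (\<forall>u v. {u, v} \<in> E \<longrightarrow> u \<noteq> v \<longrightarrow> ((u, v) \<in> R \<longleftrightarrow> (v, u) \<notin> R))"

definition contains_copy :: "'b set \<Rightarrow> 'b set set \<Rightarrow> 'a set set \<Rightarrow> bool" where
  "contains_copy VF EF E \<longleftrightarrow> (\<exists>f. inj_on f VF \<and> (\<forall>e\<in>EF. f ` e \<in> E))"

definition contains_dicopy :: "'b set \<Rightarrow> ('b \<times> 'b) set \<Rightarrow> ('a \<times> 'a) set \<Rightarrow> bool" where
  "contains_dicopy VH A R \<longleftrightarrow> (\<exists>f. inj_on f VH \<and> (\<forall>(a, b)\<in>A. (f a, f b) \<in> R))"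

definition turan_ex :: "nat \<Rightarrow> 'b set \<Rightarrow> 'b set set \<Rightarrow> nat" where
  "turan_ex n VF EF = Max {card E | E. graph_on n E \<and> \<not> contains_copy VF EF E}"

definition D :: "nat \<Rightarrow> 'b set \<Rightarrow> ('b \<times> 'b) set \<Rightarrow> nat" where
  "D n VH A = Max {card {R. orientation_of E R \<and> \<not> contains_dicopy VH A R} | E. graph_on n E}"

text \<open>F_{3,3}: three triangles {0,1,2}, {0,3,4}, {0,5,6} sharing the centre 0.\<close>
definition F33_vertices :: "nat set" where
  "F33_vertices = {0..<7}"

definition F33_edges :: "nat set set" where
  "F33_edges = {{0,1},{0,2},{1,2},{0,3},{0,4},{3,4},{0,5},{0,6},{5,6}}"

definition anti_directed_F33 :: "(nat \<times> nat) set \<Rightarrow> bool" where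
  "anti_directed_F33 A \<longleftrightarrow> orientation_of F33_edges A \<and>
     (\<forall>(a, b)\<in>{(1::nat, 2::nat), (3, 4), (5, 6)}.
        ((a, 0) \<in> A \<or> (b, 0) \<in> A) \<and> ((0, a) \<in> A \<or> (0, b) \<in> A))"

end

theory Submission
  imports Defs "HOL-Library.FuncSet" "HOL-Real_Asymp.Real_Asymp"
begin

text \<open>
  If an orientation avoids the pattern, then around each vertex \<open>c\<close> one of the three required triangle
  types has no occurrence outside a set of four vertices. Fix a bounded vertex set \<open>K\<close> and guess its
  internal orientation together with these exceptional sets; this costs only polynomially many choices.
  For adjacent \<open>u, v\<close> in \<open>K\<close> and an unexceptional common neighbour \<open>w\<close> outside, one of the four
  orientations of the pair \<open>uw, vw\<close> is now impossible. Whenever some \<open>K\<close> turns this into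
  a linear number of bits saved against \<open>|K| n / 2\<close>, deleting \<open>K\<close> is profitable: measured against
  \<open>n\<^sup>2 / 4\<close> the number of orientations grows relatively by at least \<open>2\<close> to the \<open>|K|\<close>. This cannot be
  iterated down to a bounded number of vertices, since there it would exceed the trivial bound.

  A profitable \<open>K\<close> exists if the density exceeds \<open>1/2\<close> (a bounded set inducing minimum degree above
  \<open>|K| / 2\<close>), if a vertex has five neighbours of linear codegree with it, if a vertex has seven neighbours in
  both classes of an approximate bipartition, or if one class contains a vertex of inner degree three or
  three disjoint edges. What remains is a nearly complete balanced bipartite graph with at most six further
  edges in each class. If both classes have inner edges, then, up to an exponentially
  small proportion of orientations, no vertex of inner degree two spans a triangle of the first type with an edge
  of the other class, and this loses at least one factor of two per edge above \<open>n\<^sup>2 / 4 + 6\<close>.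
\<close>

subsection \<open>Counting orientations by traces on a small vertex set\<close>

text \<open>The pattern enters only through three booleans. Since each of its triangles has one arc
  into and one arc out of the centre, directing \<open>uv\<close> leaves exactly one of the four
  ways to direct \<open>uw\<close> and \<open>vw\<close> that completes a triangle of a given type,
  whether \<open>u\<close> or \<open>w\<close> is the centre. A missing type therefore always means
  an unshattered pair in a set family, and which type is missing costs one bit per centre. Guesses
  cost a power of n while the target is exact, so deletion can only dispose of graphs that lose
  linearly many bits; the last case has to be counted with no constant lost. The 6 is the largest
  number of edges of a graph with maximum degree two and no three disjoint edges, attained by two
  triangles. If both classes have inner edges, up to twelve may be added in all. A vertex of inner
  degree two then already owns two spokes for two of the triangles at itself, so the remaining
  triangle, on an inner edge of the opposite class, is exponentially rare; its absence makes those
  inner edges unshattered at this vertex.\<close>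

definition sgraph :: "nat set \<Rightarrow> nat set set \<Rightarrow> bool" where
  "sgraph V E \<longleftrightarrow> finite V \<and> (\<forall>e\<in>E. \<exists>u v. u \<in> V \<and> v \<in> V \<and> u \<noteq> v \<and> e = {u, v})"

definition nbh :: "nat set set \<Rightarrow> nat \<Rightarrow> nat set" where
  "nbh E v = {u. {u, v} \<in> E}"

definition del :: "nat set set \<Rightarrow> nat set \<Rightarrow> nat set set" where
  "del E K = {e\<in>E. e \<inter> K = {}}"

text \<open>Once the arcs inside \<open>K\<close> are known, the arcs between \<open>w\<close> and
  \<open>K\<close> are recorded by their ends in \<open>K\<close> that point to \<open>w\<close>.
  Counting orientations of a star becomes counting a set family.\<close>

definition sv :: "nat set \<Rightarrow> (nat \<times> nat) set \<Rightarrow> nat \<Rightarrow> nat set" where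
  "sv K R w = {x\<in>K. (x, w) \<in> R}"

definition traces :: "nat set \<Rightarrow> (nat \<times> nat) set set \<Rightarrow> nat \<Rightarrow> nat set set" where
  "traces K T w = (\<lambda>R. sv K R w) ` T"

definition agree_on :: "nat set \<Rightarrow> (nat \<times> nat) set set \<Rightarrow> bool" where
  "agree_on K T \<longleftrightarrow> (\<forall>R\<in>T. \<forall>R'\<in>T. R \<inter> K \<times> K = R' \<inter> K \<times> K)"

lemma agree_onD: "agree_on K T \<Longrightarrow> R \<in> T \<Longrightarrow> R' \<in> T \<Longrightarrow> R \<inter> K \<times> K = R' \<inter> K \<times> K"
  unfolding agree_on_def by blast

text \<open>In an anti-directed triangle the centre \<open>c\<close> has one out-neighbour and one in-neighbour; \<open>t\<close> records
  whether the third edge leaves the out-neighbour.\<close>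
definition tri :: "(nat \<times> nat) set \<Rightarrow> bool \<Rightarrow> nat \<Rightarrow> nat \<Rightarrow> nat \<Rightarrow> bool" where
  "tri R t c a b \<longleftrightarrow>
     (c, a) \<in> R \<and> (b, c) \<in> R \<and> (if t then (a, b) \<in> R else (b, a) \<in> R) \<or>
     (c, b) \<in> R \<and> (a, c) \<in> R \<and> (if t then (b, a) \<in> R else (a, b) \<in> R)"

text \<open>The ends of each triangle may be exchanged, as \<open>tri\<close> is symmetric in them.
  The centre differs from all six ends because the graphs have no loops.\<close>

definition fan_free :: "bool \<Rightarrow> bool \<Rightarrow> bool \<Rightarrow> (nat \<times> nat) set \<Rightarrow> bool" where
  "fan_free t1 t2 t3 R \<longleftrightarrow>
     \<not> (\<exists>c a1 b1 a2 b2 a3 b3. distinct [a1, b1, a2, b2, a3, b3] \<and>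
          tri R t1 c a1 b1 \<and> tri R t2 c a2 b2 \<and> tri R t3 c a3 b3)"

lemma sgraph_finite: "sgraph V E \<Longrightarrow> finite V"
  by (simp add: sgraph_def)

lemma sgraph_edgeD: "sgraph V E \<Longrightarrow> {u, v} \<in> E \<Longrightarrow> u \<in> V \<and> v \<in> V \<and> u \<noteq> v"
  unfolding sgraph_def by (metis doubleton_eq_iff insert_absorb2)

lemma sgraph_finite_edges: "sgraph V E \<Longrightarrow> finite E"
proof -
  assume g: "sgraph V E"
  have "E \<subseteq> Pow V" using g unfolding sgraph_def by fastforce
  thus ?thesis using g sgraph_finite finite_subset by blast
qed

lemma nbh_sub: "sgraph V E \<Longrightarrow> nbh E v \<subseteq> V - {v}"
  unfolding nbh_def using sgraph_edgeD by fastforce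

lemma finite_nbh: "sgraph V E \<Longrightarrow> finite (nbh E v)"
  using nbh_sub sgraph_finite by (metis finite_Diff finite_subset)

lemma nbh_sym: "u \<in> nbh E v \<longleftrightarrow> v \<in> nbh E u"
  unfolding nbh_def by (simp add: insert_commute)

lemma sgraph_del: "sgraph V E \<Longrightarrow> sgraph (V - K) (del E K)"
  unfolding sgraph_def del_def by fastforce

lemma orient_edge: "orientation_of E R \<Longrightarrow> (u, v) \<in> R \<Longrightarrow> {u, v} \<in> E"
  unfolding orientation_of_def by auto

lemma orient_iff: "sgraph V E \<Longrightarrow> orientation_of E R \<Longrightarrow> {u, v} \<in> E \<Longrightarrow> (v, u) \<in> R \<longleftrightarrow> (u, v) \<notin> R"
  using sgraph_edgeD[of V E u v] unfolding orientation_of_def by blast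

lemma orient_sub: "sgraph V E \<Longrightarrow> orientation_of E R \<Longrightarrow> R \<subseteq> V \<times> V"
  using orient_edge sgraph_edgeD by fastforce

lemma finite_orientations: "sgraph V E \<Longrightarrow> finite {R. orientation_of E R}"
  using orient_sub[of V E] sgraph_finite[of V E]
  by (intro finite_subset[of "{R. orientation_of E R}" "Pow (V \<times> V)"]) auto

text \<open>The edges directed from the smaller to the larger end form an arbitrary subset of
  \<open>E\<close>: \<open>up\<close> reads it off and \<open>ori\<close> restores the
  orientation.\<close>

lemma card_orientations:
  assumes g: "sgraph V E"
  shows "card {R. orientation_of E R} = 2 ^ card E"
proof -
  define up where "up R = {e. \<exists>u v. u < v \<and> e = {u, v} \<and> (u, v) \<in> R}" for R :: "(nat \<times> nat) set"
  define ori where "ori F = {(u, v). u \<noteq> v \<and> {u, v} \<in> E \<and> ((u < v) = ({u, v} \<in> F))}" for F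
  have "bij_betw up {R. orientation_of E R} (Pow E)"
  proof (rule bij_betw_byWitness[where f' = ori])
    show "\<forall>R\<in>{R. orientation_of E R}. ori (up R) = R"
    proof
      fix R assume "R \<in> {R. orientation_of E R}"
      hence R: "orientation_of E R" by simp
      have mem': "{u, v} \<in> up R \<longleftrightarrow> (u, v) \<in> R" if "u < v" for u v
      proof
        assume "{u, v} \<in> up R"
        then obtain a b where "a < b" "{u, v} = {a, b}" "(a, b) \<in> R" unfolding up_def by blast
        moreover from this that have "a = u" "b = v" by (metis doubleton_eq_iff less_asym)+
        ultimately show "(u, v) \<in> R" by simp
      next
        assume "(u, v) \<in> R"
        with that have "u < v \<and> {u, v} = {u, v} \<and> (u, v) \<in> R" by blast
        thus "{u, v} \<in> up R" unfolding up_def mem_Collect_eq by (intro exI)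
      qed
      have mem: "{u, v} \<in> up R \<longleftrightarrow> (if u < v then (u, v) \<in> R else (v, u) \<in> R)" if "u \<noteq> v" for u v
      proof (cases "u < v")
        case True thus ?thesis using mem'[OF True] by simp
      next
        case False
        hence "v < u" using that by simp
        thus ?thesis using mem'[of v u] False by (simp only: insert_commute[of u v] if_False)
      qed
      show "ori (up R) = R"
      proof (rule set_eqI, clarify)
        fix u v
        have lhs: "(u, v) \<in> ori (up R) \<longleftrightarrow> u \<noteq> v \<and> {u, v} \<in> E \<and> ((u < v) = ({u, v} \<in> up R))"
          unfolding ori_def by simp
        show "(u, v) \<in> ori (up R) \<longleftrightarrow> (u, v) \<in> R"
        proof (cases "{u, v} \<in> E")
          case True
          hence ne: "u \<noteq> v" using sgraph_edgeD[OF g] by blast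
          show ?thesis
          proof (cases "u < v")
            case lt: True
            thus ?thesis using lhs True ne mem[OF ne] by simp
          next
            case lt: False
            hence "{u, v} \<in> up R \<longleftrightarrow> (v, u) \<in> R" using mem[OF ne] by simp
            thus ?thesis using lhs True ne lt orient_iff[OF g R True] by blast
          qed
        next
          case False
          thus ?thesis using lhs orient_edge[OF R] by blast
        qed
      qed
    qed
    show "\<forall>F\<in>Pow E. up (ori F) = F"
    proof
      fix F assume F: "F \<in> Pow E"
      show "up (ori F) = F"
      proof
        show "up (ori F) \<subseteq> F"
        proof
          fix e assume "e \<in> up (ori F)"
          then obtain u v where "u < v" "e = {u, v}" "(u, v) \<in> ori F" unfolding up_def by blast
          moreover from this(3) have "(u < v) = ({u, v} \<in> F)" unfolding ori_def by blast
          ultimately show "e \<in> F" by blast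
        qed
        show "F \<subseteq> up (ori F)"
        proof
          fix e assume e: "e \<in> F"
          hence "e \<in> E" using F by blast
          then obtain u v where uv: "u \<noteq> v" "e = {u, v}" using g unfolding sgraph_def by metis
          define a b where "a = min u v" and "b = max u v"
          have ab: "a < b" "e = {a, b}" using uv unfolding a_def b_def by (auto simp: min_def max_def)
          hence "(a, b) \<in> ori F" using e F unfolding ori_def by auto
          with ab have "a < b \<and> e = {a, b} \<and> (a, b) \<in> ori F" by blast
          thus "e \<in> up (ori F)" unfolding up_def mem_Collect_eq by (intro exI)
        qed
      qed
    qed
    show "up ` {R. orientation_of E R} \<subseteq> Pow E"
      unfolding up_def using orient_edge by fastforce
    show "ori ` Pow E \<subseteq> {R. orientation_of E R}"
      unfolding ori_def orientation_of_def by (auto simp: insert_commute)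
  qed
  thus ?thesis
    by (simp add: bij_betw_same_card card_Pow sgraph_finite_edges[OF g])
qed

locale fan_types =
  fixes t1 t2 t3 :: bool
begin

definition FO :: "nat set set \<Rightarrow> (nat \<times> nat) set set" where
  "FO E = {R. orientation_of E R \<and> fan_free t1 t2 t3 R}"

definition cnt :: "nat set set \<Rightarrow> nat" where
  "cnt E = card (FO E)"

lemma finite_FO: "sgraph V E \<Longrightarrow> finite (FO E)"
  unfolding FO_def by (rule finite_subset[OF _ finite_orientations]) auto

lemma cnt_le: "sgraph V E \<Longrightarrow> cnt E \<le> 2 ^ card E"
  unfolding cnt_def FO_def
  by (subst card_orientations[symmetric]) (auto intro: card_mono finite_orientations)

lemma tri_mono: "R \<subseteq> R' \<Longrightarrow> tri R t c a b \<Longrightarrow> tri R' t c a b"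
  unfolding tri_def by (auto split: if_splits)

lemma fan_free_mono: "R \<subseteq> R' \<Longrightarrow> fan_free t1 t2 t3 R' \<Longrightarrow> fan_free t1 t2 t3 R"
  unfolding fan_free_def using tri_mono by metis

lemma FO_restrict:
  assumes "R \<in> FO E"
  shows "{(u, v)\<in>R. u \<notin> K \<and> v \<notin> K} \<in> FO (del E K)"
proof -
  have "orientation_of (del E K) {(u, v)\<in>R. u \<notin> K \<and> v \<notin> K}"
    using assms unfolding FO_def orientation_of_def del_def by auto
  moreover have "fan_free t1 t2 t3 {(u, v)\<in>R. u \<notin> K \<and> v \<notin> K}"
    using assms unfolding FO_def by (auto intro: fan_free_mono[rotated])
  ultimately show ?thesis unfolding FO_def by blast
qed

text \<open>An orientation is determined by its traces on the pairs inside \<open>K\<close>, on the stars from the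
  other vertices into \<open>K\<close>, and on the graph without \<open>K\<close>.\<close>
lemma card_class_le:
  assumes g: "sgraph V E" and K: "K \<subseteq> V" and T: "T \<subseteq> FO E"
    and agree: "agree_on K T"
  shows "card T \<le> (\<Prod>w\<in>V - K. card (traces K T w)) * cnt (del E K)"
proof -
  define \<Phi> where "\<Phi> R = (\<lambda>w\<in>V - K. sv K R w, {(u, v)\<in>R. u \<notin> K \<and> v \<notin> K})" for R
  have fV: "finite V" and fK: "finite K" using g K sgraph_finite finite_subset by blast+
  have fT: "finite T" using T finite_FO[OF g] finite_subset by blast
  let ?P = "(\<Pi>\<^sub>E w\<in>V - K. traces K T w)"
  have inj: "inj_on \<Phi> T"
  proof (rule inj_onI)
    fix R R' assume R: "R \<in> T" and R': "R' \<in> T" and eq: "\<Phi> R = \<Phi> R'"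
    have o: "orientation_of E R" "orientation_of E R'" using R R' T unfolding FO_def by auto
    have s: "sv K R w = sv K R' w" if "w \<in> V - K" for w
      using eq that unfolding \<Phi>_def by (simp add: fun_eq_iff restrict_def) meson
    have r: "{(u, v)\<in>R. u \<notin> K \<and> v \<notin> K} = {(u, v)\<in>R'. u \<notin> K \<and> v \<notin> K}"
      using eq unfolding \<Phi>_def by simp
    have e: "(u, v) \<in> R \<longleftrightarrow> (u, v) \<in> R'" if "{u, v} \<in> E" for u v
    proof -
      have uv: "u \<in> V" "v \<in> V" using sgraph_edgeD[OF g that] by auto
      consider "u \<in> K" "v \<in> K" | "u \<in> K" "v \<notin> K" | "u \<notin> K" "v \<in> K" | "u \<notin> K" "v \<notin> K" by blast
      thus ?thesis
      proof cases
        case 1 thus ?thesis using agree_onD[OF agree R R'] by blast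
      next
        case 2 thus ?thesis using s[of v] uv unfolding sv_def by blast
      next
        case 3
        hence "(v, u) \<in> R \<longleftrightarrow> (v, u) \<in> R'" using s[of u] uv unfolding sv_def by blast
        thus ?thesis using orient_iff[OF g o(1) that] orient_iff[OF g o(2) that] by blast
      next
        case 4 thus ?thesis using r by blast
      qed
    qed
    have "(u, v) \<in> R \<longleftrightarrow> (u, v) \<in> R'" for u v
      using e[of u v] orient_edge[OF o(1), of u v] orient_edge[OF o(2), of u v] by blast
    thus "R = R'" by auto
  qed
  have "\<Phi> ` T \<subseteq> ?P \<times> FO (del E K)"
    unfolding \<Phi>_def traces_def using T FO_restrict by auto
  hence "card T \<le> card (?P \<times> FO (del E K))"
    using inj fV fT by (intro card_inj_on_le[of \<Phi>] finite_cartesian_product finite_PiE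
        finite_FO[OF sgraph_del[OF g]]) (auto simp: traces_def)
  also have "\<dots> = (\<Prod>w\<in>V - K. card (traces K T w)) * cnt (del E K)"
    using fV by (simp add: card_cartesian_product card_PiE cnt_def)
  finally show ?thesis .
qed

end

subsection \<open>Families of sets with unshattered pairs\<close>

text \<open>The two-element set is not shattered in the sense of Vapnik and Chervonenkis: one of its
  four possible traces is missing.\<close>

definition unsh :: "'a set set \<Rightarrow> 'a \<Rightarrow> 'a \<Rightarrow> bool" where
  "unsh F u v \<longleftrightarrow> (\<exists>a b. \<forall>S\<in>F. \<not> ((u \<in> S) = a \<and> (v \<in> S) = b))"

lemma unsh_image:
  assumes "unsh F v w" "u \<noteq> v" "u \<noteq> w"
  shows "unsh ((\<lambda>S. S - {u}) ` F) v w"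
  using assms unfolding unsh_def by auto

text \<open>A set counted twice by the projection away from \<open>u\<close> extends by both values of \<open>u\<close>, so each
  pair \<open>u, v\<close> prescribes its value at \<open>v\<close>.\<close>
lemma card_le_star:
  assumes N: "finite N" and F: "F \<subseteq> Pow N" and u: "u \<in> N" and B: "B \<subseteq> N - {u}"
    and un: "\<And>v. v \<in> B \<Longrightarrow> unsh F u v"
  shows "card F \<le> card ((\<lambda>S. S - {u}) ` F) + 2 ^ (card N - 1 - card B)"
proof -
  define F1 where "F1 = {S\<in>F. u \<in> S}"
  define F0 where "F0 = {S\<in>F. u \<notin> S}"
  define P where "P = (\<lambda>S. S - {u}) ` F1"
  have fF: "finite F" using N F finite_subset by blast
  hence fin: "finite F0" "finite F1" "finite P" unfolding F0_def F1_def P_def by auto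
  have cP: "card P = card F1"
    unfolding P_def by (rule card_image) (auto simp: inj_on_def F1_def)
  have "F0 = (\<lambda>S. S - {u}) ` F0" unfolding F0_def by force
  moreover have "F = F0 \<union> F1" unfolding F0_def F1_def by blast
  ultimately have im: "(\<lambda>S. S - {u}) ` F = F0 \<union> P" unfolding P_def by blast
  have "card F = card F0 + card F1"
    by (subst \<open>F = F0 \<union> F1\<close>, rule card_Un_disjoint) (use fin in \<open>auto simp: F0_def F1_def\<close>)
  also have "\<dots> = card (F0 \<union> P) + card (F0 \<inter> P)"
    using card_Un_Int[of F0 P] fin cP by simp
  finally have eq: "card F = card ((\<lambda>S. S - {u}) ` F) + card (F0 \<inter> P)" using im by simp
  have fNB: "finite (N - {u} - B)" using N by simp
  have "card (F0 \<inter> P) \<le> card (Pow (N - {u} - B))"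
  proof (rule card_inj_on_le[of "\<lambda>S. S - B"])
    show "inj_on (\<lambda>S. S - B) (F0 \<inter> P)"
    proof (rule inj_onI)
      fix S S' assume S: "S \<in> F0 \<inter> P" and S': "S' \<in> F0 \<inter> P" and eq: "S - B = S' - B"
      have ext: "X \<in> F \<and> insert u X \<in> F \<and> u \<notin> X" if "X \<in> F0 \<inter> P" for X
        using that unfolding F0_def P_def F1_def by (auto simp: insert_absorb)
      have "v \<in> S \<longleftrightarrow> v \<in> S'" if v: "v \<in> B" for v
      proof -
        obtain a b where ab: "\<forall>S\<in>F. \<not> ((u \<in> S) = a \<and> (v \<in> S) = b)"
          using un[OF v] unfolding unsh_def by blast
        have vu: "v \<noteq> u" using v B by blast
        have "(v \<in> X) \<noteq> b" if "X \<in> F0 \<inter> P" for X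
        proof (cases a)
          case True
          have "\<not> ((u \<in> insert u X) = a \<and> (v \<in> insert u X) = b)" using ab ext[OF that] by blast
          thus ?thesis using True vu by simp
        next
          case False
          have "\<not> ((u \<in> X) = a \<and> (v \<in> X) = b)" using ab ext[OF that] by blast
          thus ?thesis using False ext[OF that] by simp
        qed
        thus ?thesis using S S' by blast
      qed
      thus "S = S'" using eq by blast
    qed
    show "(\<lambda>S. S - B) ` (F0 \<inter> P) \<subseteq> Pow (N - {u} - B)" unfolding F0_def using F by auto
    show "finite (Pow (N - {u} - B))" using fNB by simp
  qed
  also have "\<dots> = 2 ^ (card N - 1 - card B)"
    using N u B by (simp add: card_Pow card_Diff_subset finite_subset)
  finally show ?thesis using eq by simp
qed

lemma image_remove_sub: "F \<subseteq> Pow N \<Longrightarrow> (\<lambda>S. S - {u}) ` F \<subseteq> Pow (N - {u})"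
  by auto

lemma card_sub_Pow: "finite N \<Longrightarrow> F \<subseteq> Pow N \<Longrightarrow> card F \<le> 2 ^ card N"
  by (metis card_Pow card_mono finite_Pow_iff)

lemma card_le_star':
  assumes "finite N" "F \<subseteq> Pow N" "u \<in> N" "B \<subseteq> N - {u}" "\<And>v. v \<in> B \<Longrightarrow> unsh F u v"
  shows "card F \<le> 2 ^ (card N - 1) + 2 ^ (card N - 1 - card B)"
proof -
  have "card ((\<lambda>S. S - {u}) ` F) \<le> 2 ^ card (N - {u})"
    using assms by (intro card_sub_Pow image_remove_sub) auto
  thus ?thesis using card_le_star[of N F u B, OF assms] assms(1,3) by simp
qed

text \<open>Elements are projected away one at a time. Each projection merges at most
  \<open>2 ^ d\<close> pairs of sets, since only shattered partners stay free, so the bound is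
  linear in \<open>card N\<close> instead of exponential.\<close>

lemma card_le_unshattered:
  assumes "finite N" "F \<subseteq> Pow N" "\<And>u. u \<in> N \<Longrightarrow> card {v\<in>N - {u}. \<not> unsh F u v} \<le> d"
  shows "card F \<le> 1 + card N * 2 ^ d"
  using assms
proof (induction N arbitrary: F rule: finite_induct)
  case empty
  hence "F \<subseteq> {{}}" by simp
  thus ?case using card_mono[of "{{}}" F] by simp
next
  case (insert u N)
  define F' where "F' = (\<lambda>S. S - {u}) ` F"
  define B where "B = {v\<in>N. unsh F u v}"
  have F': "F' \<subseteq> Pow N" unfolding F'_def using insert.prems(1) by auto
  have "card F' \<le> 1 + card N * 2 ^ d"
  proof (rule insert.IH[OF F'])
    fix v assume v: "v \<in> N"
    have "{w\<in>N - {v}. \<not> unsh F' v w} \<subseteq> {w\<in>insert u N - {v}. \<not> unsh F v w}"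
      unfolding F'_def using unsh_image[of F v _ u] insert.hyps v by auto
    hence "card {w\<in>N - {v}. \<not> unsh F' v w} \<le> card {w\<in>insert u N - {v}. \<not> unsh F v w}"
      using insert.hyps by (intro card_mono) auto
    thus "card {w\<in>N - {v}. \<not> unsh F' v w} \<le> d" using insert.prems(2)[of v] v by simp
  qed
  moreover have "card F \<le> card F' + 2 ^ (card (insert u N) - 1 - card B)"
    unfolding F'_def using insert by (intro card_le_star) (auto simp: B_def)
  moreover have "card (insert u N) - 1 - card B \<le> d"
  proof -
    have "{v\<in>insert u N - {u}. \<not> unsh F u v} = N - B" unfolding B_def using insert.hyps by auto
    hence "card (N - B) \<le> d" using insert.prems(2)[of u] by simp
    thus ?thesis using insert.hyps by (simp add: card_Diff_subset B_def)
  qed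
  hence "(2::nat) ^ (card (insert u N) - 1 - card B) \<le> 2 ^ d" by (rule power_increasing) simp
  ultimately have "card F \<le> (1 + card N * 2 ^ d) + 2 ^ d" by linarith
  thus ?case using insert.hyps by simp
qed

lemma two_power_split: "u \<in> N \<Longrightarrow> finite N \<Longrightarrow> (2::nat) ^ card N = 2 * 2 ^ (card N - 1)"
  by (metis card_gt_0_iff empty_iff power_eq_if not_gr_zero)

lemma card_le_unsh1:
  assumes "finite N" "F \<subseteq> Pow N" "u \<in> N" "v \<in> N" "u \<noteq> v" "unsh F u v"
  shows "4 * card F \<le> 3 * 2 ^ card N"
proof -
  have c: "card F \<le> 2 ^ (card N - 1) + 2 ^ (card N - 1 - 1)"
    using card_le_star'[of N F u "{v}"] assms by auto
  have "(2::nat) ^ card N = 2 * 2 ^ (card N - 1)" "(2::nat) ^ card (N - {u}) = 2 * 2 ^ (card (N - {u}) - 1)"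
    using assms two_power_split[of u N] two_power_split[of v "N - {u}"] by (blast, simp)
  thus ?thesis using c assms by simp
qed

text \<open>Two pairs at \<open>u\<close> limit the merged sets to one eighth of all subsets. The
  first bound keeps the projection, so that pairs avoiding \<open>u\<close> can improve it further;
  the second is 1/2 + 1/8.\<close>

lemma card_le_unsh_path:
  assumes N: "finite N" "F \<subseteq> Pow N" and uvw: "u \<in> N" "v \<in> N" "w \<in> N" "distinct [u, v, w]"
    and un: "unsh F u v" "unsh F u w"
  shows "8 * card F \<le> 8 * card ((\<lambda>S. S - {u}) ` F) + 2 ^ card N"
    and "8 * card F \<le> 5 * 2 ^ card N"
proof -
  have "card F \<le> card ((\<lambda>S. S - {u}) ` F) + 2 ^ (card N - 1 - card {v, w})"
    using assms by (intro card_le_star) auto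
  moreover have "card {u, v, w} \<le> card N" using assms by (intro card_mono) auto
  hence "card N = (card N - 1 - card {v, w}) + 3" using uvw by auto
  hence "(2::nat) ^ card N = 2 ^ ((card N - 1 - card {v, w}) + 3)" by (rule arg_cong)
  hence "(2::nat) ^ card N = 8 * 2 ^ (card N - 1 - card {v, w})" by (simp only: power_add) simp
  ultimately show 1: "8 * card F \<le> 8 * card ((\<lambda>S. S - {u}) ` F) + 2 ^ card N" by linarith
  have "card ((\<lambda>S. S - {u}) ` F) \<le> 2 ^ card (N - {u})"
    using assms by (intro card_sub_Pow image_remove_sub) auto
  moreover have "(2::nat) ^ card N = 2 * 2 ^ card (N - {u})"
    using two_power_split[of u N] assms by simp
  ultimately show "8 * card F \<le> 5 * 2 ^ card N" using 1 by linarith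
qed

text \<open>Projecting away one end gives 3/8 + 1/4 if the pairs are disjoint and 1/2 + 1/8 if they
  meet; both sums are 5/8.\<close>

lemma card_le_unsh2:
  assumes N: "finite N" "F \<subseteq> Pow N" and M: "M \<subseteq> Pow N" "\<And>e. e \<in> M \<Longrightarrow> card e = 2"
    and un: "\<And>u v. {u, v} \<in> M \<Longrightarrow> unsh F u v" and ef: "e \<in> M" "f \<in> M" "e \<noteq> f"
  shows "8 * card F \<le> 5 * 2 ^ card N"
proof (cases "e \<inter> f = {}")
  case True
  obtain a b where e: "e = {a, b}" "a \<noteq> b" using M(2)[OF ef(1)] by (auto simp: card_2_iff)
  obtain c d where f: "f = {c, d}" "c \<noteq> d" using M(2)[OF ef(2)] by (auto simp: card_2_iff)
  have in_N: "a \<in> N" "b \<in> N" "c \<in> N" "d \<in> N" using M(1) ef e f by auto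
  define F' where "F' = (\<lambda>S. S - {a}) ` F"
  have "unsh F' c d" unfolding F'_def
    using True e f ef un[of c d] by (intro unsh_image) auto
  hence "4 * card F' \<le> 3 * 2 ^ card (N - {a})"
    using True e f in_N N unfolding F'_def by (intro card_le_unsh1[of _ _ c d] image_remove_sub) auto
  moreover have "(2::nat) ^ card N = 2 * 2 ^ card (N - {a})"
    using two_power_split[of a N] in_N N by simp
  moreover have "(2::nat) ^ card (N - {a}) = 2 * 2 ^ (card (N - {a}) - 1)"
    using e in_N N by (intro two_power_split[of b]) auto
  moreover have "card F \<le> card F' + 2 ^ (card N - 1 - card {b})"
    unfolding F'_def using e ef un[of a b] in_N N by (intro card_le_star) auto
  moreover have "card N - 1 - card {b} = card (N - {a}) - 1" using in_N N by simp
  ultimately show ?thesis by simp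
next
  case False
  then obtain u where u: "u \<in> e" "u \<in> f" by blast
  obtain v where v: "e = {u, v}" "u \<noteq> v" using M(2)[OF ef(1)] u by (auto simp: card_2_iff)
  obtain w where w: "f = {u, w}" "u \<noteq> w" using M(2)[OF ef(2)] u by (auto simp: card_2_iff)
  show ?thesis
    using v w M(1) ef un[of u v] un[of u w] N by (intro card_le_unsh_path(2)[of N F u v w]) auto
qed

text \<open>The path at \<open>u\<close> costs 1/8. The projection still has one or two unshattered
  pairs, hence density 3/4 or 5/8 on a ground set of half as many subsets: 3/8 + 1/8 and 5/16 +
  1/8.\<close>

lemma card_le_unsh3:
  assumes N: "finite N" "F \<subseteq> Pow N" and M: "M \<subseteq> Pow N" "\<And>e. e \<in> M \<Longrightarrow> card e = 2"
    and un: "\<And>u v. {u, v} \<in> M \<Longrightarrow> unsh F u v"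
    and path: "{u, v} \<in> M" "{u, w} \<in> M" "v \<noteq> w" and e: "e \<in> M" "u \<notin> e"
  shows "2 * card F \<le> 2 ^ card N"
    and "f \<in> M \<Longrightarrow> u \<notin> f \<Longrightarrow> e \<noteq> f \<Longrightarrow> 16 * card F \<le> 7 * 2 ^ card N"
proof -
  have "u \<noteq> v" "u \<noteq> w" using path M(2)[of "{u, v}"] M(2)[of "{u, w}"] by auto
  hence d: "distinct [u, v, w]" "u \<in> N" "v \<in> N" "w \<in> N" using path M(1) by auto
  define F' where "F' = (\<lambda>S. S - {u}) ` F"
  have p: "8 * card F \<le> 8 * card F' + 2 ^ card N"
    unfolding F'_def using d path un N by (intro card_le_unsh_path(1)[of N F u v w]) auto
  have tw: "(2::nat) ^ card N = 2 * 2 ^ card (N - {u})"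
    using two_power_split[of u N] d N by simp
  obtain a b where ab: "e = {a, b}" "a \<noteq> b" using M(2)[OF e(1)] by (auto simp: card_2_iff)
  have "4 * card F' \<le> 3 * 2 ^ card (N - {u})"
    unfolding F'_def using ab e M(1) N un[of a b]
    by (intro card_le_unsh1[of _ _ a b] image_remove_sub unsh_image) auto
  thus "2 * card F \<le> 2 ^ card N" using p tw by linarith
  assume f: "f \<in> M" "u \<notin> f" "e \<noteq> f"
  have "8 * card F' \<le> 5 * 2 ^ card (N - {u})"
  proof (rule card_le_unsh2[where M = "{e, f}" and e = e and f = f])
    show "finite (N - {u})" using N by simp
    show "F' \<subseteq> Pow (N - {u})" unfolding F'_def by (rule image_remove_sub[OF N(2)])
    show "{e, f} \<subseteq> Pow (N - {u})" using e f M(1) by blast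
    show "card g = 2" if "g \<in> {e, f}" for g using that e(1) f(1) M(2) by blast
    fix x y assume xy: "{x, y} \<in> {e, f}"
    hence "x \<in> e \<union> f" "y \<in> e \<union> f" "{x, y} \<in> M" using e(1) f(1) by blast+
    moreover from this have "u \<noteq> x" "u \<noteq> y" using e(2) f(2) by blast+
    ultimately show "unsh F' x y" unfolding F'_def using un unsh_image by metis
  qed (use f(3) in simp_all)
  thus "16 * card F \<le> 7 * 2 ^ card N" using p tw by linarith
qed

subsection \<open>Unshattered pairs around a centre and the deletion argument\<close>

lemma sv_sub: "orientation_of E R \<Longrightarrow> sv K R w \<subseteq> nbh E w \<inter> K"
  unfolding sv_def nbh_def using orient_edge by fastforce

lemma sum_nbh_le:
  assumes g: "sgraph V E" and K: "K \<subseteq> V"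
  shows "(\<Sum>w\<in>V - K. card (nbh E w \<inter> K)) \<le> (\<Sum>u\<in>K. card (nbh E u))"
proof -
  have fin: "finite V" "finite K" using g K sgraph_finite finite_subset by blast+
  have "(\<Sum>w\<in>V - K. card (nbh E w \<inter> K)) = (\<Sum>w\<in>V - K. \<Sum>u\<in>K. if u \<in> nbh E w then 1 else 0)"
    using fin by (simp add: sum.If_cases Int_commute)
  also have "\<dots> = (\<Sum>u\<in>K. \<Sum>w\<in>V - K. if w \<in> nbh E u then 1 else 0)"
    by (subst sum.swap) (simp only: nbh_sym)
  also have "\<dots> = (\<Sum>u\<in>K. card (nbh E u \<inter> (V - K)))"
    using fin by (simp add: sum.If_cases Int_commute)
  also have "\<dots> \<le> (\<Sum>u\<in>K. card (nbh E u))"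
    by (intro sum_mono card_mono finite_nbh[OF g]) auto
  finally show ?thesis .
qed

lemma card_edges_split:
  assumes g: "sgraph V E" and K: "K \<subseteq> V"
  shows "card E = card {e\<in>E. e \<subseteq> K} + (\<Sum>w\<in>V - K. card (nbh E w \<inter> K)) + card (del E K)"
proof -
  have fin: "finite V" "finite K" "finite E"
    using g K sgraph_finite finite_subset sgraph_finite_edges by blast+
  define C where "C = {e\<in>E. e \<inter> K \<noteq> {} \<and> \<not> e \<subseteq> K}"
  have "bij_betw (\<lambda>(w, x). {w, x}) (SIGMA w:V - K. nbh E w \<inter> K) C"
    unfolding bij_betw_def
  proof
    show "inj_on (\<lambda>(w, x). {w, x}) (SIGMA w:V - K. nbh E w \<inter> K)"
      by (auto simp: inj_on_def doubleton_eq_iff)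
    show "(\<lambda>(w, x). {w, x}) ` (SIGMA w:V - K. nbh E w \<inter> K) = C"
    proof
      show "(\<lambda>(w, x). {w, x}) ` (SIGMA w:V - K. nbh E w \<inter> K) \<subseteq> C"
        unfolding C_def nbh_def by (auto simp: insert_commute)
      show "C \<subseteq> (\<lambda>(w, x). {w, x}) ` (SIGMA w:V - K. nbh E w \<inter> K)"
      proof
        fix e assume e: "e \<in> C"
        then obtain u v where uv: "u \<in> V" "v \<in> V" "e = {u, v}" "e \<in> E"
          using g unfolding C_def sgraph_def by fast
        have "(u \<in> K \<and> v \<notin> K) \<or> (u \<notin> K \<and> v \<in> K)" using e uv unfolding C_def by auto
        then obtain w x where "w \<in> V - K" "x \<in> K" "e = {w, x}" using uv by (metis DiffI insert_commute)
        moreover from this have "x \<in> nbh E w" using uv unfolding nbh_def by (simp add: insert_commute)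
        ultimately have "(w, x) \<in> (SIGMA w:V - K. nbh E w \<inter> K)" "e = (\<lambda>(w, x). {w, x}) (w, x)" by auto
        thus "e \<in> (\<lambda>(w, x). {w, x}) ` (SIGMA w:V - K. nbh E w \<inter> K)" by (rule rev_image_eqI)
      qed
    qed
  qed
  hence "card C = card (SIGMA w:V - K. nbh E w \<inter> K)" by (metis bij_betw_same_card)
  also have "\<dots> = (\<Sum>w\<in>V - K. card (nbh E w \<inter> K))" using fin by (intro card_SigmaI) auto
  finally have C: "card C = (\<Sum>w\<in>V - K. card (nbh E w \<inter> K))" .
  have ne: "e \<noteq> {}" if "e \<in> E" for e using g that unfolding sgraph_def by blast
  have E: "E = ({e\<in>E. e \<subseteq> K} \<union> C) \<union> del E K" unfolding C_def del_def by blast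
  have "card E = card ({e\<in>E. e \<subseteq> K} \<union> C) + card (del E K)"
  proof (subst E, rule card_Un_disjoint)
    show "({e \<in> E. e \<subseteq> K} \<union> C) \<inter> del E K = {}" unfolding C_def del_def using ne by blast
  qed (use fin in \<open>auto simp: C_def del_def\<close>)
  also have "card ({e\<in>E. e \<subseteq> K} \<union> C) = card {e\<in>E. e \<subseteq> K} + card C"
    by (rule card_Un_disjoint) (use fin in \<open>auto simp: C_def\<close>)
  finally show ?thesis using C by simp
qed

lemma sum_degrees:
  assumes g: "sgraph V E"
  shows "(\<Sum>v\<in>V. card (nbh E v)) = 2 * card E"
  using g
proof (induction "card V" arbitrary: V E)
  case 0
  hence "V = {}" using sgraph_finite by auto
  moreover from this 0 have "E = {}" unfolding sgraph_def by blast
  ultimately show ?case by simp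
next
  case (Suc n)
  have fV: "finite V" using Suc.prems sgraph_finite by blast
  then obtain a where a: "a \<in> V" using Suc.hyps(2) by (metis card_eq_0_iff ex_in_conv nat.distinct(1))
  let ?E = "del E {a}"
  have g': "sgraph (V - {a}) ?E" using sgraph_del[OF Suc.prems] .
  have IH: "(\<Sum>v\<in>V - {a}. card (nbh ?E v)) = 2 * card ?E"
    using Suc.hyps(1)[OF _ g'] Suc.hyps(2) a fV by simp
  have no: "{e\<in>E. e \<subseteq> {a}} = {}"
    using Suc.prems unfolding sgraph_def by fastforce
  have split: "card E = (\<Sum>w\<in>V - {a}. card (nbh E w \<inter> {a})) + card ?E"
    using card_edges_split[OF Suc.prems, of "{a}"] a no by simp
  have nb: "card (nbh E v) = card (nbh E v \<inter> {a}) + card (nbh ?E v)" if "v \<in> V - {a}" for v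
  proof -
    have "nbh E v = (nbh E v \<inter> {a}) \<union> nbh ?E v" "(nbh E v \<inter> {a}) \<inter> nbh ?E v = {}"
      using that unfolding nbh_def del_def by auto
    thus ?thesis using finite_nbh[OF Suc.prems] finite_nbh[OF g'] by (metis card_Un_disjoint finite_Int)
  qed
  have da: "card (nbh E a) = (\<Sum>w\<in>V - {a}. card (nbh E w \<inter> {a}))"
  proof -
    have "(\<Sum>w\<in>V - {a}. card (nbh E w \<inter> {a})) = (\<Sum>w\<in>V - {a}. if w \<in> nbh E a then 1 else 0)"
      by (intro sum.cong) (auto simp: nbh_sym[of a] Int_insert_right)
    also have "\<dots> = card ((V - {a}) \<inter> nbh E a)" using fV by (simp add: sum.If_cases)
    also have "(V - {a}) \<inter> nbh E a = nbh E a" using nbh_sub[OF Suc.prems] by blast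
    finally show ?thesis by simp
  qed
  have "(\<Sum>v\<in>V. card (nbh E v)) = card (nbh E a) + (\<Sum>v\<in>V - {a}. card (nbh E v))"
    using fV a by (simp add: sum.remove)
  also have "(\<Sum>v\<in>V - {a}. card (nbh E v)) = (\<Sum>v\<in>V - {a}. card (nbh E v \<inter> {a})) + (\<Sum>v\<in>V - {a}. card (nbh ?E v))"
    using nb by (simp add: sum.distrib)
  finally show ?case using IH split da by simp
qed

section \<open>From missing triangle types to unshattered pairs, and the deletion argument\<close>

context fan_types
begin

lemma FO_orient: "R \<in> FO E \<Longrightarrow> orientation_of E R"
  unfolding FO_def by simp

lemma traces_sub: "T \<subseteq> FO E \<Longrightarrow> traces K T w \<subseteq> Pow (nbh E w \<inter> K)"
  unfolding traces_def by (intro image_subsetI PowI sv_sub FO_orient) (rule subsetD)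

text \<open>All members of \<open>T\<close> direct \<open>uv\<close> alike, so the excluded triangle
  excludes the same orientation of \<open>uw\<close>, \<open>vw\<close> for all of them. The centre
  is in \<open>K\<close> when covers are guessed; the alternative with centre \<open>w\<close>
  serves the final count.\<close>

lemma unsh_spoke:
  assumes g: "sgraph V E" and T: "T \<subseteq> FO E"
    and agree: "agree_on K T"
    and uv: "u \<in> K" "v \<in> K" "{u, v} \<in> E" and w: "{u, w} \<in> E" "{v, w} \<in> E"
    and tri: "(\<forall>R\<in>T. \<not> tri R t u v w) \<or> (\<forall>R\<in>T. \<not> tri R t w u v)"
  shows "unsh (traces K T w) u v"
proof (cases "T = {}")
  case True thus ?thesis unfolding unsh_def traces_def by simp
next
  case False
  then obtain R0 where R0: "R0 \<in> T" by blast
  have o: "orientation_of E R" if "R \<in> T" for R using that T FO_orient by blast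
  have uvR: "(u, v) \<in> R \<longleftrightarrow> (u, v) \<in> R0" "(v, u) \<in> R \<longleftrightarrow> (u, v) \<notin> R0" if "R \<in> T" for R
  proof -
    show "(u, v) \<in> R \<longleftrightarrow> (u, v) \<in> R0" using agree_onD[OF agree that R0] uv by blast
    thus "(v, u) \<in> R \<longleftrightarrow> (u, v) \<notin> R0" using orient_iff[OF g o[OF that] uv(3)] by blast
  qed
  have rw: "u \<in> sv K R w \<longleftrightarrow> (u, w) \<in> R" "v \<in> sv K R w \<longleftrightarrow> (v, w) \<in> R" for R
    using uv unfolding sv_def by auto
  have io: "(w, u) \<in> R \<longleftrightarrow> (u, w) \<notin> R" "(w, v) \<in> R \<longleftrightarrow> (v, w) \<notin> R" if "R \<in> T" for R
    using orient_iff[OF g o[OF that]] w by blast+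
  show ?thesis
  proof (cases "\<forall>R\<in>T. \<not> tri R t u v w")
    case True
    show ?thesis unfolding unsh_def traces_def
    \<comment> \<open>With centre \<open>u\<close>, the edge \<open>uw\<close> must run opposite to
      \<open>uv\<close> as seen from \<open>u\<close>, and \<open>t\<close> then decides the
      direction of \<open>vw\<close>.\<close>
    proof (rule exI[of _ "(u, v) \<notin> R0"], rule exI[of _ "((u, v) \<in> R0) = t"], rule ballI)
      fix S assume "S \<in> (\<lambda>R. sv K R w) ` T"
      then obtain R where R: "R \<in> T" "S = sv K R w" by blast
      have "\<not> tri R t u v w" using True R by blast
      thus "\<not> ((u \<in> S) = ((u, v) \<notin> R0) \<and> (v \<in> S) = (((u, v) \<in> R0) = t))"
        unfolding tri_def R(2) rw uvR[OF R(1)] io[OF R(1)] by (cases t) auto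
    qed
  next
    case False
    hence nt: "\<forall>R\<in>T. \<not> tri R t w u v" using tri by blast
    show ?thesis unfolding unsh_def traces_def
    \<comment> \<open>With centre \<open>w\<close>, exactly one of \<open>u\<close>,
      \<open>v\<close> points to \<open>w\<close>, namely \<open>v\<close> if and only if the
      direction of \<open>uv\<close> agrees with \<open>t\<close>.\<close>
    proof (rule exI[of _ "((u, v) \<in> R0) \<noteq> t"], rule exI[of _ "((u, v) \<in> R0) = t"], rule ballI)
      fix S assume "S \<in> (\<lambda>R. sv K R w) ` T"
      then obtain R where R: "R \<in> T" "S = sv K R w" by blast
      have "\<not> tri R t w u v" using nt R by blast
      thus "\<not> ((u \<in> S) = (((u, v) \<in> R0) \<noteq> t) \<and> (v \<in> S) = (((u, v) \<in> R0) = t))"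
        unfolding tri_def R(2) rw uvR[OF R(1)] io[OF R(1)] by (cases t) auto
    qed
  qed
qed

lemma tri_edges:
  assumes "sgraph V E" "orientation_of E R" "tri R t c a b"
  shows "{c, a} \<in> E" "{c, b} \<in> E" "{a, b} \<in> E" "a \<in> V" "b \<in> V" "c \<in> V" "a \<noteq> b" "c \<noteq> a" "c \<noteq> b"
proof -
  have e: "{x, y} \<in> E" if "(x, y) \<in> R \<or> (y, x) \<in> R" for x y
    using that orient_edge[OF assms(2)] by (metis insert_commute)
  show 1: "{c, a} \<in> E" "{c, b} \<in> E" "{a, b} \<in> E"
    using assms(3) unfolding tri_def by (auto intro!: e split: if_splits)
  show "a \<in> V" "b \<in> V" "c \<in> V" "a \<noteq> b" "c \<noteq> a" "c \<noteq> b"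
    using 1 sgraph_edgeD[OF assms(1)] by blast+
qed

text \<open>Otherwise triangles of the three types can be chosen greedily at \<open>c\<close>: the
  last one has only the four ends of the first two to avoid.\<close>

lemma fan_free_cover:
  assumes g: "sgraph V E" and R: "R \<in> FO E" and V: "V \<noteq> {}"
  shows "\<exists>p q r s t. p \<in> V \<and> q \<in> V \<and> r \<in> V \<and> s \<in> V \<and>
           (\<forall>x y. x \<notin> {p, q, r, s} \<longrightarrow> y \<notin> {p, q, r, s} \<longrightarrow> \<not> tri R t c x y)"
proof (rule ccontr)
  assume neg: "\<not> ?thesis"
  have o: "orientation_of E R" using R FO_orient by blast
  have ex: "\<exists>x y. x \<notin> {p, q, r, s} \<and> y \<notin> {p, q, r, s} \<and> tri R t c x y"
    if "p \<in> V" "q \<in> V" "r \<in> V" "s \<in> V" for p q r s t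
    using neg[unfolded not_ex, rule_format, of p q r s t] that by blast
  \<comment> \<open>The vertex \<open>z\<close> only fills the four slots while there is nothing to
    avoid yet.\<close>
  obtain z where z: "z \<in> V" using V by blast
  obtain a1 b1 where 1: "tri R t1 c a1 b1" using ex[OF z z z z] by blast
  note e1 = tri_edges[OF g o 1]
  obtain a2 b2 where 2: "a2 \<notin> {a1, b1}" "b2 \<notin> {a1, b1}" "tri R t2 c a2 b2"
    using ex[OF e1(4,5,4,5)] by blast
  note e2 = tri_edges[OF g o 2(3)]
  obtain a3 b3 where 3: "a3 \<notin> {a1, b1, a2, b2}" "b3 \<notin> {a1, b1, a2, b2}" "tri R t3 c a3 b3"
    using ex[OF e1(4,5) e2(4,5)] by blast
  have "distinct [a1, b1, a2, b2, a3, b3]" using 2 3 e1 e2 tri_edges[OF g o 3(3)] by auto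
  thus False using 1 2 3 R unfolding FO_def fan_free_def by blast
qed

text \<open>The same greedy choice with one end of each triangle prescribed: only the earlier third
  vertices, at most two, and the three prescribed ends are to be avoided.\<close>

lemma fan_free_cover_inner1:
  assumes g: "sgraph V E" and R: "R \<in> FO E" and V: "V \<noteq> {}"
    and x: "distinct [x1, x2, x3]"
  shows "\<exists>x\<in>{x1, x2, x3}. \<exists>t. \<exists>p\<in>V. \<exists>q\<in>V. \<forall>w. w \<notin> {p, q, x1, x2, x3} \<longrightarrow> \<not> tri R t c x w"
proof (rule ccontr)
  assume neg: "\<not> ?thesis"
  have o: "orientation_of E R" using R FO_orient by blast
  define P where "P x t p q \<longleftrightarrow> (\<forall>w. w \<notin> {p, q, x1, x2, x3} \<longrightarrow> \<not> tri R t c x w)" for x t p q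
  have neg': "\<not> (\<exists>x\<in>{x1, x2, x3}. \<exists>t. \<exists>p\<in>V. \<exists>q\<in>V. P x t p q)"
    unfolding P_def by (rule neg)
  have ex: "\<exists>w. w \<notin> {p, q, x1, x2, x3} \<and> tri R t c x w" if "x \<in> {x1, x2, x3}" "p \<in> V" "q \<in> V" for p q x t
  proof -
    have "\<not> P x t p q" using neg' that by blast
    thus ?thesis unfolding P_def by blast
  qed
  obtain z where z: "z \<in> V" using V by blast
  obtain w1 where 1: "w1 \<notin> {x1, x2, x3}" "tri R t1 c x1 w1" using ex[of x1 z z t1] z by blast
  have w1: "w1 \<in> V" using tri_edges[OF g o 1(2)] by blast
  obtain w2 where 2: "w2 \<notin> {w1, x1, x2, x3}" "tri R t2 c x2 w2" using ex[of x2 w1 w1 t2] w1 by blast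
  have w2: "w2 \<in> V" using tri_edges[OF g o 2(2)] by blast
  obtain w3 where 3: "w3 \<notin> {w1, w2, x1, x2, x3}" "tri R t3 c x3 w3" using ex[of x3 w1 w2 t3] w1 w2 by blast
  have "distinct [x1, w1, x2, w2, x3, w3]" using 1 2 3 x by auto
  thus False using 1 2 3 R unfolding FO_def fan_free_def by blast
qed

text \<open>Here a triangle of the first type is already present at \<open>c\<close>, so two
  prescribed spokes suffice for the greedy choice and a single third vertex has to be
  guessed.\<close>

lemma fan_free_cover_inner2:
  assumes g: "sgraph V E" and R: "R \<in> FO E"
    and x: "distinct [a, b, x2, x3]" and t: "tri R t1 c a b"
  shows "\<exists>x\<in>{x2, x3}. \<exists>t. \<exists>p\<in>V. \<forall>w. w \<notin> {p, a, b, x2, x3} \<longrightarrow> \<not> tri R t c x w"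
proof (rule ccontr)
  assume neg: "\<not> ?thesis"
  have o: "orientation_of E R" using R FO_orient by blast
  define P where "P x t p \<longleftrightarrow> (\<forall>w. w \<notin> {p, a, b, x2, x3} \<longrightarrow> \<not> tri R t c x w)" for x t p
  have neg': "\<not> (\<exists>x\<in>{x2, x3}. \<exists>t. \<exists>p\<in>V. P x t p)"
    unfolding P_def by (rule neg)
  have ex: "\<exists>w. w \<notin> {p, a, b, x2, x3} \<and> tri R t c x w" if "x \<in> {x2, x3}" "p \<in> V" for p x t
  proof -
    have "\<not> P x t p" using neg' that by blast
    thus ?thesis unfolding P_def by blast
  qed
  have z: "a \<in> V" using tri_edges[OF g o t] by blast
  obtain w2 where 2: "w2 \<notin> {a, b, x2, x3}" "tri R t2 c x2 w2" using ex[of x2 a t2] z by blast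
  have w2: "w2 \<in> V" using tri_edges[OF g o 2(2)] by blast
  obtain w3 where 3: "w3 \<notin> {w2, a, b, x2, x3}" "tri R t3 c x3 w3" using ex[of x3 w2 t3] w2 by blast
  have "distinct [a, b, x2, w2, x3, w3]" using 2 3 x by auto
  thus False using 2 3 t R unfolding FO_def fan_free_def by blast
qed

text \<open>Here \<open>w\<close> is the centre of all three triangles. For each of the three edges
  some direction of its two spokes gives the wanted type, and the three choices combine to one trace
  \<open>S0\<close> that would create the whole pattern; 63 of 64 traces remain.\<close>

lemma card_traces_matching:
  assumes g: "sgraph V E" and T: "T \<subseteq> FO E"
    and agree: "agree_on K T"
    and K: "K = {a1, b1, a2, b2, a3, b3}" "distinct [a1, b1, a2, b2, a3, b3]"
    and E: "{a1, b1} \<in> E" "{a2, b2} \<in> E" "{a3, b3} \<in> E" and w: "K \<subseteq> nbh E w"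
  shows "card (traces K T w) \<le> 63"
proof (cases "T = {}")
  case True thus ?thesis by (simp add: traces_def)
next
  case False
  then obtain R0 where R0: "R0 \<in> T" by blast
  have o: "orientation_of E R" if "R \<in> T" for R using that T FO_orient by blast
  \<comment> \<open>The end that must point to \<open>w\<close> so that \<open>w\<close> becomes the
    centre of a triangle of type \<open>t\<close> on this edge.\<close>
  define h where "h t a b = (if t = ((a, b) \<in> R0) then b else a)" for t and a b :: nat
  define S0 where "S0 = {h t1 a1 b1, h t2 a2 b2, h t3 a3 b3}"
  have hin: "h t a b \<in> {a, b}" for t a b unfolding h_def by simp
  have S0K: "S0 \<subseteq> K" unfolding S0_def K using hin by (metis (no_types, lifting) empty_subsetI insertCI insertE insert_subset singletonD)
  have trih: "tri R t w a b" if R: "R \<in> T" and ab: "{a, b} \<in> E" "a \<in> K" "b \<in> K" "a \<noteq> b"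
    and s: "sv K R w \<inter> {a, b} = {h t a b}" for R t a b
  proof -
    have "(a, b) \<in> R \<longleftrightarrow> (a, b) \<in> R0" using agree_onD[OF agree R R0] ab by blast
    moreover have "(b, a) \<in> R \<longleftrightarrow> (a, b) \<notin> R" using orient_iff[OF g o[OF R] ab(1)] .
    moreover have "{a, w} \<in> E" "{b, w} \<in> E" using w ab unfolding nbh_def by auto
    hence "(w, a) \<in> R \<longleftrightarrow> (a, w) \<notin> R" "(w, b) \<in> R \<longleftrightarrow> (b, w) \<notin> R"
      using orient_iff[OF g o[OF R]] by blast+
    moreover have "a \<in> sv K R w \<longleftrightarrow> (a, w) \<in> R" "b \<in> sv K R w \<longleftrightarrow> (b, w) \<in> R"
      using ab unfolding sv_def by auto
    moreover have "a \<in> sv K R w \<longleftrightarrow> a = h t a b" "b \<in> sv K R w \<longleftrightarrow> b = h t a b" using s by auto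
    ultimately show ?thesis unfolding tri_def h_def using ab(4) by (auto split: if_splits)
  qed
  have "S0 \<notin> traces K T w"
  proof
    assume "S0 \<in> traces K T w"
    then obtain R where R: "R \<in> T" "sv K R w = S0" unfolding traces_def by blast
    have i: "S0 \<inter> {a1, b1} = {h t1 a1 b1}" "S0 \<inter> {a2, b2} = {h t2 a2 b2}" "S0 \<inter> {a3, b3} = {h t3 a3 b3}"
      unfolding S0_def using K(2) by (auto simp: h_def)
    have "tri R t1 w a1 b1" "tri R t2 w a2 b2" "tri R t3 w a3 b3"
      using trih[OF R(1)] E K i R(2) by auto
    thus False using K(2) R T unfolding FO_def fan_free_def by blast
  qed
  moreover have "traces K T w \<subseteq> Pow K" unfolding traces_def sv_def by auto
  ultimately have "traces K T w \<subseteq> Pow K - {S0}" by blast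
  hence "card (traces K T w) \<le> card (Pow K - {S0})" using K(1) by (intro card_mono) auto
  also have "\<dots> = 63" using K S0K by (simp add: card_Pow)
  finally show ?thesis .
qed

text \<open>Relations inside \<open>K\<close> are bounded crudely by the subsets of
  \<open>K \<times> K\<close>; for bounded \<open>K\<close> this constant is swallowed by any linear
  gain.\<close>

lemma card_le_classes:
  assumes g: "sgraph V E" and K: "K \<subseteq> V" and U: "U \<subseteq> FO E" and Cs: "finite Cs" and c: "\<And>R. R \<in> U \<Longrightarrow> c R \<in> Cs"
    and b: "\<And>I d. real (card {R\<in>U. R \<inter> K \<times> K = I \<and> c R = d}) \<le> b"
  shows "real (card U) \<le> 2 ^ (card K * card K) * real (card Cs) * b"
proof -
  have fK: "finite K" using g K sgraph_finite finite_subset by blast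
  let ?X = "Pow (K \<times> K) \<times> Cs"
  have fX: "finite ?X" using fK Cs by simp
  have "U = (\<Union>(I, d)\<in>?X. {R\<in>U. R \<inter> K \<times> K = I \<and> c R = d})" using c by auto
  hence "card U \<le> (\<Sum>x\<in>?X. card (case x of (I, d) \<Rightarrow> {R\<in>U. R \<inter> K \<times> K = I \<and> c R = d}))"
    using card_UN_le[OF fX, of "\<lambda>(I, d). {R\<in>U. R \<inter> K \<times> K = I \<and> c R = d}"] by (simp only:)
  hence "real (card U) \<le> (\<Sum>x\<in>?X. real (card (case x of (I, d) \<Rightarrow> {R\<in>U. R \<inter> K \<times> K = I \<and> c R = d})))"
    by (simp only: of_nat_sum[symmetric] of_nat_le_iff)
  also have "\<dots> \<le> (\<Sum>x\<in>?X. b)" by (intro sum_mono) (use b in auto)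
  also have "\<dots> = 2 ^ (card K * card K) * real (card Cs) * b"
    using fK by (simp add: card_cartesian_product card_Pow)
  finally show ?thesis .
qed

text \<open>Deleting \<open>S\<close> loses \<open>card S\<close> bits less than \<open>n\<^sup>2 div 4\<close> drops by; the surplus accumulates along
  repeated deletions.\<close>
definition gain :: "nat set \<Rightarrow> nat set set \<Rightarrow> bool" where
  "gain V E \<longleftrightarrow> (\<exists>S. S \<subseteq> V \<and> S \<noteq> {} \<and>
     cnt E * 2 ^ ((card V - card S)\<^sup>2 div 4 + card S) \<le> 2 ^ ((card V)\<^sup>2 div 4) * cnt (del E S))"

text \<open>The induction carries the surplus \<open>(n0\<^sup>2 + n0) - card V\<close> in truncated
  subtraction. Deleting \<open>S\<close> raises it by at most \<open>card S\<close>, which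
  \<open>gain\<close> pays for. Below \<open>n0\<close> vertices it is no smaller than the number of
  edges, so the trivial bound suffices; from \<open>n0\<^sup>2 + n0\<close> vertices on it is
  zero.\<close>

lemma cnt_bound_from_step:
  assumes step: "\<And>V E. sgraph V E \<Longrightarrow> card V \<ge> n0 \<Longrightarrow> cnt E \<le> 2 ^ ((card V)\<^sup>2 div 4 + 6) \<or> gain V E"
  assumes g: "sgraph V E"
  shows "cnt E \<le> 2 ^ ((card V)\<^sup>2 div 4 + 6 + ((n0\<^sup>2 + n0) - card V))"
  using g
proof (induction "card V" arbitrary: V E rule: less_induct)
  case less
  have fV: "finite V" using less.prems sgraph_finite by blast
  show ?case
  proof (cases "card V \<ge> n0")
    case False
    have "E \<subseteq> (\<lambda>(u, v). {u, v}) ` (V \<times> V)" using less.prems unfolding sgraph_def by fast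
    hence "card E \<le> card ((\<lambda>(u, v). {u, v}) ` (V \<times> V))" using fV by (intro card_mono) simp_all
    also have "\<dots> \<le> card (V \<times> V)" using fV by (intro card_image_le) simp
    finally have "card E \<le> card V * card V" by (simp add: card_cartesian_product)
    also have "\<dots> \<le> n0 * n0" using False by (intro mult_mono) auto
    finally have "card E \<le> (card V)\<^sup>2 div 4 + 6 + ((n0\<^sup>2 + n0) - card V)"
      using False by (simp add: power2_eq_square)
    hence "(2::nat) ^ card E \<le> 2 ^ ((card V)\<^sup>2 div 4 + 6 + ((n0\<^sup>2 + n0) - card V))"
      by (rule power_increasing) simp
    thus ?thesis using cnt_le[OF less.prems] by linarith
  next
    case True
    from step[OF less.prems True] show ?thesis
    proof
      assume "cnt E \<le> 2 ^ ((card V)\<^sup>2 div 4 + 6)"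
      also have "(2::nat) ^ ((card V)\<^sup>2 div 4 + 6) \<le> 2 ^ ((card V)\<^sup>2 div 4 + 6 + ((n0\<^sup>2 + n0) - card V))"
        by (rule power_increasing) simp_all
      finally show ?thesis .
    next
      assume "gain V E"
      then obtain S where S: "S \<subseteq> V" "S \<noteq> {}"
        and le: "cnt E * 2 ^ ((card V - card S)\<^sup>2 div 4 + card S) \<le> 2 ^ ((card V)\<^sup>2 div 4) * cnt (del E S)"
        unfolding gain_def by blast
      let ?s = "card S" and ?M = "n0\<^sup>2 + n0" and ?t = "(card V - card S)\<^sup>2 div 4"
      have fS: "finite S" using S fV finite_subset by blast
      have s: "?s > 0" "?s \<le> card V" using S fS fV by (auto simp: card_gt_0_iff card_mono)
      have c: "card (V - S) = card V - ?s" using S fS by (simp add: card_Diff_subset)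
      have "cnt (del E S) \<le> 2 ^ (?t + 6 + (?M - (card V - ?s)))"
        using less.hyps[OF _ sgraph_del[OF less.prems], of S] s c by simp
      hence "2 ^ ((card V)\<^sup>2 div 4) * cnt (del E S) \<le> 2 ^ ((card V)\<^sup>2 div 4) * 2 ^ (?t + 6 + (?M - (card V - ?s)))"
        by simp
      also have "\<dots> = 2 ^ ((card V)\<^sup>2 div 4 + (?t + 6 + (?M - (card V - ?s))))" by (simp only: power_add)
      also have "\<dots> \<le> 2 ^ ((card V)\<^sup>2 div 4 + 6 + (?M - card V) + (?t + ?s))"
        by (rule power_increasing) simp_all
      finally have "cnt E * 2 ^ (?t + ?s) \<le> 2 ^ ((card V)\<^sup>2 div 4 + 6 + (?M - card V)) * 2 ^ (?t + ?s)"
        using le by (simp only: power_add)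
      thus ?thesis by simp
    qed
  qed
qed

text \<open>For k = \<open>card K\<close>, the quarter square drops by kn/2 - k^2/4 up to rounding.
  So the allowance is about n/2 bits per deleted vertex; the subtracted terms cover the square, the
  k bits to be gained and the floors.\<close>

lemma gainI:
  assumes fV: "finite V" and K: "K \<subseteq> V" "K \<noteq> {}"
    and le: "real (cnt E) \<le> M * real (cnt (del E K))"
    and M: "M \<le> 2 powr (real (card K) * real (card V) / 2 - real ((card K)\<^sup>2) - real (card K) - 1)"
  shows "gain V E"
proof -
  let ?n = "card V" and ?k = "card K" and ?c = "cnt (del E K)"
  have kn: "?k \<le> ?n" using fV K by (intro card_mono)
  let ?t = "(?n - ?k)\<^sup>2 div 4"
  have "4 * (?n\<^sup>2 div 4) + 3 \<ge> ?n\<^sup>2" by presburger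
  hence "4 * real (?n\<^sup>2 div 4) + 3 \<ge> real (?n\<^sup>2)" by linarith
  moreover have "4 * ?t \<le> (?n - ?k)\<^sup>2" by presburger
  hence "4 * real ?t \<le> real ((?n - ?k)\<^sup>2)" by linarith
  moreover have "real ((?n - ?k)\<^sup>2) = real (?n\<^sup>2) - 2 * (real ?k * real ?n) + real (?k\<^sup>2)"
    using kn by (simp add: of_nat_diff power2_diff)
  moreover have "real (?k\<^sup>2) \<ge> 0" by (rule of_nat_0_le_iff)
  moreover have "real (?t + ?k) = real ?t + real ?k" by simp
  ultimately have ex: "(real ?k * real ?n / 2 - real (?k\<^sup>2) - real ?k - 1) + real (?t + ?k) \<le> real (?n\<^sup>2 div 4)"
    by linarith
  have pw: "real (2 ^ m) = 2 powr real m" for m by (simp add: powr_realpow)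
  have "real (cnt E * 2 ^ (?t + ?k)) = real (cnt E) * 2 powr real (?t + ?k)"
    by (simp only: pw of_nat_mult)
  also have "\<dots> \<le> (M * real ?c) * 2 powr real (?t + ?k)" using le by (intro mult_right_mono) auto
  also have "\<dots> \<le> (2 powr (real ?k * real ?n / 2 - real (?k\<^sup>2) - real ?k - 1) * real ?c) * 2 powr real (?t + ?k)"
    using M by (intro mult_right_mono) auto
  also have "\<dots> = 2 powr ((real ?k * real ?n / 2 - real (?k\<^sup>2) - real ?k - 1) + real (?t + ?k)) * real ?c"
    by (subst powr_add) simp
  also have "\<dots> \<le> 2 powr real (?n\<^sup>2 div 4) * real ?c"
    using ex by (intro mult_right_mono) auto
  also have "\<dots> = real (2 ^ (?n\<^sup>2 div 4) * ?c)" by (simp only: pw of_nat_mult)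
  finally have "cnt E * 2 ^ (?t + ?k) \<le> 2 ^ (?n\<^sup>2 div 4) * ?c" by (simp only: of_nat_le_iff)
  thus ?thesis unfolding gain_def using K by blast
qed

end

subsection \<open>Configurations with exponential gain\<close>

lemma eventually_log_le:
  assumes "a > 0"
  shows "\<forall>\<^sub>F n in sequentially. C + m * log 2 (real n) \<le> a * real n"
proof -
  have "((\<lambda>n. C / real n + m * (log 2 (real n) / real n)) \<longlongrightarrow> 0 + m * 0) sequentially"
    by (intro tendsto_intros; real_asymp)
  hence "\<forall>\<^sub>F n in sequentially. C / real n + m * (log 2 (real n) / real n) < a"
    using assms order_tendstoD(2)[of _ 0 sequentially a] by simp
  thus ?thesis using eventually_gt_at_top[of 0]
  proof eventually_elim
    case (elim n)
    have "C + m * log 2 (real n) = (C / real n + m * (log 2 (real n) / real n)) * real n"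
      using elim(2) by (simp add: field_simps)
    also have "\<dots> \<le> a * real n" using elim(1) by (intro mult_right_mono) auto
    finally show ?case .
  qed
qed

lemma powr_two_log_power: "n > 0 \<Longrightarrow> real n ^ m = 2 powr (real m * log 2 (real n))"
  by (simp add: powr_realpow[symmetric] powr_powr[symmetric] mult.commute powr_def log_def)

lemma two_powr_nat: "(2::real) ^ m = 2 powr real m"
  by (simp add: powr_realpow)

text \<open>One threshold that makes the exponential gains of all sparse configurations beat their
  polynomial overheads.\<close>
definition large :: "nat \<Rightarrow> bool" where
  "large n \<longleftrightarrow> n \<ge> 4000000000 \<and> 1000 + 4 * log 2 (real n) \<le> (1 / 40000) * real n"

lemma eventually_large: "\<forall>\<^sub>F n in sequentially. large n"
  unfolding large_def by (intro eventually_conj eventually_ge_at_top eventually_log_le) simp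

lemma largeD:
  assumes "large n"
  shows "real n \<ge> 4000000000" "n > 0" "1000 + 4 * log 2 (real n) \<le> (1 / 40000) * real n" "0 \<le> log 2 (real n)"
  using assms unfolding large_def by auto

section \<open>Guessed covers and products over the outside vertices\<close>

context fan_types
begin

definition covers :: "nat set \<Rightarrow> (nat \<times> nat) set \<Rightarrow> nat \<Rightarrow> nat set \<times> bool \<Rightarrow> bool" where
  "covers V R c = (\<lambda>(C, t). (\<forall>x y. x \<notin> C \<longrightarrow> y \<notin> C \<longrightarrow> \<not> tri R t c x y))"

text \<open>As images of quadruples these sets may have fewer than four elements, and their number
  is at most a fourth power.\<close>

definition cover_sets :: "nat set \<Rightarrow> nat set set" where
  "cover_sets V = (\<lambda>(p, q, r, s). {p, q, r, s}) ` (V \<times> V \<times> V \<times> V)"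

lemma finite_cover_sets: "finite V \<Longrightarrow> finite (cover_sets V)"
  unfolding cover_sets_def by simp

lemma card_cover_sets: "finite V \<Longrightarrow> card (cover_sets V) \<le> card V ^ 4"
proof -
  assume "finite V"
  hence "card (cover_sets V) \<le> card (V \<times> V \<times> V \<times> V)"
    unfolding cover_sets_def by (intro card_image_le) simp
  thus ?thesis by (simp add: card_cartesian_product power4_eq_xxxx)
qed

lemma cover_sets_card4: "C \<in> cover_sets V \<Longrightarrow> finite C \<and> card C \<le> 4 \<and> C \<subseteq> V"
proof -
  assume "C \<in> cover_sets V"
  then obtain p q r s where C: "C = {p, q, r, s}" "{p, q, r, s} \<subseteq> V" unfolding cover_sets_def by auto
  have "card (set [p, q, r, s]) \<le> length [p, q, r, s]" by (rule card_length)
  thus ?thesis using C by simp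
qed

text \<open>A fixed choice makes the exceptional set and the missing type functions of
  \<open>R\<close>, by which orientations can be sorted into classes.\<close>

definition cover_of :: "nat set \<Rightarrow> (nat \<times> nat) set \<Rightarrow> nat \<Rightarrow> nat set \<times> bool" where
  "cover_of V R c = (SOME d. fst d \<in> cover_sets V \<and> covers V R c d)"

lemma cover_of:
  assumes "sgraph V E" "R \<in> FO E" "V \<noteq> {}"
  shows "cover_of V R c \<in> cover_sets V \<times> UNIV" "covers V R c (cover_of V R c)"
proof -
  obtain p q r s t where "p \<in> V" "q \<in> V" "r \<in> V" "s \<in> V"
    "\<forall>x y. x \<notin> {p, q, r, s} \<longrightarrow> y \<notin> {p, q, r, s} \<longrightarrow> \<not> tri R t c x y"
    using fan_free_cover[OF assms, of c] by metis
  hence "fst ({p, q, r, s}, t) \<in> cover_sets V \<and> covers V R c ({p, q, r, s}, t)"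
    unfolding covers_def cover_sets_def by (auto intro!: rev_image_eqI[of "(p, q, r, s)"])
  hence "fst (cover_of V R c) \<in> cover_sets V \<and> covers V R c (cover_of V R c)"
    unfolding cover_of_def by (rule someI)
  thus "cover_of V R c \<in> cover_sets V \<times> UNIV" "covers V R c (cover_of V R c)"
    by (auto simp: mem_Times_iff)
qed

lemma unsh_cover:
  assumes g: "sgraph V E" and T: "T \<subseteq> FO E"
    and agree: "agree_on K T"
    and cov: "\<And>R. R \<in> T \<Longrightarrow> covers V R u (C, t)"
    and uv: "u \<in> K" "v \<in> K" "{u, v} \<in> E" "{u, w} \<in> E" "{v, w} \<in> E" "v \<notin> C" "w \<notin> C"
  shows "unsh (traces K T w) u v"
proof (rule unsh_spoke[OF g T agree uv(1-5)])
  show "(\<forall>R\<in>T. \<not> tri R t u v w) \<or> (\<forall>R\<in>T. \<not> tri R t w u v)"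
    using cov uv unfolding covers_def by blast
qed

text \<open>Savings relative to the number of edges into \<open>K\<close>. This fits sets
  \<open>K\<close> whose degrees barely exceed n/2, where the trivial count is already close to the
  allowance.\<close>

lemma card_class_ratio:
  assumes g: "sgraph V E" and K: "K \<subseteq> V" and T: "T \<subseteq> FO E"
    and agree: "agree_on K T"
    and r: "0 \<le> r" and W: "W \<subseteq> V - K"
    and ratio: "\<And>w. w \<in> W \<Longrightarrow> real (card (traces K T w)) \<le> r * 2 ^ card (nbh E w \<inter> K)"
  shows "real (card T) \<le> r ^ card W * 2 ^ (\<Sum>w\<in>V - K. card (nbh E w \<inter> K)) * real (cnt (del E K))"
proof -
  have fin: "finite V" using g sgraph_finite by blast
  have triv: "card (traces K T w) \<le> 2 ^ card (nbh E w \<inter> K)" for w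
    using traces_sub[OF T] finite_nbh[OF g] by (intro card_sub_Pow) auto
  have "real (\<Prod>w\<in>V - K. card (traces K T w)) =
      (\<Prod>w\<in>V - K. real (card (traces K T w)))" by simp
  also have "\<dots> \<le> (\<Prod>w\<in>V - K. (if w \<in> W then r else 1) * 2 ^ card (nbh E w \<inter> K))"
  proof (rule prod_mono, rule conjI)
    fix w
    show "real (card (traces K T w)) \<le> (if w \<in> W then r else 1) * 2 ^ card (nbh E w \<inter> K)"
      using ratio[of w] of_nat_mono[OF triv[of w], where 'a = real] by simp
  qed simp
  also have "\<dots> = (\<Prod>w\<in>V - K. if w \<in> W then r else 1) * (\<Prod>w\<in>V - K. 2 ^ card (nbh E w \<inter> K))"
    by (rule prod.distrib)
  also have "(\<Prod>w\<in>V - K. if w \<in> W then r else 1) = r ^ card W"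
    using fin W by (simp add: prod.If_cases Int_absorb1)
  also have "(\<Prod>w\<in>V - K. (2::real) ^ card (nbh E w \<inter> K)) = 2 ^ (\<Sum>w\<in>V - K. card (nbh E w \<inter> K))"
    by (simp add: power_sum)
  finally have "real (\<Prod>w\<in>V - K. card (traces K T w)) * real (cnt (del E K)) \<le>
      r ^ card W * 2 ^ (\<Sum>w\<in>V - K. card (nbh E w \<inter> K)) * real (cnt (del E K))"
    by (rule mult_right_mono) simp
  moreover have "real (card T) \<le> real ((\<Prod>w\<in>V - K. card (traces K T w)) * cnt (del E K))"
    by (rule of_nat_mono) (rule card_class_le[OF g K T agree])
  ultimately show ?thesis by simp
qed

text \<open>The absolute counterpart, for sets \<open>K\<close> whose degrees are not controlled.
  Exceptional vertices \<open>W\<close> are charged one bit for each vertex of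
  \<open>K\<close>.\<close>

lemma card_class_const:
  assumes g: "sgraph V E" and K: "K \<subseteq> V" and T: "T \<subseteq> FO E"
    and agree: "agree_on K T"
    and b: "1 \<le> b" and W: "finite W"
    and bd: "\<And>w. w \<in> V - K - W \<Longrightarrow> real (card (traces K T w)) \<le> b"
  shows "real (card T) \<le> b ^ card V * 2 ^ (card K * card W) * real (cnt (del E K))"
proof -
  have fin: "finite V" "finite K" using g K sgraph_finite finite_subset by blast+
  have triv: "card (traces K T w) \<le> 2 ^ card K" for w
    using fin by (intro card_sub_Pow) (auto simp: sv_def traces_def)
  have "real (\<Prod>w\<in>V - K. card (traces K T w)) =
      (\<Prod>w\<in>V - K. real (card (traces K T w)))" by simp
  also have "\<dots> \<le> (\<Prod>w\<in>V - K. b * (if w \<in> W then 2 ^ card K else 1))"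
  proof (rule prod_mono, rule conjI)
    fix w assume w: "w \<in> V - K"
    have "real (card (traces K T w)) \<le> 2 ^ card K"
      using of_nat_mono[OF triv[of w], where 'a = real] by simp
    also have "(2::real) ^ card K \<le> b * 2 ^ card K" using b by simp
    finally show "real (card (traces K T w)) \<le> b * (if w \<in> W then 2 ^ card K else 1)"
      using bd[of w] w by auto
  qed simp
  also have "\<dots> = b ^ card (V - K) * (\<Prod>w\<in>V - K. if w \<in> W then 2 ^ card K else 1)"
    by (simp add: prod.distrib)
  also have "(\<Prod>w\<in>V - K. if w \<in> W then 2 ^ card K else 1) = (2::real) ^ (card K * card ((V - K) \<inter> W))"
    using fin by (simp add: prod.If_cases power_mult)
  also have "b ^ card (V - K) * 2 ^ (card K * card ((V - K) \<inter> W)) \<le> b ^ card V * 2 ^ (card K * card W)"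
    using b fin W by (intro mult_mono power_increasing card_mono mult_left_mono) auto
  finally have "real (\<Prod>w\<in>V - K. card (traces K T w)) * real (cnt (del E K)) \<le>
      b ^ card V * 2 ^ (card K * card W) * real (cnt (del E K))"
    by (rule mult_right_mono) simp
  moreover have "real (card T) \<le> real ((\<Prod>w\<in>V - K. card (traces K T w)) * cnt (del E K))"
    by (rule of_nat_mono) (rule card_class_le[OF g K T agree])
  ultimately show ?thesis by simp
qed

text \<open>Each centre in \<open>Z\<close> costs a factor two for its missing type and a fourth
  power for its exceptional set; inside a class both are constant.\<close>

lemma cnt_le_centers:
  assumes g: "sgraph V E" and K: "K \<subseteq> V" and Z: "Z \<subseteq> V" and b0: "0 \<le> b"
    and b: "\<And>T C t. T \<subseteq> FO E \<Longrightarrow> agree_on K T \<Longrightarrow>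
      (\<And>u R. u \<in> Z \<Longrightarrow> R \<in> T \<Longrightarrow> covers V R u (C u, t u)) \<Longrightarrow>
      (\<And>u. u \<in> Z \<Longrightarrow> finite (C u) \<and> card (C u) \<le> 4) \<Longrightarrow> real (card T) \<le> b"
  shows "real (cnt E) \<le> 2 ^ (card K * card K) * (2 * real (card V) ^ 4) ^ card Z * b"
proof -
  have fV: "finite V" and fZ: "finite Z" using g Z sgraph_finite finite_subset by blast+
  define c where "c R = restrict (cover_of V R) Z" for R
  let ?Cs = "Z \<rightarrow>\<^sub>E (cover_sets V \<times> (UNIV :: bool set))"
  have "real (card (FO E)) \<le> 2 ^ (card K * card K) * real (card ?Cs) * b"
  proof (rule card_le_classes[OF g K order_refl])
    show "finite ?Cs" using fV fZ by (intro finite_PiE finite_cartesian_product finite_cover_sets) auto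
    show "c R \<in> ?Cs" if "R \<in> FO E" for R
      unfolding c_def using cover_of(1)[OF g that] Z by (intro restrict_PiE_iff[THEN iffD2] ballI) blast
    fix I d
    define T where "T = {R\<in>FO E. R \<inter> K \<times> K = I \<and> c R = d}"
    show "real (card {R\<in>FO E. R \<inter> K \<times> K = I \<and> c R = d}) \<le> b"
    proof (cases "T = {}")
      case True
      thus ?thesis unfolding T_def[symmetric] using b0 by simp
    next
      case False
      then obtain R0 where R0: "R0 \<in> T" by blast
      have cd: "cover_of V R u = d u" if "R \<in> T" "u \<in> Z" for R u
        using that unfolding T_def c_def by auto
      show ?thesis unfolding T_def[symmetric]
      proof (rule b[of T "\<lambda>u. fst (d u)" "\<lambda>u. snd (d u)"])
        show "T \<subseteq> FO E" unfolding T_def by blast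
        show "agree_on K T" unfolding agree_on_def T_def by blast
        fix u assume u: "u \<in> Z"
        hence V: "V \<noteq> {}" using Z by blast
        show "covers V R u (fst (d u), snd (d u))" if "R \<in> T" for R
          using cover_of(2)[OF g _ V, of R u] cd[OF that u] that unfolding T_def by simp
        have "cover_of V R0 u \<in> cover_sets V \<times> UNIV" using R0 V unfolding T_def by (intro cover_of(1)[OF g]) auto
        hence "fst (d u) \<in> cover_sets V" using cd[OF R0 u] by auto
        thus "finite (fst (d u)) \<and> card (fst (d u)) \<le> 4" using cover_sets_card4 by blast
      qed
    qed
  qed
  also have "real (card ?Cs) \<le> (2 * real (card V) ^ 4) ^ card Z"
  proof -
    have "real (card (cover_sets V)) \<le> real (card V ^ 4)"
      by (rule of_nat_mono) (rule card_cover_sets[OF fV])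
    thus ?thesis using fZ by (auto simp: card_PiE card_cartesian_product intro!: power_mono)
  qed
  finally show ?thesis unfolding cnt_def using b0 by (simp add: mult_left_mono mult_right_mono)
qed

lemma gainI_log:
  assumes "finite V" "K \<subseteq> V" "card K = k" "k > 0"
    and "real (cnt E) \<le> 2 powr L * real (cnt (del E K))"
    and "L \<le> real k * real (card V) / 2 - real (k\<^sup>2) - real k - 1"
  shows "gain V E"
  using assms by (intro gainI[of V K E "2 powr L"]) auto

text \<open>The common balance sheet in bits: the inside of \<open>K\<close>, the guesses
  \<open>a + b * log 2 n\<close>, a saving of \<open>\<epsilon>\<close> at each of \<open>m\<close>
  vertices, and \<open>s\<close> free bits. A negative \<open>\<epsilon>\<close> accommodates
  absolute bounds per vertex.\<close>

lemma gain_num: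
  fixes \<epsilon> :: real
  assumes V: "finite V" "K \<subseteq> V" "card K = k" "k > 0" "card V = n" "n > 0"
    and le: "real (cnt E) \<le> 2 ^ (k * k) * (2 ^ a * real n ^ b) * (r ^ m * 2 ^ s * real (cnt (del E K)))"
    and r: "0 \<le> r" "r \<le> 2 powr (- \<epsilon>)"
    and num: "real (k * k) + (real a + real b * log 2 (real n)) + (real m * (- \<epsilon>) + real s)
       \<le> real k * real n / 2 - real (k\<^sup>2) - real k - 1"
  shows "gain V E"
proof (rule gainI_log[OF V(1-4) _ num[folded V(5)]])
  have "r ^ m \<le> (2 powr (- \<epsilon>)) ^ m" using r by (intro power_mono) auto
  also have "\<dots> = 2 powr (real m * (- \<epsilon>))" by (subst powr_power) simp_all
  finally have rm: "r ^ m \<le> 2 powr (real m * (- \<epsilon>))" .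
  have "real (cnt E) \<le> 2 ^ (k * k) * (2 ^ a * real n ^ b) * (2 powr (real m * (- \<epsilon>)) * 2 ^ s * real (cnt (del E K)))"
    using rm by (intro order_trans[OF le] mult_left_mono mult_right_mono) auto
  also have "\<dots> = 2 ^ (k * k) * (2 ^ a * real n ^ b) * (2 powr (real m * (- \<epsilon>)) * 2 ^ s) * real (cnt (del E K))"
    by (simp only: mult.assoc)
  also have "\<dots> = 2 powr (real (k * k) + (real a + real b * log 2 (real (card V))) + (real m * (- \<epsilon>) + real s)) * real (cnt (del E K))"
    unfolding V(5) powr_two_log_power[OF V(6)] by (simp only: two_powr_nat powr_add)
  finally show "real (cnt E) \<le> \<dots>" .
qed

text \<open>\<open>K\<close> has 15 vertices, which allows 15/2 bits per outside vertex. A vertex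
  outside \<open>B\<close> sees at most \<open>z\<close> and seven others of \<open>K\<close>. If it
  sees \<open>z\<close>, all but at most four pairs with \<open>z\<close> are unshattered, and the
  star bound leaves \<open>2 ^ 7 + 2 ^ 4 = 144\<close> traces, below
  \<open>2 powr (36 / 5)\<close>.\<close>

lemma star_gain:
  assumes big: "large n" and g: "sgraph V E" and n: "card V = n" and X: "X \<subseteq> V" and Y: "Y \<subseteq> V"
    and XY: "X \<inter> Y = {}" and Z: "real (card (V - X - Y)) \<le> n / 1000"
    and dX: "\<And>x. x \<in> X \<Longrightarrow> real (card (nbh E x \<inter> X)) \<le> n / 1000"
    and dY: "\<And>y. y \<in> Y \<Longrightarrow> real (card (nbh E y \<inter> Y)) \<le> n / 1000"
    and z: "z \<in> V" and P: "P \<subseteq> nbh E z \<inter> X" and Q: "Q \<subseteq> nbh E z \<inter> Y"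
    and cP: "card P = 7" and cQ: "card Q = 7"
  shows "gain V E"
proof -
  have fV: "finite V" using g sgraph_finite by blast
  have fPQ: "finite P" "finite Q" using cP cQ card.infinite by fastforce+
  define K where "K = insert z (P \<union> Q)"
  have zPQ: "z \<notin> P" "z \<notin> Q" using P Q nbh_sub[OF g, of z] by blast+
  have cK: "card K = 15" unfolding K_def using fPQ cP cQ zPQ P Q XY
    by (subst card_insert_disjoint; simp) (subst card_Un_disjoint; auto)
  have KV: "K \<subseteq> V" unfolding K_def using z P Q X Y by blast
  \<comment> \<open>Off \<open>B\<close>, a vertex of \<open>X\<close> has no neighbour in
    \<open>P\<close> and a vertex of \<open>Y\<close> none in \<open>Q\<close>.\<close>
  define B where "B = (V - X - Y) \<union> (\<Union>p\<in>P. nbh E p \<inter> X) \<union> (\<Union>q\<in>Q. nbh E q \<inter> Y)"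
  have fB: "finite B" unfolding B_def using fV fPQ X Y finite_subset by blast
  have cu: "real (card (\<Union>p\<in>P'. nbh E p \<inter> X')) \<le> 7 * (n / 1000)"
    if "finite P'" "card P' = 7" "\<And>p. p \<in> P' \<Longrightarrow> real (card (nbh E p \<inter> X')) \<le> n / 1000" for P' X'
  proof -
    have "card (\<Union>p\<in>P'. nbh E p \<inter> X') \<le> (\<Sum>p\<in>P'. card (nbh E p \<inter> X'))" by (rule card_UN_le[OF that(1)])
    hence "real (card (\<Union>p\<in>P'. nbh E p \<inter> X')) \<le> (\<Sum>p\<in>P'. real (card (nbh E p \<inter> X')))"
      by (simp only: of_nat_sum[symmetric] of_nat_le_iff)
    also have "\<dots> \<le> (\<Sum>p\<in>P'. n / 1000)" using that(3) by (intro sum_mono) blast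
    also have "\<dots> = 7 * (n / 1000)" using that by simp
    finally show ?thesis .
  qed
  have "card B \<le> card (V - X - Y) + card (\<Union>p\<in>P. nbh E p \<inter> X) + card (\<Union>q\<in>Q. nbh E q \<inter> Y)"
    unfolding B_def by (meson add_mono card_Un_le le_trans order_refl)
  moreover have "real (card (\<Union>p\<in>P. nbh E p \<inter> X)) \<le> 7 * (n / 1000)" using P dX cP fPQ by (intro cu) auto
  moreover have "real (card (\<Union>q\<in>Q. nbh E q \<inter> Y)) \<le> 7 * (n / 1000)" using Q dY cQ fPQ by (intro cu) auto
  \<comment> \<open>Charging 15 bits to each vertex of \<open>B\<close> costs at most 0.225 n, up to
    a constant; the margin 15/2 - 36/5 = 0.3 absorbs it.\<close>
  ultimately have cB: "real (card B) \<le> 15 * (n / 1000)" using Z by linarith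
  let ?b = "144 ^ n * 2 ^ (15 * (card B + 4)) * real (cnt (del E K))"
  have "real (cnt E) \<le> 2 ^ (card K * card K) * (2 * real (card V) ^ 4) ^ card {z} * ?b"
  proof (rule cnt_le_centers[OF g KV])
    fix T C' t
    assume T: "T \<subseteq> FO E" and agree: "agree_on K T"
      and cov': "\<And>u R. u \<in> {z} \<Longrightarrow> R \<in> T \<Longrightarrow> covers V R u (C' u, t u)"
      and C': "\<And>u. u \<in> {z} \<Longrightarrow> finite (C' u) \<and> card (C' u) \<le> 4"
    define C where "C = C' z"
    have C4: "finite C" "card C \<le> 4" using C'[of z] unfolding C_def by simp_all
    have cov: "covers V R z (C, t z)" if "R \<in> T" for R
      using cov'[OF _ that, of z] unfolding C_def by simp
      have "real (card T) \<le> 144 ^ card V * 2 ^ (card K * card (B \<union> C)) * real (cnt (del E K))"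
      proof (rule card_class_const[OF g KV T agree])
        fix w assume w: "w \<in> V - K - (B \<union> C)"
        define F where "F = traces K T w"
        define N where "N = nbh E w \<inter> K"
        have FN: "F \<subseteq> Pow N" unfolding F_def N_def by (rule traces_sub[OF T])
        have "w \<in> X \<or> w \<in> Y" using w unfolding B_def by blast
        hence "\<exists>P'. N \<subseteq> insert z P' \<and> finite P' \<and> card P' = 7"
        proof
          assume wX: "w \<in> X"
          hence "N \<inter> P = {}" using w unfolding N_def B_def by (auto simp: nbh_sym)
          thus ?thesis using fPQ cQ unfolding N_def K_def by (intro exI[of _ Q]) auto
        next
          assume wY: "w \<in> Y"
          hence "N \<inter> Q = {}" using w unfolding N_def B_def by (auto simp: nbh_sym)
          thus ?thesis using fPQ cP unfolding N_def K_def by (intro exI[of _ P]) auto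
        qed
        then obtain P' where P': "N \<subseteq> insert z P'" "finite P'" "card P' = 7" by blast
        have fN: "finite N" using P' finite_subset by blast
        have "card F \<le> 144"
        proof (cases "z \<in> N")
          case False
          hence "N \<subseteq> P'" using P' by blast
          hence "card N \<le> 7" using card_mono[OF P'(2)] P'(3) by simp
          hence "(2::nat) ^ card N \<le> 2 ^ 7" by (rule power_increasing) simp
          thus ?thesis using card_sub_Pow[OF fN FN] by simp
        next
          case True
          have "N - {z} \<subseteq> P'" using P' by blast
          hence c7: "card N - 1 \<le> 7" using card_mono[OF P'(2), of "N - {z}"] P'(3) fN True by simp
          have "card F \<le> 2 ^ (card N - 1) + 2 ^ (card N - 1 - card (N - {z} - C))"
          proof (rule card_le_star'[OF fN FN True])
            fix v assume v: "v \<in> N - {z} - C"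
            hence v': "v \<in> K" "{v, w} \<in> E" unfolding N_def nbh_def by auto
            have vz: "{z, v} \<in> E" using v v' P Q unfolding K_def nbh_def by (auto simp: insert_commute)
            have "{z, w} \<in> E" using True unfolding N_def nbh_def by simp
            moreover have "z \<in> K" "v \<notin> C" "w \<notin> C" using v w unfolding K_def by blast+
            ultimately show "unsh F z v" unfolding F_def
              using v' vz by (intro unsh_cover[OF g T agree cov]) assumption+
          qed blast
          moreover have "card (N - {z}) - card C \<le> card (N - {z} - C)"
            by (rule diff_card_le_card_Diff[OF C4(1)])
          hence "card N - 1 - card (N - {z} - C) \<le> 4" using C4 fN True by simp
          hence "(2::nat) ^ (card N - 1 - card (N - {z} - C)) \<le> 2 ^ 4" by (rule power_increasing) simp
          moreover have "(2::nat) ^ (card N - 1) \<le> 2 ^ 7" using c7 by (rule power_increasing) simp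
          ultimately show ?thesis by simp
        qed
        thus "real (card (traces K T w)) \<le> 144" unfolding F_def by simp
      qed (use fB C4 in auto)
      also have "\<dots> \<le> ?b"
      proof -
        have "card (B \<union> C) \<le> card B + 4" using card_Un_le[of B C] C4 by linarith
        hence "(2::real) ^ (card K * card (B \<union> C)) \<le> 2 ^ (15 * (card B + 4))"
          unfolding cK by (intro power_increasing) auto
        thus ?thesis unfolding n by (intro mult_right_mono mult_left_mono) auto
      qed
      finally show "real (card T) \<le> ?b" .
  qed (use z in simp_all)
  hence le: "real (cnt E) \<le> 2 ^ (15 * 15) * (2 ^ 1 * real n ^ 4) * ?b" unfolding cK n by simp
  have "(2 powr (36 / 5)) ^ 5 = (2::real) powr (real 5 * (36 / 5))" by (subst powr_power) simp_all
  also have "\<dots> = 2 ^ 36" by simp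
  finally have "(144::real) ^ 5 \<le> (2 powr (36 / 5)) ^ 5" by simp
  hence "(144::real) \<le> 2 powr (36 / 5)" by (subst (asm) power_mono_iff) simp_all
  hence r: "(144::real) \<le> 2 powr (- (- (36 / 5)))" by simp
  show "gain V E"
    by (rule gain_num[OF fV KV cK _ n _ le _ r]) (use largeD[OF big] cB in \<open>simp_all add: field_simps\<close>)
qed

end

lemma three_quarters_le: "(3 / 4 :: real) \<le> 2 powr (- (2 / 5))"
proof -
  have "(2 powr (- (2 / 5))) ^ 5 = (2::real) powr (- 2)" by (subst powr_power) simp_all
  also have "\<dots> = 1 / 4" by (simp add: powr_minus powr_numeral)
  finally have "(3 / 4 :: real) ^ 5 \<le> (2 powr (- (2 / 5))) ^ 5" by (simp add: power_divide)
  thus ?thesis by (subst (asm) power_mono_iff) simp_all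
qed

lemma sixtythree_le: "(63 / 64 :: real) \<le> 2 powr (- (1 / 50))"
proof -
  have "(2 powr (- (1 / 50))) ^ 50 = (2::real) powr (- 1)" by (subst powr_power) simp_all
  also have "\<dots> = 1 / 2" by (simp add: powr_minus)
  finally have "(63 / 64 :: real) ^ 50 \<le> (2 powr (- (1 / 50))) ^ 50" by (simp add: power_divide)
  thus ?thesis by (subst (asm) power_mono_iff) simp_all
qed

section \<open>Bounded configurations in sparse graphs\<close>

context fan_types
begin

lemma unsh_ratio:
  assumes "sgraph V E" "T \<subseteq> FO E" "unsh (traces K T w) u v" "u \<in> nbh E w \<inter> K" "v \<in> nbh E w \<inter> K" "u \<noteq> v"
  shows "real (card (traces K T w)) \<le> 3 / 4 * 2 ^ card (nbh E w \<inter> K)"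
proof -
  have "4 * card (traces K T w) \<le> 3 * 2 ^ card (nbh E w \<inter> K)"
    using assms finite_nbh[OF assms(1)] by (intro card_le_unsh1[of _ _ u v] traces_sub) auto
  hence "real (4 * card (traces K T w)) \<le> real (3 * 2 ^ card (nbh E w \<inter> K))" by (rule of_nat_mono)
  thus ?thesis by simp
qed

lemma card_class_ratio':
  assumes g: "sgraph V E" and K: "K \<subseteq> V" and T: "T \<subseteq> FO E"
    and agree: "agree_on K T"
    and r: "0 \<le> r" "r \<le> 1" and W: "W \<subseteq> V - K"
    and ratio: "\<And>w. w \<in> W \<Longrightarrow> real (card (traces K T w)) \<le> r * 2 ^ card (nbh E w \<inter> K)"
    and m: "m \<le> card W" and s: "(\<Sum>w\<in>V - K. card (nbh E w \<inter> K)) \<le> s"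
  shows "real (card T) \<le> r ^ m * 2 ^ s * real (cnt (del E K))"
proof -
  have "real (card T) \<le> r ^ card W * 2 ^ (\<Sum>w\<in>V - K. card (nbh E w \<inter> K)) * real (cnt (del E K))"
    by (rule card_class_ratio[OF g K T agree r(1) W ratio])
  also have "\<dots> \<le> r ^ m * 2 ^ s * real (cnt (del E K))"
    using r m s by (intro mult_right_mono mult_mono power_decreasing power_increasing) auto
  finally show ?thesis .
qed

text \<open>If every member of \<open>U\<close> forbids one type of triangle on some spoke \<open>vx\<close>, then every common
  neighbour of \<open>v\<close> and \<open>x\<close>, up to boundedly many, loses a quarter of its possible traces.\<close>
lemma card_spoke_le:
  assumes g: "sgraph V E" and K: "K \<subseteq> V" and v: "v \<in> K" and P: "P \<subseteq> K \<inter> nbh E v" and U: "U \<subseteq> FO E"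
    and \<C>: "finite \<C>" "\<And>C. C \<in> \<C> \<Longrightarrow> finite C \<and> card C \<le> r"
    and cov: "\<And>R. R \<in> U \<Longrightarrow> \<exists>x\<in>P. \<exists>t. \<exists>C\<in>\<C>. \<forall>w. w \<notin> C \<longrightarrow> \<not> tri R t v x w"
    and m: "\<And>x. x \<in> P \<Longrightarrow> m + r + card K \<le> card (nbh E v \<inter> nbh E x)"
    and s: "(\<Sum>w\<in>V - K. card (nbh E w \<inter> K)) \<le> s"
  shows "real (card U) \<le> 2 ^ (card K * card K) * (2 * real (card P) * real (card \<C>)) *
    ((3 / 4) ^ m * 2 ^ s * real (cnt (del E K)))"
proof -
  have fK: "finite K" using g K sgraph_finite finite_subset by blast
  have fP: "finite P" using P fK by (meson finite_subset le_inf_iff)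
  let ?D = "P \<times> (UNIV :: bool set) \<times> \<C>"
  define good where "good R d \<longleftrightarrow> (case d of (x, t, C) \<Rightarrow> \<forall>w. w \<notin> C \<longrightarrow> \<not> tri R t v x w)" for R d
  define c where "c R = (SOME d. d \<in> ?D \<and> good R d)" for R
  have c: "c R \<in> ?D \<and> good R (c R)" if R: "R \<in> U" for R
  proof -
    obtain x t C where "x \<in> P" "C \<in> \<C>" "\<forall>w. w \<notin> C \<longrightarrow> \<not> tri R t v x w" using cov[OF R] by blast
    hence "(x, t, C) \<in> ?D \<and> good R (x, t, C)" unfolding good_def by simp
    thus ?thesis unfolding c_def by (rule someI)
  qed
  have "real (card U) \<le> 2 ^ (card K * card K) * real (card ?D) * ((3 / 4) ^ m * 2 ^ s * real (cnt (del E K)))"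
  proof (rule card_le_classes[OF g K U])
    show "finite ?D" using fP \<C> by simp
    show "c R \<in> ?D" if "R \<in> U" for R using c[OF that] by blast
    fix I and d :: "nat \<times> bool \<times> nat set"
    obtain x t C where d: "d = (x, t, C)" by (cases d)
    define T where "T = {R\<in>U. R \<inter> K \<times> K = I \<and> c R = d}"
    have T: "T \<subseteq> FO E" unfolding T_def using U by blast
    have agree: "agree_on K T" unfolding agree_on_def T_def by blast
    show "real (card {R\<in>U. R \<inter> K \<times> K = I \<and> c R = d}) \<le> (3 / 4) ^ m * 2 ^ s * real (cnt (del E K))"
    proof (cases "T = {}")
      case True
      thus ?thesis unfolding T_def[symmetric] by simp
    next
      case False
      then obtain R0 where "R0 \<in> T" by blast
      hence xC: "x \<in> P" "C \<in> \<C>" using c[of R0] unfolding T_def d by auto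
      have nt: "\<not> tri R t v x w" if "R \<in> T" "w \<notin> C" for R w
        using c[of R] that unfolding T_def good_def d by auto
      have fC: "finite C" "card C \<le> r" using \<C>(2)[OF xC(2)] by auto
      define W where "W = nbh E v \<inter> nbh E x - (C \<union> K)"
      show ?thesis unfolding T_def[symmetric]
      proof (rule card_class_ratio'[OF g K T agree, where W = W])
        show "W \<subseteq> V - K" unfolding W_def using nbh_sub[OF g, of v] by blast
        have "card (nbh E v \<inter> nbh E x) - card (C \<union> K) \<le> card W"
          unfolding W_def using fC fK by (intro diff_card_le_card_Diff) simp
        thus "m \<le> card W" using card_Un_le[of C K] fC m[OF xC(1)] by linarith
        show "(\<Sum>w\<in>V - K. card (nbh E w \<inter> K)) \<le> s" by (rule s)
        fix w assume w: "w \<in> W"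
        have xv: "x \<in> K" "{v, x} \<in> E" "v \<noteq> x"
          using P xC nbh_sub[OF g, of v] unfolding nbh_def by (auto simp: insert_commute)
        have e: "{v, w} \<in> E" "{x, w} \<in> E" "w \<notin> C" using w unfolding W_def nbh_def by (auto simp: insert_commute)
        have "unsh (traces K T w) v x"
          using v xv e nt by (intro unsh_spoke[OF g T agree]) blast+
        thus "real (card (traces K T w)) \<le> 3 / 4 * 2 ^ card (nbh E w \<inter> K)"
          using v xv e by (intro unsh_ratio[OF g T]) (auto simp: nbh_def)
      qed simp_all
    qed
  qed
  thus ?thesis by (simp add: card_cartesian_product mult.assoc)
qed

text \<open>Five neighbours are taken because an exceptional set has at most four elements, so some
  spoke \<open>xp\<close> is unexceptional. Its common neighbours save 2/5 bit each, together
  n/10000 up to a constant, while the six degrees exceed n/2 by at most 6n/80000 in total; the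
  difference n/40000 is the rate in \<open>large\<close>.\<close>

lemma pair_gain:
  assumes big: "large n" and g: "sgraph V E" and n: "card V = n" and x: "x \<in> V" and P: "P \<subseteq> nbh E x" and cP: "card P = 5"
    and deg: "\<And>u. u \<in> insert x P \<Longrightarrow> real (card (nbh E u)) \<le> (1 / 2 + 1 / 80000) * n"
    and cod: "\<And>p. p \<in> P \<Longrightarrow> real (card (nbh E x \<inter> nbh E p)) \<ge> n / 4000"
  shows "gain V E"
proof -
  have fV: "finite V" using g sgraph_finite by blast
  have fP: "finite P" using cP card.infinite by fastforce
  have xP: "x \<notin> P" using P nbh_sub[OF g, of x] by blast
  define K where "K = insert x P"
  have cK: "card K = 6" unfolding K_def using fP xP cP by simp
  have KV: "K \<subseteq> V" unfolding K_def using x P nbh_sub[OF g, of x] by blast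
  define s where "s = (\<Sum>u\<in>K. card (nbh E u))"
  have "real s = (\<Sum>u\<in>K. real (card (nbh E u)))" unfolding s_def by simp
  also have "\<dots> \<le> (\<Sum>u\<in>K. (1 / 2 + 1 / 80000) * n)" using deg unfolding K_def by (intro sum_mono) blast
  finally have s: "real s \<le> 6 * ((1 / 2 + 1 / 80000) * n)" using cK by simp
  define m where "m = nat \<lceil>n / 4000\<rceil> - 10"
  have m: "real m \<ge> n / 4000 - 10" unfolding m_def by linarith
  have "real (card (FO E)) \<le> 2 ^ (card K * card K) * (2 * real (card P) * real (card (cover_sets V))) *
      ((3 / 4) ^ m * 2 ^ s * real (cnt (del E K)))"
  proof (rule card_spoke_le[OF g KV _ _ order_refl finite_cover_sets[OF fV]])
    show "finite C \<and> card C \<le> 4" if "C \<in> cover_sets V" for C using cover_sets_card4[OF that] by blast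
    show "\<exists>p\<in>P. \<exists>t. \<exists>C\<in>cover_sets V. \<forall>w. w \<notin> C \<longrightarrow> \<not> tri R t x p w" if R: "R \<in> FO E" for R
    proof -
      obtain C t where C: "C \<in> cover_sets V" "covers V R x (C, t)"
        using cover_of[OF g R, of x] x by (metis empty_iff mem_Times_iff prod.collapse)
      have "\<not> P \<subseteq> C" using card_mono[of C P] cover_sets_card4[OF C(1)] cP by auto
      then obtain p where "p \<in> P" "p \<notin> C" by blast
      thus ?thesis using C unfolding covers_def by blast
    qed
    show "m + 4 + card K \<le> card (nbh E x \<inter> nbh E p)" if "p \<in> P" for p
    proof -
      have "n / 4000 \<le> real (card (nbh E x \<inter> nbh E p))" using cod that by blast
      hence "nat \<lceil>n / 4000\<rceil> \<le> card (nbh E x \<inter> nbh E p)" by (simp add: nat_le_iff ceiling_le_iff)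
      moreover have "10 \<le> nat \<lceil>n / 4000\<rceil>" using largeD(1)[OF big] by linarith
      ultimately show ?thesis unfolding m_def cK by linarith
    qed
    show "(\<Sum>w\<in>V - K. card (nbh E w \<inter> K)) \<le> s" unfolding s_def by (rule sum_nbh_le[OF g KV])
  qed (use P in \<open>auto simp: K_def\<close>)
  also have "\<dots> \<le> 2 ^ (6 * 6) * (2 ^ 4 * real n ^ 4) * ((3 / 4) ^ m * 2 ^ s * real (cnt (del E K)))"
  proof -
    have "real (card (cover_sets V)) \<le> real (n ^ 4)" using card_cover_sets[OF fV] n by (simp only: of_nat_le_iff)
    thus ?thesis unfolding cK cP by (intro mult_right_mono mult_mono) simp_all
  qed
  finally have le: "real (cnt E) \<le> \<dots>" unfolding cnt_def[of E] .
  show "gain V E"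
    by (rule gain_num[OF fV KV cK _ n _ le _ three_quarters_le])
      (use largeD[OF big] m s in \<open>simp_all add: field_simps\<close>)
qed

text \<open>Meant for a vertex with three neighbours in its own class: each spoke then has linearly
  many common neighbours in the other class. One of the three spokes must fail some type, and only
  two further vertices are guessed.\<close>

lemma inner3_gain:
  assumes big: "large n" and g: "sgraph V E" and n: "card V = n" and d: "distinct [x1, x2, x3]"
    and x: "{x1, x2, x3} \<subseteq> nbh E v"
    and deg: "\<And>u. u \<in> {v, x1, x2, x3} \<Longrightarrow> real (card (nbh E u)) \<le> n / 2 + 20"
    and com: "\<And>x. x \<in> {x1, x2, x3} \<Longrightarrow> real (card (nbh E v \<inter> nbh E x)) \<ge> n / 4"
  shows "gain V E"
proof -
  have fV: "finite V" using g sgraph_finite by blast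
  have vV: "v \<in> V" using x sgraph_edgeD[OF g, of x1 v] unfolding nbh_def by simp
  have vx: "v \<notin> {x1, x2, x3}" using x nbh_sub[OF g, of v] by blast
  define K where "K = {v, x1, x2, x3}"
  have cK: "card K = 4" unfolding K_def using vx d by simp
  have KV: "K \<subseteq> V" unfolding K_def using vV x nbh_sub[OF g, of v] by blast
  define s where "s = (\<Sum>u\<in>K. card (nbh E u))"
  have "real s = (\<Sum>u\<in>K. real (card (nbh E u)))" unfolding s_def by simp
  also have "\<dots> \<le> (\<Sum>u\<in>K. n / 2 + 20)" using deg unfolding K_def by (intro sum_mono) blast
  finally have s: "real s \<le> 4 * (n / 2 + 20)" using cK by simp
  define m where "m = nat \<lceil>n / 4\<rceil> - 9"
  have m: "real m \<ge> n / 4 - 9" unfolding m_def by linarith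
  define \<C> where "\<C> = (\<lambda>(p, q). {p, q, x1, x2, x3}) ` (V \<times> V)"
  have "real (card (FO E)) \<le> 2 ^ (card K * card K) * (2 * real (card {x1, x2, x3}) * real (card \<C>)) *
      ((3 / 4) ^ m * 2 ^ s * real (cnt (del E K)))"
  proof (rule card_spoke_le[OF g KV _ _ order_refl])
    show "finite \<C>" unfolding \<C>_def using fV by simp
    show "finite C \<and> card C \<le> 5" if "C \<in> \<C>" for C using that unfolding \<C>_def by (auto simp: card_insert_if)
    show "\<exists>x\<in>{x1, x2, x3}. \<exists>t. \<exists>C\<in>\<C>. \<forall>w. w \<notin> C \<longrightarrow> \<not> tri R t v x w" if R: "R \<in> FO E" for R
    proof -
      obtain x t p q where "x \<in> {x1, x2, x3}" "(p, q) \<in> V \<times> V" "\<forall>w. w \<notin> {p, q, x1, x2, x3} \<longrightarrow> \<not> tri R t v x w"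
        using fan_free_cover_inner1[OF g R _ d, of v] vV by blast
      moreover from this(2) have "{p, q, x1, x2, x3} \<in> \<C>" unfolding \<C>_def by (rule rev_image_eqI) simp
      ultimately show ?thesis by blast
    qed
    show "m + 5 + card K \<le> card (nbh E v \<inter> nbh E x)" if "x \<in> {x1, x2, x3}" for x
    proof -
      have "n / 4 \<le> real (card (nbh E v \<inter> nbh E x))" using com that by blast
      hence "nat \<lceil>n / 4\<rceil> \<le> card (nbh E v \<inter> nbh E x)" by (simp add: nat_le_iff ceiling_le_iff)
      moreover have "9 \<le> nat \<lceil>n / 4\<rceil>" using largeD(1)[OF big] by linarith
      ultimately show ?thesis unfolding m_def cK by linarith
    qed
    show "(\<Sum>w\<in>V - K. card (nbh E w \<inter> K)) \<le> s" unfolding s_def by (rule sum_nbh_le[OF g KV])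
  qed (use x in \<open>auto simp: K_def\<close>)
  also have "\<dots> \<le> 2 ^ (4 * 4) * (2 ^ 3 * real n ^ 2) * ((3 / 4) ^ m * 2 ^ s * real (cnt (del E K)))"
  proof -
    have "card \<C> \<le> n * n" unfolding \<C>_def using card_image_le[of "V \<times> V"] fV n by (simp add: card_cartesian_product)
    hence "real (card \<C>) \<le> real (n * n)" by (rule of_nat_mono)
    moreover have "card {x1, x2, x3} = 3" using d by simp
    ultimately show ?thesis unfolding cK by (intro mult_right_mono mult_mono) (simp_all add: power2_eq_square)
  qed
  finally have le: "real (cnt E) \<le> \<dots>" unfolding cnt_def[of E] .
  show "gain V E"
    by (rule gain_num[OF fV KV cK _ n _ le _ three_quarters_le])
      (use largeD[OF big] m s in \<open>simp_all add: field_simps\<close>)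
qed

text \<open>The outside vertices themselves act as centres, so nothing is guessed beyond the
  orientation inside \<open>K\<close>; each common neighbour keeps 63 of 64 traces, a saving of 1/50
  bit.\<close>

lemma matching_gain:
  assumes big: "large n" and g: "sgraph V E" and n: "card V = n" and d: "distinct [a1, b1, a2, b2, a3, b3]"
    and ed: "{a1, b1} \<in> E" "{a2, b2} \<in> E" "{a3, b3} \<in> E"
    and deg: "\<And>u. u \<in> {a1, b1, a2, b2, a3, b3} \<Longrightarrow> real (card (nbh E u)) \<le> n / 2 + 20"
    and com: "real (card {w\<in>V. {a1, b1, a2, b2, a3, b3} \<subseteq> nbh E w}) \<ge> n / 4"
  shows "gain V E"
proof -
  have fV: "finite V" using g sgraph_finite by blast
  define K where "K = {a1, b1, a2, b2, a3, b3}"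
  have cK: "card K = 6" unfolding K_def using d by simp
  have KV: "K \<subseteq> V" unfolding K_def using sgraph_edgeD[OF g] ed by blast
  define W where "W = {w\<in>V. K \<subseteq> nbh E w}"
  define s where "s = (\<Sum>u\<in>K. card (nbh E u))"
  have "real s = (\<Sum>u\<in>K. real (card (nbh E u)))" unfolding s_def by simp
  also have "\<dots> \<le> (\<Sum>u\<in>K. n / 2 + 20)" using deg unfolding K_def by (intro sum_mono) blast
  finally have s: "real s \<le> 6 * (n / 2 + 20)" using cK by simp
  have m: "real (card W) \<ge> n / 4" using com unfolding W_def K_def .
  have "real (card (FO E)) \<le> 2 ^ (card K * card K) * real (card {()}) *
      ((63 / 64) ^ card W * 2 ^ s * real (cnt (del E K)))"
  proof (rule card_le_classes[OF g KV order_refl, where c = "\<lambda>_. ()"])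
    fix I and d :: unit
    define T where "T = {R\<in>FO E. R \<inter> K \<times> K = I \<and> () = d}"
    have T: "T \<subseteq> FO E" unfolding T_def by blast
    have agree: "agree_on K T" unfolding agree_on_def T_def by blast
    show "real (card {R\<in>FO E. R \<inter> K \<times> K = I \<and> () = d}) \<le> (63 / 64) ^ card W * 2 ^ s * real (cnt (del E K))"
      unfolding T_def[symmetric]
    proof (rule card_class_ratio'[OF g KV T agree, where W = W])
      show "W \<subseteq> V - K" unfolding W_def using nbh_sub[OF g] by fastforce
      show "(\<Sum>w\<in>V - K. card (nbh E w \<inter> K)) \<le> s" unfolding s_def by (rule sum_nbh_le[OF g KV])
      fix w assume w: "w \<in> W"
      have Kw: "K \<subseteq> nbh E w" using w unfolding W_def by blast
      have "card (traces K T w) \<le> 63"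
        by (rule card_traces_matching[OF g T agree K_def d ed Kw])
      moreover have "nbh E w \<inter> K = K" using Kw by blast
      ultimately show "real (card (traces K T w)) \<le> 63 / 64 * 2 ^ card (nbh E w \<inter> K)"
        using cK by simp
    qed simp_all
  qed simp_all
  hence le: "real (cnt E) \<le> 2 ^ (6 * 6) * (2 ^ 0 * real n ^ 0) * ((63 / 64) ^ card W * 2 ^ s * real (cnt (del E K)))"
    unfolding cnt_def cK by simp
  show "gain V E"
    by (rule gain_num[OF fV KV cK _ n _ le _ sixtythree_le])
      (use largeD[OF big] m s in \<open>simp_all add: field_simps\<close>)
qed

text \<open>A triangle of the first type at \<open>y\<close> forces one of the spokes to
  \<open>x2\<close>, \<open>x3\<close> to fail a type, which costs a factor 3/4 at each of at least
  \<open>m\<close> common neighbours. The count is compared with \<open>2 ^ card E\<close> and not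
  with smaller graphs: it serves the final count.\<close>

lemma atypical_bound:
  assumes g: "sgraph V E" and d: "distinct [a, b, x2, x3]" and x: "x2 \<in> nbh E y" "x3 \<in> nbh E y"
    and m: "\<And>x. x \<in> {x2, x3} \<Longrightarrow> m + 8 \<le> card (nbh E y \<inter> nbh E x)"
  shows "real (card {R\<in>FO E. tri R t1 y a b}) \<le> 2 ^ 9 * (4 * real (card V)) * ((3 / 4) ^ m * 2 ^ card E)"
proof -
  have fV: "finite V" using g sgraph_finite by blast
  have yV: "y \<in> V" using x sgraph_edgeD[OF g, of x2 y] unfolding nbh_def by simp
  define K where "K = {y, x2, x3}"
  have "y \<notin> {x2, x3}" using x nbh_sub[OF g, of y] by blast
  hence cK: "card K = 3" unfolding K_def using d by simp
  have KV: "K \<subseteq> V" unfolding K_def using yV x nbh_sub[OF g, of y] by blast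
  define s where "s = (\<Sum>w\<in>V - K. card (nbh E w \<inter> K))"
  define \<C> where "\<C> = (\<lambda>p. {p, a, b, x2, x3}) ` V"
  have "real (card {R\<in>FO E. tri R t1 y a b}) \<le> 2 ^ (card K * card K) * (2 * real (card {x2, x3}) * real (card \<C>)) *
      ((3 / 4) ^ m * 2 ^ s * real (cnt (del E K)))"
  proof (rule card_spoke_le[OF g KV])
    show "finite \<C>" unfolding \<C>_def using fV by simp
    show "finite C \<and> card C \<le> 5" if "C \<in> \<C>" for C using that unfolding \<C>_def by (auto simp: card_insert_if)
    show "\<exists>x\<in>{x2, x3}. \<exists>t. \<exists>C\<in>\<C>. \<forall>w. w \<notin> C \<longrightarrow> \<not> tri R t y x w" if R: "R \<in> {R\<in>FO E. tri R t1 y a b}" for R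
    proof -
      have R': "R \<in> FO E" "tri R t1 y a b" using R by auto
      obtain x t p where "x \<in> {x2, x3}" "p \<in> V" "\<forall>w. w \<notin> {p, a, b, x2, x3} \<longrightarrow> \<not> tri R t y x w"
        using fan_free_cover_inner2[OF g R'(1) d R'(2)] by blast
      moreover from this(2) have "{p, a, b, x2, x3} \<in> \<C>" unfolding \<C>_def by (rule imageI)
      ultimately show ?thesis by blast
    qed
    show "m + 5 + card K \<le> card (nbh E y \<inter> nbh E x)" if "x \<in> {x2, x3}" for x using m[OF that] cK by simp
  qed (use x in \<open>auto simp: K_def s_def\<close>)
  also have "\<dots> \<le> 2 ^ 9 * (4 * real (card V)) * ((3 / 4) ^ m * 2 ^ card E)"
  proof (rule mult_mono)
    have "card \<C> \<le> card V" unfolding \<C>_def by (rule card_image_le[OF fV])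
    thus "2 ^ (card K * card K) * (2 * real (card {x2, x3}) * real (card \<C>)) \<le> 2 ^ 9 * (4 * real (card V))"
      unfolding cK using d by simp
    have sE: "s + card (del E K) \<le> card E" using card_edges_split[OF g KV] unfolding s_def by simp
    have "real (cnt (del E K)) \<le> 2 ^ card (del E K)"
      using of_nat_mono[OF cnt_le[OF sgraph_del[OF g, of K]], where 'a = real] by simp
    hence "2 ^ s * real (cnt (del E K)) \<le> 2 ^ s * 2 ^ card (del E K)" by simp
    also have "\<dots> = 2 ^ (s + card (del E K))" by (simp add: power_add)
    also have "\<dots> \<le> (2::real) ^ card E" using sE by (intro power_increasing) simp_all
    finally have "2 ^ s * real (cnt (del E K)) \<le> 2 ^ card E" .
    thus "(3 / 4) ^ m * 2 ^ s * real (cnt (del E K)) \<le> (3 / 4) ^ m * 2 ^ card E"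
      by (simp add: mult.assoc)
  qed simp_all
  finally show ?thesis .
qed

end

section \<open>Graphs of density above one half\<close>

lemma del_single: "sgraph V E \<Longrightarrow> v \<in> V \<Longrightarrow> card E = card (nbh E v) + card (del E {v})"
proof -
  assume g: "sgraph V E" and v: "v \<in> V"
  have no: "{e\<in>E. e \<subseteq> {v}} = {}" using g unfolding sgraph_def by fastforce
  have "(\<Sum>w\<in>V - {v}. card (nbh E w \<inter> {v})) = (\<Sum>w\<in>V - {v}. if w \<in> nbh E v then 1 else 0)"
    by (intro sum.cong) (auto simp: nbh_sym[of v] Int_insert_right)
  also have "\<dots> = card ((V - {v}) \<inter> nbh E v)" using sgraph_finite[OF g] by (simp add: sum.If_cases)
  also have "(V - {v}) \<inter> nbh E v = nbh E v" using nbh_sub[OF g] by blast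
  finally show ?thesis using card_edges_split[OF g, of "{v}"] v no by simp
qed

text \<open>Deleting a vertex of at most average degree does not lower the ratio of edges to pairs
  of vertices; this is repeated until \<open>k\<close> vertices remain.\<close>

lemma dense_subset:
  fixes lam :: real
  assumes "sgraph V E" "2 * real (card E) \<ge> lam * real (card V) * (real (card V) - 1)" "k \<le> card V"
  shows "\<exists>K\<subseteq>V. card K = k \<and> 2 * real (card {e\<in>E. e \<subseteq> K}) \<ge> lam * real k * (real k - 1)"
  using assms
proof (induction "card V" arbitrary: V E)
  case 0
  thus ?case by (intro exI[of _ "{}"]) auto
next
  case (Suc n)
  note g = Suc.prems(1)
  have fV: "finite V" using g sgraph_finite by blast
  have sub: "{e\<in>E. e \<subseteq> V} = E" using g unfolding sgraph_def by fastforce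
  consider "k = Suc n" | "k = 0" | "k \<le> n" "k > 0" using Suc.prems(3) Suc.hyps(2) by linarith
  thus ?case
  proof cases
    case 1
    show ?thesis by (rule exI[of _ V]) (use 1 Suc sub in simp)
  next
    case 2
    thus ?thesis by (intro exI[of _ "{}"]) auto
  next
    case 3
    hence n: "n \<ge> 1" by simp
    have ne: "V \<noteq> {}" using Suc.hyps(2) by auto
    have "\<exists>v\<in>V. real (card (nbh E v)) * Suc n \<le> 2 * card E"
    proof (rule ccontr)
      assume "\<not> ?thesis"
      hence "(\<Sum>v\<in>V. 2 * real (card E)) < (\<Sum>v\<in>V. real (card (nbh E v)) * Suc n)"
        using fV ne by (intro sum_strict_mono) auto
      also have "\<dots> = real (\<Sum>v\<in>V. card (nbh E v)) * Suc n" by (simp add: sum_distrib_right)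
      also have "\<dots> = 2 * real (card E) * Suc n" using sum_degrees[OF g] by simp
      finally show False using Suc.hyps(2) by simp
    qed
    then obtain v where v: "v \<in> V" "real (card (nbh E v)) * Suc n \<le> 2 * card E" by blast
    let ?e = "real (card E)" and ?d = "real (card (nbh E v))"
    have ce: "real (card (del E {v})) = ?e - ?d" using del_single[OF g v(1)] by simp
    have h: "lam * real (Suc n) * real n \<le> 2 * ?e"
      using Suc.prems(2) unfolding Suc.hyps(2)[symmetric] by simp
    have "(lam * n * (real n - 1)) * Suc n = (lam * real (Suc n) * real n) * (real n - 1)" by (simp only: mult_ac)
    also have "\<dots> \<le> (2 * ?e) * (real n - 1)" using h n by (intro mult_right_mono) simp_all
    also have "\<dots> = (2 * ?e) * Suc n - 2 * (2 * ?e)" by (simp add: algebra_simps)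
    also have "\<dots> \<le> (2 * ?e) * Suc n - 2 * (?d * Suc n)" using v(2) by linarith
    also have "\<dots> = (2 * (?e - ?d)) * Suc n" by (simp add: algebra_simps)
    finally have "(lam * n * (real n - 1)) * Suc n \<le> (2 * (?e - ?d)) * Suc n" .
    hence "lam * n * (real n - 1) \<le> 2 * (?e - ?d)" by (rule mult_right_le_imp_le) simp
    hence "\<exists>K\<subseteq>V - {v}. card K = k \<and> 2 * real (card {e\<in>del E {v}. e \<subseteq> K}) \<ge> lam * real k * (real k - 1)"
    proof -
      have cV: "n = card (V - {v})" using Suc.hyps(2) v(1) fV by simp
      show ?thesis
        by (rule Suc.hyps(1)[OF cV sgraph_del[OF g]]) (use 3 ce \<open>lam * n * (real n - 1) \<le> 2 * (?e - ?d)\<close> in \<open>simp_all flip: cV\<close>)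
    qed
    then obtain K where K: "K \<subseteq> V - {v}" "card K = k"
      "2 * real (card {e\<in>del E {v}. e \<subseteq> K}) \<ge> lam * real k * (real k - 1)" by blast
    have "{e\<in>del E {v}. e \<subseteq> K} = {e\<in>E. e \<subseteq> K}" unfolding del_def using K(1) by blast
    thus ?thesis using K by (intro exI[of _ K]) auto
  qed
qed

lemma sgraph_induced:
  assumes "sgraph V E" "K \<subseteq> V"
  shows "sgraph K {e\<in>E. e \<subseteq> K}"
  unfolding sgraph_def
proof
  show "finite K" using assms sgraph_finite finite_subset by blast
  show "\<forall>e\<in>{e\<in>E. e \<subseteq> K}. \<exists>u v. u \<in> K \<and> v \<in> K \<and> u \<noteq> v \<and> e = {u, v}"
  proof
    fix e assume e: "e \<in> {e\<in>E. e \<subseteq> K}"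
    hence "e \<in> E" by simp
    then obtain u v where "u \<noteq> v" "e = {u, v}" using assms(1) unfolding sgraph_def by metis
    with e have "u \<in> K \<and> v \<in> K \<and> u \<noteq> v \<and> e = {u, v}" by simp
    thus "\<exists>u v. u \<in> K \<and> v \<in> K \<and> u \<noteq> v \<and> e = {u, v}" by (intro exI)
  qed
qed

text \<open>The core maximises \<open>2 e(S) - (1/2 + th) |S|\<^sup>2\<close> over the subsets of \<open>K0\<close>.\<close>
lemma dense_core:
  fixes th :: real
  assumes g: "sgraph V E" and th: "th > 0" and K0: "K0 \<subseteq> V" "card K0 = k"
    and e: "2 * real (card {e\<in>E. e \<subseteq> K0}) \<ge> (1 / 2 + 2 * th) * real k * (real k - 1)"
  shows "\<exists>K\<subseteq>K0. th * real k ^ 2 - (1 / 2 + 2 * th) * real k \<le> real (card K) ^ 2 \<and>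
    (\<forall>u\<in>K. real (card (K - nbh E u)) \<le> (1 / 2 - th) * real (card K) + 1)"
proof -
  define ei where "ei S = {e\<in>E. e \<subseteq> S}" for S
  define phi where "phi S = 2 * real (card (ei S)) - (1 / 2 + th) * real (card S) ^ 2" for S
  have fK0: "finite K0" using g K0 sgraph_finite finite_subset by blast
  have "Max (phi ` Pow K0) \<in> phi ` Pow K0" using fK0 by (intro Max_in) auto
  then obtain K where K: "K \<subseteq> K0" "phi K = Max (phi ` Pow K0)" by auto
  have mx: "phi S \<le> phi K" if "S \<subseteq> K0" for S unfolding K(2) using that fK0 by (intro Max_ge) auto
  have fK: "finite K" using K fK0 finite_subset by blast
  have gK: "sgraph K (ei K)" unfolding ei_def using g K K0 by (intro sgraph_induced[of V]) auto
  have nK: "nbh (ei K) u = nbh E u \<inter> K" if "u \<in> K" for u unfolding ei_def nbh_def using that by auto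
  have "2 * card (ei K) \<le> card K * card K"
  proof -
    have "2 * card (ei K) = (\<Sum>v\<in>K. card (nbh (ei K) v))" using sum_degrees[OF gK] by simp
    also have "\<dots> \<le> (\<Sum>v\<in>K. card K)" using nbh_sub[OF gK] fK by (intro sum_mono card_mono) auto
    finally show ?thesis by simp
  qed
  hence up: "2 * real (card (ei K)) \<le> real (card K) ^ 2"
    by (simp add: power2_eq_square flip: of_nat_mult)
  \<comment> \<open>The maximum is at least the value at \<open>K0\<close>, and no value exceeds the
    squared size, so the core cannot be small.\<close>
  have "(1 / 2 + 2 * th) * real k * (real k - 1) - (1 / 2 + th) * real k ^ 2 \<le> phi K0"
    unfolding phi_def ei_def using e K0 by simp
  also have "\<dots> \<le> phi K" by (rule mx) simp
  also have "\<dots> \<le> real (card K) ^ 2"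
  proof -
    have "(1 / 2 + th) * real (card K) ^ 2 \<ge> 0" using th by simp
    thus ?thesis unfolding phi_def using up by linarith
  qed
  finally have 1: "th * real k ^ 2 - (1 / 2 + 2 * th) * real k \<le> real (card K) ^ 2"
    by (simp add: field_simps power2_eq_square)
  have 2: "real (card (K - nbh E u)) \<le> (1 / 2 - th) * real (card K) + 1" if u: "u \<in> K" for u
  proof -
    define d where "d = card (nbh E u \<inter> K)"
    have "del (ei K) {u} = ei (K - {u})" unfolding del_def ei_def by auto
    hence c: "card (ei K) = d + card (ei (K - {u}))" using del_single[OF gK u] nK[OF u] unfolding d_def by simp
    have k1: "card K \<ge> 1" using u fK by (metis One_nat_def Suc_leI card_gt_0_iff empty_iff)
    \<comment> \<open>Maximality against the removal of one vertex is a minimum degree condition: at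
      least (1/2 + th)(|K| - 1/2) neighbours inside \<open>K\<close>.\<close>
    have "phi (K - {u}) \<le> phi K" using K by (intro mx) auto
    moreover have "real (card (K - {u})) = real (card K) - 1" using u fK k1 by (simp add: of_nat_diff)
    ultimately have "(1 / 2 + th) * (real (card K) ^ 2 - (real (card K) - 1) ^ 2) \<le> 2 * real d"
      unfolding phi_def c by (simp add: algebra_simps)
    hence dd: "(1 / 2 + th) * (2 * real (card K) - 1) \<le> 2 * real d" by (simp add: power2_eq_square algebra_simps)
    have "card (K - nbh E u) = card K - d" unfolding d_def using fK by (simp add: card_Diff_subset_Int Int_commute)
    moreover have "d \<le> card K" unfolding d_def using fK by (intro card_mono) auto
    ultimately have "real (card (K - nbh E u)) = real (card K) - real d" by simp
    moreover have "card (nbh E u \<inter> K) \<le> card (K - {u})" using nbh_sub[OF g, of u] fK by (intro card_mono) auto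
    hence "real d \<le> real (card K) - 1" unfolding d_def using u fK k1 by (simp add: of_nat_diff)
    \<comment> \<open>The half vertex in the degree bound contributes (1/2 + th)/2 non-neighbours;
      this is at most the allowed 1.\<close>
    hence "th \<le> 3 / 2"
    proof -
      have "(1 / 2 + th) * (2 * real (card K) - 1) \<le> 2 * real (card K) - 2" using dd \<open>real d \<le> real (card K) - 1\<close> by linarith
      also have "\<dots> \<le> 1 * (2 * real (card K) - 1)" by simp
      finally have "(1 / 2 + th) * (2 * real (card K) - 1) \<le> 1 * (2 * real (card K) - 1)" .
      hence "1 / 2 + th \<le> 1" by (rule mult_right_le_imp_le) (use k1 in simp)
      thus ?thesis by simp
    qed
    ultimately show ?thesis using dd by (simp add: algebra_simps)
  qed
  show ?thesis using K(1) 1 2 by blast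
qed

context fan_types
begin

text \<open>At an outside vertex not in any exceptional set, adjacent vertices \<open>u\<close>,
  \<open>v\<close> of \<open>K\<close> are unshattered unless \<open>v\<close> is exceptional for
  \<open>u\<close>. So each \<open>u\<close> has fewer than half of \<open>K\<close> as shattered
  partners, and \<open>card_le_unshattered\<close> leaves about
  \<open>2 powr ((1 / 2 - th) * k)\<close> traces.\<close>

lemma dense_core_gain:
  fixes th :: real
  assumes g: "sgraph V E" and n: "card V = n" and n0: "n > 0" and KV: "K \<subseteq> V" and k_def: "k = card K" and kk: "k \<ge> 1"
    and core: "\<And>u. u \<in> K \<Longrightarrow> real (card (K - nbh E u)) \<le> (1 / 2 - th) * real (card K) + 1"
    and lk: "7 + log 2 (real k) \<le> th * real k"
    and num: "6 * real k ^ 2 + 2 * real k + 1 + 4 * real k * log 2 (real n) \<le> real n"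
  shows "gain V E"
proof -
  have fV: "finite V" using g sgraph_finite by blast
  have fK: "finite K" using KV fV finite_subset by blast
  \<comment> \<open>\<open>B\<close> is one bit below the allowance of k/2 per outside vertex; this
    bit is the whole gain. The 5 in \<open>d\<close> is the 1 from the core condition plus four
    exceptional vertices.\<close>
  define B where "B = 2 powr (real k / 2 - 1)"
  define d where "d = nat \<lfloor>(1 / 2 - th) * real k + 5\<rfloor>"
  let ?b = "B ^ n * 2 ^ (k * (4 * k)) * real (cnt (del E K))"
  have "real (cnt E) \<le> 2 ^ (card K * card K) * (2 * real (card V) ^ 4) ^ card K * ?b"
  proof (rule cnt_le_centers[OF g KV KV])
    fix T C t
    assume T: "T \<subseteq> FO E" and agree: "agree_on K T"
      and cov: "\<And>u R. u \<in> K \<Longrightarrow> R \<in> T \<Longrightarrow> covers V R u (C u, t u)"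
      and C4: "\<And>u. u \<in> K \<Longrightarrow> finite (C u) \<and> card (C u) \<le> 4"
    define W where "W = (\<Union>u\<in>K. C u)"
    have fW: "finite W" unfolding W_def using fK C4 by blast
    have "card W \<le> (\<Sum>u\<in>K. card (C u))" unfolding W_def by (rule card_UN_le[OF fK])
    also have "\<dots> \<le> (\<Sum>u\<in>K. 4)" using C4 by (intro sum_mono) blast
    finally have cW: "card W \<le> 4 * k" unfolding k_def by simp
    obtain u0 where u0: "u0 \<in> K" using kk unfolding k_def by fastforce
    have dnn: "(1 / 2 - th) * real k + 1 \<ge> 0" using core[OF u0] unfolding k_def by linarith
    have B1: "1 \<le> B"
    proof -
      have "1 \<le> real k / 2 - th * real k + 1"
      proof -
        have "u0 \<in> K - nbh E u0" using u0 nbh_sub[OF g, of u0] by blast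
        hence "card (K - nbh E u0) \<ge> 1" using fK by (metis One_nat_def Suc_leI card_gt_0_iff empty_iff finite_Diff)
        thus ?thesis using core[OF u0] unfolding k_def by (simp add: algebra_simps)
      qed
      moreover have "log 2 (real k) \<ge> 0" using kk by simp
      ultimately have "real k / 2 - 1 \<ge> 0" using lk by linarith
      thus ?thesis unfolding B_def by (simp add: ge_one_powr_ge_zero)
    qed
    have "real (card T) \<le> B ^ card V * 2 ^ (card K * card W) * real (cnt (del E K))"
    proof (rule card_class_const[OF g KV T agree B1 fW])
      fix w assume w: "w \<in> V - K - W"
      define F where "F = traces K T w"
      define N where "N = nbh E w \<inter> K"
      have FN: "F \<subseteq> Pow N" unfolding F_def N_def by (rule traces_sub[OF T])
      have fN: "finite N" unfolding N_def using fK by simp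
      have "card F \<le> 1 + card N * 2 ^ d"
      proof (rule card_le_unshattered[OF fN FN])
        fix u assume u: "u \<in> N"
        have uK: "u \<in> K" "{u, w} \<in> E" using u unfolding N_def nbh_def by auto
        have "{v\<in>N - {u}. \<not> unsh F u v} \<subseteq> (K - nbh E u) \<union> C u"
        proof
          fix v assume v: "v \<in> {v\<in>N - {u}. \<not> unsh F u v}"
          show "v \<in> (K - nbh E u) \<union> C u"
          proof (rule ccontr)
            assume nv: "v \<notin> (K - nbh E u) \<union> C u"
            have vK: "v \<in> K" "{v, w} \<in> E" using v unfolding N_def nbh_def by auto
            have e: "{u, v} \<in> E" "v \<notin> C u" using nv vK unfolding nbh_def by (auto simp: insert_commute)
            have "w \<notin> C u" using w uK unfolding W_def by blast
            hence "unsh F u v" unfolding F_def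
              using uK vK e by (intro unsh_cover[OF g T agree cov]) assumption+
            thus False using v by blast
          qed
        qed
        hence "card {v\<in>N - {u}. \<not> unsh F u v} \<le> card ((K - nbh E u) \<union> C u)"
          using fK C4[OF uK(1)] by (intro card_mono) auto
        also have "\<dots> \<le> card (K - nbh E u) + 4" using card_Un_le[of "K - nbh E u" "C u"] C4[OF uK(1)] by linarith
        finally have "real (card {v\<in>N - {u}. \<not> unsh F u v}) \<le> (1 / 2 - th) * real k + 5"
          using core[OF uK(1)] unfolding k_def by linarith
        thus "card {v\<in>N - {u}. \<not> unsh F u v} \<le> d" unfolding d_def by linarith
      qed
      also have "\<dots> \<le> 2 * k * 2 ^ d"
      proof -
        have "card N \<le> k" unfolding N_def k_def using fK by (intro card_mono) auto
        hence "card N * 2 ^ d \<le> k * 2 ^ d" by simp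
        moreover have "1 \<le> k * 2 ^ d" using kk by simp
        ultimately show ?thesis by linarith
      qed
      finally have "real (card F) \<le> real (2 * k * 2 ^ d)" by (rule of_nat_mono)
      also have "\<dots> = 2 powr 1 * 2 powr (log 2 (real k)) * 2 powr real d"
        using kk by (simp add: powr_realpow)
      also have "\<dots> = 2 powr (1 + log 2 (real k) + real d)" by (simp only: powr_add)
      also have "\<dots> \<le> B"
      proof -
        have "real d \<le> (1 / 2 - th) * real k + 5" unfolding d_def using dnn by linarith
        hence "1 + log 2 (real k) + real d \<le> real k / 2 - 1" using lk by (simp add: algebra_simps)
        thus ?thesis unfolding B_def by simp
      qed
      finally show "real (card (traces K T w)) \<le> B" unfolding F_def .
    qed
    also have "\<dots> \<le> ?b"
    proof -
      have "card K * card W \<le> k * (4 * k)" using cW unfolding k_def by simp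
      hence "(2::real) ^ (card K * card W) \<le> 2 ^ (k * (4 * k))" by (intro power_increasing) simp_all
      thus ?thesis unfolding n B_def by (intro mult_right_mono mult_left_mono) auto
    qed
    finally show "real (card T) \<le> ?b" .
  qed (simp add: B_def)
  also have "\<dots> = 2 ^ (k * k) * (2 ^ k * real n ^ (4 * k)) * ?b"
    unfolding k_def n by (simp only: power_mult_distrib power_mult)
  finally have le: "real (cnt E) \<le> \<dots>" .
  show "gain V E"
    by (rule gain_num[OF fV KV k_def[symmetric] _ n n0 le, of "1 - real k / 2"])
      (use num kk in \<open>simp_all add: B_def algebra_simps power2_eq_square\<close>)
qed

lemma dense_gain:
  fixes th :: real
  assumes th: "th > 0"
  shows "\<forall>\<^sub>F n in sequentially. \<forall>V E. sgraph V E \<longrightarrow> card V = n \<longrightarrow>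
    real (card E) \<ge> (1 / 4 + th) * real n ^ 2 \<longrightarrow> gain V E"
proof -
  have "\<forall>\<^sub>F k in sequentially. 7 + 1 * log 2 (real k) \<le> th * real k"
    by (rule eventually_log_le[OF th])
  then obtain k1 where k1: "\<And>k. k \<ge> k1 \<Longrightarrow> 7 + 1 * log 2 (real k) \<le> th * real k"
    unfolding eventually_sequentially by blast
  \<comment> \<open>Order of choice: \<open>k2\<close> makes logarithms negligible against
    \<open>th * k\<close>, \<open>k0\<close> forces the core to have at least \<open>k2\<close>
    vertices, and n comes last. The core has at most \<open>k0\<close> vertices, so the estimate at
    \<open>k0\<close> serves every possible size.\<close>
  define k2 where "k2 = max 1 k1"
  have "filterlim (\<lambda>k. th * real k ^ 2 - (1 / 2 + 2 * th) * real k) at_top sequentially"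
    using th by real_asymp
  hence "\<forall>\<^sub>F k in sequentially. th * real k ^ 2 - (1 / 2 + 2 * th) * real k \<ge> real k2 ^ 2"
    unfolding filterlim_at_top by blast
  then obtain k0 where k0: "th * real k0 ^ 2 - (1 / 2 + 2 * th) * real k0 \<ge> real k2 ^ 2"
    unfolding eventually_sequentially by blast
  have ev: "\<forall>\<^sub>F n in sequentially. (6 * real k0 ^ 2 + 2 * real k0 + 1) + 4 * real k0 * log 2 (real n) \<le> 1 * real n"
    by (rule eventually_log_le) simp
  show ?thesis using ev eventually_ge_at_top[of k0] eventually_gt_at_top[of 0]
  proof eventually_elim
    case (elim n)
    show ?case
    proof (intro allI impI)
      fix V E
      assume g: "sgraph V E" and n: "card V = n" and dense: "real (card E) \<ge> (1 / 4 + th) * real n ^ 2"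
      have fV: "finite V" using g sgraph_finite by blast
      have "(1 / 2 + 2 * th) * real (card V) * (real (card V) - 1) \<le> 2 * real (card E)"
      proof -
        have "(1 / 2 + 2 * th) * real n * (real n - 1) \<le> (1 / 2 + 2 * th) * real n * real n"
          using th by (intro mult_left_mono) auto
        also have "\<dots> = 2 * ((1 / 4 + th) * real n ^ 2)" by (simp add: power2_eq_square algebra_simps)
        also have "\<dots> \<le> 2 * real (card E)" using dense by simp
        finally show ?thesis unfolding n .
      qed
      then obtain K0 where K0: "K0 \<subseteq> V" "card K0 = k0"
        "2 * real (card {e\<in>E. e \<subseteq> K0}) \<ge> (1 / 2 + 2 * th) * real k0 * (real k0 - 1)"
        using dense_subset[OF g, of "1 / 2 + 2 * th" k0] elim(2) n by blast
      obtain K where K: "K \<subseteq> K0" "th * real k0 ^ 2 - (1 / 2 + 2 * th) * real k0 \<le> real (card K) ^ 2"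
        and core: "\<And>u. u \<in> K \<Longrightarrow> real (card (K - nbh E u)) \<le> (1 / 2 - th) * real (card K) + 1"
        using dense_core[OF g th K0] by blast
      define k where "k = card K"
      have KV: "K \<subseteq> V" using K K0 by blast
      have "real k2 ^ 2 \<le> real k ^ 2" unfolding k_def using k0 K(2) by linarith
      hence "real k2 \<le> real k" by (rule power2_le_imp_le) simp
      hence kk: "k \<ge> k1" "k \<ge> 1" unfolding k2_def by auto
      have kle: "k \<le> k0" unfolding k_def using K(1) K0(1,2) fV by (metis card_mono finite_subset)
      have lk: "7 + log 2 (real k) \<le> th * real k" using k1[OF kk(1)] by simp
      have l0: "log 2 (real n) \<ge> 0" using elim(3) by simp
      have "6 * real k ^ 2 + 2 * real k + 1 + 4 * real k * log 2 (real n) \<le>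
          6 * real k0 ^ 2 + 2 * real k0 + 1 + 4 * real k0 * log 2 (real n)"
        using kle l0 by (intro add_mono mult_left_mono mult_right_mono power_mono) auto
      hence num: "6 * real k ^ 2 + 2 * real k + 1 + 4 * real k * log 2 (real n) \<le> real n" using elim(1) by linarith
      show "gain V E"
        by (rule dense_core_gain[OF g n elim(3) KV k_def kk(2) core lk num])
    qed
  qed
qed

end

subsection \<open>Reduction to nearly complete bipartite graphs\<close>

lemma square_div4_step: "n > 0 \<Longrightarrow> (n - 1)\<^sup>2 div 4 + n div 2 = (n::nat)\<^sup>2 div 4"
proof -
  assume "n > 0"
  then obtain k where "n = Suc k" using gr0_implies_Suc by blast
  moreover have "k\<^sup>2 div 4 + Suc k div 2 = (Suc k)\<^sup>2 div 4"
  proof (cases "even k")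
    case True
    then obtain i where "k = 2 * i" by blast
    thus ?thesis by (simp add: power2_eq_square algebra_simps)
  next
    case False
    then obtain i where i: "k = 2 * i + 1" by (metis oddE)
    have "k\<^sup>2 = 4 * (i * i + i) + 1" "(Suc k)\<^sup>2 = 4 * (i * i + i + (i + 1))"
      unfolding i by (simp_all add: power2_eq_square algebra_simps)
    hence "k\<^sup>2 div 4 = i * i + i" "(Suc k)\<^sup>2 div 4 = i * i + i + (i + 1)" by (simp_all only: div_mult_self4) simp_all
    moreover have "Suc k div 2 = i + 1" unfolding i by simp
    ultimately show ?thesis by simp
  qed
  ultimately show ?thesis by simp
qed

lemma half_le_div: "real n / 2 - 1 / 2 \<le> real (n div 2)"
proof -
  have "n \<le> 2 * (n div 2) + 1" by presburger
  hence "real n \<le> real (2 * (n div 2) + 1)" by (rule of_nat_mono)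
  thus ?thesis by simp
qed

context fan_types
begin

text \<open>Removing one vertex lowers \<open>n\<^sup>2 div 4\<close> by exactly
  \<open>n div 2\<close>, but loses at most \<open>card (nbh E v)\<close> bits, which is at least
  one less.\<close>

lemma low_degree_gain:
  assumes g: "sgraph V E" and v: "v \<in> V" and deg: "card (nbh E v) < card V div 2"
  shows "gain V E"
proof -
  have fV: "finite V" using g sgraph_finite by blast
  have nV: "card V > 0" using fV v card_gt_0_iff by blast
  have agree: "agree_on {v} (FO E)"
  proof -
    have "(v, v) \<notin> R" if "R \<in> FO E" for R
      using orient_edge[OF FO_orient[OF that], of v v] sgraph_edgeD[OF g, of v v] by blast
    thus ?thesis unfolding agree_on_def by blast
  qed
  have "real (card (FO E)) \<le> 1 ^ card ({} :: nat set) * 2 ^ (\<Sum>w\<in>V - {v}. card (nbh E w \<inter> {v})) * real (cnt (del E {v}))"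
    using v by (intro card_class_ratio[OF g _ order_refl agree]) simp_all
  also have "\<dots> = real (2 ^ (\<Sum>w\<in>V - {v}. card (nbh E w \<inter> {v})) * cnt (del E {v}))" by simp
  finally have "cnt E \<le> 2 ^ (\<Sum>w\<in>V - {v}. card (nbh E w \<inter> {v})) * cnt (del E {v})"
    unfolding cnt_def[of E] by (simp only: of_nat_le_iff)
  also have "(\<Sum>w\<in>V - {v}. card (nbh E w \<inter> {v})) \<le> card (nbh E v)"
    using sum_nbh_le[OF g, of "{v}"] v by simp
  hence "(2::nat) ^ (\<Sum>w\<in>V - {v}. card (nbh E w \<inter> {v})) * cnt (del E {v}) \<le> 2 ^ card (nbh E v) * cnt (del E {v})"
    by (intro mult_right_mono power_increasing) simp_all
  finally have "cnt E * 2 ^ ((card V - 1)\<^sup>2 div 4 + 1) \<le> 2 ^ card (nbh E v) * cnt (del E {v}) * 2 ^ ((card V - 1)\<^sup>2 div 4 + 1)"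
    by (rule mult_right_mono) simp
  also have "\<dots> = 2 ^ (card (nbh E v) + ((card V - 1)\<^sup>2 div 4 + 1)) * cnt (del E {v})"
    by (simp only: power_add mult_ac)
  also have "\<dots> \<le> 2 ^ ((card V)\<^sup>2 div 4) * cnt (del E {v})"
    using deg square_div4_step[OF nV] by (intro mult_right_mono power_increasing) simp_all
  finally show ?thesis unfolding gain_def using v by (intro exI[of _ "{v}"]) simp
qed

text \<open>All degrees are at least (n-1)/2, so the edge bound leaves n^2/6400000000 + n/2 for the
  excess degrees, of which each high vertex takes n/80000. The density constant is 1/(2 * 80000^2),
  giving n/80000 + 40000 such vertices.\<close>

lemma high_degree_few:
  assumes g: "sgraph V E" and n: "card V = n" and deg: "\<forall>v\<in>V. n div 2 \<le> card (nbh E v)"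
    and e: "real (card E) \<le> (1 / 4 + 1 / 12800000000) * real n ^ 2" and big: "n \<ge> 4000000000"
  shows "real (card {v\<in>V. real (card (nbh E v)) > (1 / 2 + 1 / 80000) * n}) \<le> n / 40000"
proof -
  define H where "H = {v\<in>V. real (card (nbh E v)) > (1 / 2 + 1 / 80000) * n}"
  have fV: "finite V" using g sgraph_finite by blast
  have "real n * ((real n - 1) / 2) + real (card H) * (n / 80000) = (\<Sum>v\<in>V. (real n - 1) / 2 + (if v \<in> H then n / 80000 else 0))"
    using fV n by (simp add: sum.distrib sum.If_cases H_def Int_def)
  also have "\<dots> \<le> (\<Sum>v\<in>V. real (card (nbh E v)))"
  proof (rule sum_mono)
    fix v assume v: "v \<in> V"
    have "real (n div 2) \<le> real (card (nbh E v))" using deg v by simp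
    moreover have "(real n - 1) / 2 \<le> real (n div 2)" using half_le_div[of n] by (simp add: diff_divide_distrib)
    ultimately have "(real n - 1) / 2 \<le> real (card (nbh E v))" by (rule order_trans[rotated])
    thus "(real n - 1) / 2 + (if v \<in> H then n / 80000 else 0) \<le> real (card (nbh E v))"
    proof (cases "v \<in> H")
      case True
      hence "real (card (nbh E v)) > (1 / 2 + 1 / 80000) * n" unfolding H_def by blast
      thus ?thesis using True by (simp add: field_simps)
    qed simp
  qed
  also have "\<dots> = 2 * real (card E)" using sum_degrees[OF g] by (simp flip: of_nat_sum)
  also have "\<dots> \<le> 2 * ((1 / 4 + 1 / 12800000000) * real n ^ 2)" using e by simp
  finally have "real (card H) * (n / 80000) \<le> real n * (n / 6400000000 + 1 / 2)"
    by (simp add: power2_eq_square field_simps)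
  hence "real (card H) * n \<le> (n / 80000 + 40000) * n" by (simp add: field_simps)
  hence "real (card H) \<le> n / 80000 + 40000" by (rule mult_right_le_imp_le) (use big in simp)
  also have "\<dots> \<le> n / 40000" using big by simp
  finally show ?thesis unfolding H_def .
qed

definition balanced :: "nat set \<Rightarrow> nat set set \<Rightarrow> nat set \<Rightarrow> nat set \<Rightarrow> bool" where
  "balanced V E X Y \<longleftrightarrow> X \<union> Y = V \<and> X \<inter> Y = {} \<and> (\<forall>x\<in>X. card (nbh E x \<inter> X) \<le> 6) \<and>
     (\<forall>y\<in>Y. card (nbh E y \<inter> Y) \<le> 6) \<and> (\<forall>v\<in>V. card V div 2 \<le> card (nbh E v))"

lemma star_dichotomy:
  assumes big: "large n" and g: "sgraph V E" and h: "card V = n" "X \<subseteq> V" "Y \<subseteq> V" "X \<inter> Y = {}" "real (card (V - X - Y)) \<le> n / 1000"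
    and dX: "\<And>x. x \<in> X \<Longrightarrow> real (card (nbh E x \<inter> X)) \<le> n / 1000"
    and dY: "\<And>y. y \<in> Y \<Longrightarrow> real (card (nbh E y \<inter> Y)) \<le> n / 1000"
    and ng: "\<not> gain V E" and z: "z \<in> V"
  shows "card (nbh E z \<inter> X) \<le> 6 \<or> card (nbh E z \<inter> Y) \<le> 6"
proof (rule ccontr)
  assume "\<not> ?thesis"
  hence z7: "7 \<le> card (nbh E z \<inter> X)" "7 \<le> card (nbh E z \<inter> Y)" by simp_all
  obtain P where P: "P \<subseteq> nbh E z \<inter> X" "card P = 7" using obtain_subset_with_card_n[OF z7(1)] by metis
  obtain Q where Q: "Q \<subseteq> nbh E z \<inter> Y" "card Q = 7" using obtain_subset_with_card_n[OF z7(2)] by metis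
  show False using star_gain[OF big g h dX dY z P(1) Q(1) P(2) Q(2)] ng by blast
qed

text \<open>The neighbourhoods of two suitable adjacent vertices nearly partition \<open>V\<close>
  into two nearly independent halves. The star dichotomy then assigns the remaining vertices, and a
  second use of it improves linear inner degrees to six.\<close>

lemma balanced_if_no_gain:
  assumes big: "large n" and g: "sgraph V E" and n: "card V = n" and ng: "\<not> gain V E"
    and sparse: "real (card E) \<le> (1 / 4 + 1 / 12800000000) * real n ^ 2"
  shows "\<exists>X Y. balanced V E X Y"
proof -
  note bigr = largeD(1)[OF big]
  have fV: "finite V" using g sgraph_finite by blast
  have deg: "n div 2 \<le> card (nbh E v)" if "v \<in> V" for v
    using low_degree_gain[OF g that] ng n by (meson not_less)
  have half: "real (n div 2) \<ge> n / 2 - 1 / 2" by (rule half_le_div)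
  define H where "H = {v\<in>V. real (card (nbh E v)) > (1 / 2 + 1 / 80000) * n}"
  have cH: "real (card H) \<le> n / 40000"
    unfolding H_def using high_degree_few[OF g n _ sparse] deg bigr by simp
  have fH: "finite H" unfolding H_def using fV by simp
  \<comment> \<open>For \<open>z\<close> in \<open>Nx x\<close>, the neighbours of \<open>z\<close>
    inside \<open>Nx x\<close> are common neighbours of \<open>x\<close> and \<open>z\<close>, hence
    few: the set is nearly independent. By \<open>pair_gain\<close> it misses at most four
    neighbours of \<open>x\<close> outside \<open>H\<close>.\<close>
  define Nx where "Nx x = {p\<in>nbh E x - H. real (card (nbh E x \<inter> nbh E p)) < n / 4000}" for x
  have Nx_sub: "Nx x \<subseteq> nbh E x - H" for x unfolding Nx_def by blast
  have Nx_fin: "finite (Nx x)" for x using Nx_sub finite_nbh[OF g] by (meson finite_Diff finite_subset)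
  have Nx_card: "real (card (Nx x)) \<ge> n div 2 - n / 40000 - 4" if x: "x \<in> V - H" for x
  proof -
    define A where "A = {p\<in>nbh E x - H. real (card (nbh E x \<inter> nbh E p)) \<ge> n / 4000}"
    have fA: "finite A" unfolding A_def using finite_nbh[OF g] by simp
    have cA: "card A \<le> 4"
    proof (rule ccontr)
      assume "\<not> card A \<le> 4"
      hence "5 \<le> card A" by simp
      then obtain P where P: "P \<subseteq> A" "card P = 5" using obtain_subset_with_card_n by metis
      have "gain V E"
      proof (rule pair_gain[OF big g n _ _ P(2)])
        show "x \<in> V" using x by blast
        show "P \<subseteq> nbh E x" using P(1) unfolding A_def by blast
        show "real n / 4000 \<le> real (card (nbh E x \<inter> nbh E p))" if "p \<in> P" for p
          using that P(1) unfolding A_def by blast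
        fix u assume "u \<in> insert x P"
        hence "u \<in> V - H" using x P(1) nbh_sub[OF g, of x] unfolding A_def by blast
        thus "real (card (nbh E u)) \<le> (1 / 2 + 1 / 80000) * real n" unfolding H_def by auto
      qed
      thus False using ng by blast
    qed
    have "nbh E x \<subseteq> (Nx x \<union> A) \<union> H" unfolding Nx_def A_def by auto
    hence "card (nbh E x) \<le> card ((Nx x \<union> A) \<union> H)" using fA fH Nx_fin by (intro card_mono) auto
    also have "\<dots> \<le> card (Nx x) + card A + card H" by (meson add_mono card_Un_le le_trans order_refl)
    finally have "real (card (nbh E x)) \<le> real (card (Nx x)) + real (card A) + real (card H)" by linarith
    moreover have "real (n div 2) \<le> real (card (nbh E x))" using deg[of x] x by simp
    ultimately show ?thesis using cH cA by linarith
  qed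
  have "\<not> V \<subseteq> H"
  proof
    assume "V \<subseteq> H"
    hence "n \<le> card H" using card_mono[OF fH] n by blast
    thus False using cH bigr by linarith
  qed
  then obtain x where x: "x \<in> V - H" by blast
  define Y1 where "Y1 = Nx x"
  have "real (card Y1) > 0" using Nx_card[OF x] half bigr unfolding Y1_def by linarith
  then obtain x' where x': "x' \<in> Y1" by (metis card.empty ex_in_conv less_irrefl of_nat_0)
  have x'V: "x' \<in> V - H" using x' Nx_sub[of x] nbh_sub[OF g, of x] unfolding Y1_def by blast
  have cod: "real (card (nbh E x \<inter> nbh E x')) < n / 4000" using x' unfolding Y1_def Nx_def by blast
  \<comment> \<open>\<open>Y1\<close> lies in the neighbourhood of \<open>x\<close>, so removing
    that neighbourhood makes the halves disjoint; the loss is the small codegree of \<open>x\<close>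
    and \<open>x'\<close>.\<close>
  define X1 where "X1 = Nx x' - nbh E x"
  have XY: "X1 \<inter> Y1 = {}" "X1 \<subseteq> V" "Y1 \<subseteq> V"
    unfolding X1_def Y1_def using Nx_sub[of x] Nx_sub[of x'] nbh_sub[OF g] by blast+
  have "Nx x' \<subseteq> X1 \<union> (nbh E x \<inter> nbh E x')" unfolding X1_def using Nx_sub[of x'] by blast
  hence "card (Nx x') \<le> card (X1 \<union> (nbh E x \<inter> nbh E x'))"
    using finite_nbh[OF g] Nx_fin unfolding X1_def by (intro card_mono) auto
  also have "\<dots> \<le> card X1 + card (nbh E x \<inter> nbh E x')" by (rule card_Un_le)
  finally have cX1: "real (card X1) \<ge> n div 2 - n / 40000 - 4 - n / 4000"
    using Nx_card[OF x'V] cod by linarith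
  have cY1: "real (card Y1) \<ge> n div 2 - n / 40000 - 4" unfolding Y1_def by (rule Nx_card[OF x])
  have f1: "finite X1" "finite Y1" unfolding X1_def Y1_def using Nx_fin by auto
  define Z where "Z = V - X1 - Y1"
  have cU: "card (X1 \<union> Y1) = card X1 + card Y1" by (rule card_Un_disjoint[OF f1 XY(1)])
  have "Z = V - (X1 \<union> Y1)" unfolding Z_def by blast
  hence "card Z = n - (card X1 + card Y1)"
    using f1 XY n cU card_Diff_subset[of "X1 \<union> Y1" V] by simp
  moreover have "card X1 + card Y1 \<le> n"
    using card_mono[OF fV, of "X1 \<union> Y1"] cU XY n by simp
  ultimately have "real (card Z) = real n - real (card X1) - real (card Y1)" by simp
  hence cZ: "real (card Z) \<le> 9 + n / 20000 + n / 4000" using cX1 cY1 half by linarith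
  have inner: "real (card (nbh E z \<inter> S)) \<le> n / 4000" if "S \<subseteq> Nx u" "z \<in> S" for u z S
  proof -
    have "nbh E z \<inter> S \<subseteq> nbh E u \<inter> nbh E z" using Nx_sub[of u] that(1) by blast
    hence "card (nbh E z \<inter> S) \<le> card (nbh E u \<inter> nbh E z)" using finite_nbh[OF g] by (intro card_mono) auto
    moreover have "real (card (nbh E u \<inter> nbh E z)) < n / 4000" using that unfolding Nx_def by blast
    ultimately show ?thesis by linarith
  qed
  have iX: "real (card (nbh E z \<inter> X1)) \<le> n / 4000" if "z \<in> X1" for z
    by (rule inner[OF _ that]) (auto simp: X1_def)
  have iY: "real (card (nbh E z \<inter> Y1)) \<le> n / 4000" if "z \<in> Y1" for z
    by (rule inner[OF _ that]) (auto simp: Y1_def)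
  have di: "card (nbh E z \<inter> X1) \<le> 6 \<or> card (nbh E z \<inter> Y1) \<le> 6" if "z \<in> V" for z
  proof (rule star_dichotomy[OF big g n XY(2,3,1) _ _ _ ng that])
    show "real (card (V - X1 - Y1)) \<le> real n / 1000" using cZ bigr unfolding Z_def by linarith
    show "real (card (nbh E z \<inter> X1)) \<le> real n / 1000" if "z \<in> X1" for z using iX[OF that] bigr by linarith
    show "real (card (nbh E z \<inter> Y1)) \<le> real n / 1000" if "z \<in> Y1" for z using iY[OF that] bigr by linarith
  qed
  have un3: "card (nbh E z \<inter> S) \<le> card (nbh E z \<inter> S1) + card S2" if "nbh E z \<inter> S \<subseteq> (nbh E z \<inter> S1) \<union> S2" "finite S2" for z S S1 S2
  proof -
    have "card (nbh E z \<inter> S) \<le> card ((nbh E z \<inter> S1) \<union> S2)"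
      using that finite_nbh[OF g] by (intro card_mono) auto
    thus ?thesis using card_Un_le[of "nbh E z \<inter> S1" S2] by linarith
  qed
  have degsplit: "real n / 2 - 1 / 2 \<le> real (card (nbh E z \<inter> S1)) + real (card (nbh E z \<inter> S2)) + real (card (V - S1 - S2))"
    if "z \<in> V" for z S1 S2
  proof -
    have "nbh E z \<subseteq> (nbh E z \<inter> S1) \<union> (nbh E z \<inter> S2) \<union> (V - S1 - S2)" using nbh_sub[OF g, of z] by blast
    hence "card (nbh E z) \<le> card ((nbh E z \<inter> S1) \<union> (nbh E z \<inter> S2) \<union> (V - S1 - S2))"
      using finite_nbh[OF g] fV by (intro card_mono) auto
    also have "\<dots> \<le> card (nbh E z \<inter> S1) + card (nbh E z \<inter> S2) + card (V - S1 - S2)"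
      by (meson add_mono card_Un_le le_trans order_refl)
    finally have "real (card (nbh E z)) \<le> real (card (nbh E z \<inter> S1)) + real (card (nbh E z \<inter> S2)) + real (card (V - S1 - S2))"
      by linarith
    moreover have "real (n div 2) \<le> real (card (nbh E z))" using deg[OF that] by simp
    ultimately show ?thesis using half by linarith
  qed
  \<comment> \<open>By the dichotomy every vertex outside \<open>X\<close> has at most six
    neighbours in \<open>Y1\<close>. The degree bound makes \<open>X1\<close> and \<open>Y1\<close>
    keep their sides.\<close>
  define X where "X = {z\<in>V. card (nbh E z \<inter> X1) \<le> 6}"
  define Y where "Y = V - X"
  have Y6: "card (nbh E z \<inter> Y1) \<le> 6" if "z \<in> Y" for z using that di unfolding Y_def X_def by blast
  have X1X: "z \<in> X" if "z \<in> X1" for z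
  proof (rule ccontr)
    assume "z \<notin> X"
    hence "z \<in> Y" using that XY unfolding Y_def by blast
    hence "real (card (nbh E z \<inter> Y1)) \<le> 6" using Y6 by fastforce
    moreover have "z \<in> V" using that XY by blast
    ultimately show False using degsplit[of z X1 Y1] iX[OF that] cZ bigr unfolding Z_def by linarith
  qed
  have Y1Y: "z \<in> Y" if "z \<in> Y1" for z
  proof (rule ccontr)
    assume "z \<notin> Y"
    hence "real (card (nbh E z \<inter> X1)) \<le> 6" using that XY unfolding Y_def X_def by fastforce
    moreover have "z \<in> V" using that XY by blast
    ultimately show False using degsplit[of z X1 Y1] iY[OF that] cZ bigr unfolding Z_def by linarith
  qed
  have fZ: "finite Z" unfolding Z_def using fV by simp
  have iX2: "real (card (nbh E z \<inter> X)) \<le> n / 1000" if "z \<in> X" for z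
  proof -
    have "nbh E z \<inter> X \<subseteq> (nbh E z \<inter> X1) \<union> Z" using Y1Y unfolding Y_def X_def Z_def by blast
    moreover have "card (nbh E z \<inter> X1) \<le> 6" using that unfolding X_def by blast
    ultimately have "card (nbh E z \<inter> X) \<le> 6 + card Z" using un3[OF _ fZ] by (meson add_right_mono le_trans)
    thus ?thesis using cZ bigr by linarith
  qed
  have iY2: "real (card (nbh E z \<inter> Y)) \<le> n / 1000" if "z \<in> Y" for z
  proof -
    have "nbh E z \<inter> Y \<subseteq> (nbh E z \<inter> Y1) \<union> Z" using X1X unfolding Y_def Z_def by blast
    hence "card (nbh E z \<inter> Y) \<le> 6 + card Z" using un3[OF _ fZ] Y6[OF that] by (meson add_right_mono le_trans)
    thus ?thesis using cZ bigr by linarith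
  qed
  have XYV: "X \<subseteq> V" "Y \<subseteq> V" "X \<inter> Y = {}" "X \<union> Y = V" "V - X - Y = {}" "V - Y - X = {}" unfolding X_def Y_def by auto
  \<comment> \<open>Applied to the full partition, the dichotomy leaves no intermediate case: at
    most six neighbours on the opposite side, together with at most n/1000 on its own, would
    contradict the minimum degree.\<close>
  have di2: "card (nbh E z \<inter> X) \<le> 6 \<or> card (nbh E z \<inter> Y) \<le> 6" if "z \<in> V" for z
  proof (rule star_dichotomy[OF big g n XYV(1-3) _ _ _ ng that])
    show "real (card (V - X - Y)) \<le> real n / 1000" unfolding XYV(5) by simp
  qed (use iX2 iY2 in blast)+
  have six: "card (nbh E z \<inter> S) \<le> 6"
    if "z \<in> V" "real (card (nbh E z \<inter> S)) \<le> n / 1000" "card (nbh E z \<inter> S) \<le> 6 \<or> card (nbh E z \<inter> S') \<le> 6" "V - S - S' = {}" for z S S'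
  proof (rule ccontr)
    assume "\<not> ?thesis"
    hence "real (card (nbh E z \<inter> S')) \<le> 6" using that(3) by simp
    thus False using degsplit[OF that(1), of S S'] that(2) bigr unfolding that(4) by simp
  qed
  have "balanced V E X Y" unfolding balanced_def
  proof (intro conjI ballI)
    show "card (nbh E z \<inter> X) \<le> 6" if "z \<in> X" for z
      using that XYV iX2[OF that] di2[of z] by (intro six[of z X Y]) auto
    show "card (nbh E z \<inter> Y) \<le> 6" if "z \<in> Y" for z
      using that XYV iY2[OF that] di2[of z] by (intro six[of z Y X]) auto
  qed (use XYV deg n in auto)
  thus ?thesis by blast
qed

end

section \<open>Graphs of maximum degree two without three disjoint edges\<close>

lemma sgraph_edgeE:
  assumes "sgraph V E" "e \<in> E"
  obtains u v where "u \<noteq> v" "e = {u, v}"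
proof -
  have "\<exists>u v. u \<in> V \<and> v \<in> V \<and> u \<noteq> v \<and> e = {u, v}" using assms unfolding sgraph_def by simp
  thus thesis using that by (elim exE conjE)
qed

definition disjoint_edges3 :: "nat set set \<Rightarrow> bool" where
  "disjoint_edges3 M \<longleftrightarrow> (\<exists>a1 b1 a2 b2 a3 b3. distinct [a1, b1, a2, b2, a3, b3] \<and>
     {a1, b1} \<in> M \<and> {a2, b2} \<in> M \<and> {a3, b3} \<in> M)"

lemma card_le1I: "finite S \<Longrightarrow> (\<And>x y. x \<in> S \<Longrightarrow> y \<in> S \<Longrightarrow> x = y) \<Longrightarrow> card S \<le> 1"
  using card_le_Suc0_iff_eq[of S] by (metis One_nat_def)

text \<open>A component of a graph of maximum degree two has at most three times as many vertices as its
  matching number.\<close>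
lemma card_nonisolated_le6:
  assumes g: "sgraph X M" and deg: "\<And>x. x \<in> X \<Longrightarrow> card (nbh M x) \<le> 2" and no: "\<not> disjoint_edges3 M"
  shows "card {x\<in>X. nbh M x \<noteq> {}} \<le> 6"
proof -
  define N where "N = {x\<in>X. nbh M x \<noteq> {}}"
  have fX: "finite X" using g sgraph_finite by blast
  define Att where "Att p q r s = {v\<in>N - {p, q, r, s}. \<exists>z\<in>{p, q}. {v, z} \<in> M}" for p q r s
  have fA: "finite (Att p q r s)" for p q r s unfolding Att_def N_def using fX by simp
  have d3: False if "{u, x} \<in> M" "{u, y} \<in> M" "{u, z} \<in> M" "distinct [x, y, z]" for u x y z
  proof -
    have "{x, y, z} \<subseteq> nbh M u" using that unfolding nbh_def by (auto simp: insert_commute)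
    hence "card {x, y, z} \<le> card (nbh M u)" using finite_nbh[OF g] by (intro card_mono)
    moreover have "card {x, y, z} = 3" using that(4) by simp
    moreover have "u \<in> X" using sgraph_edgeD[OF g that(1)] by blast
    ultimately show False using deg[of u] by simp
  qed
  show ?thesis
  proof (cases "\<exists>a b c d. distinct [a, b, c, d] \<and> {a, b} \<in> M \<and> {c, d} \<in> M")
    case True
    then obtain a b c d where abcd: "distinct [a, b, c, d]" "{a, b} \<in> M" "{c, d} \<in> M" by blast
    \<comment> \<open>Two vertices attached to the same end of \<open>pq\<close> give it degree
      three; attached to different ends they give, with \<open>rs\<close>, three disjoint
      edges.\<close>
    have one: "card (Att p q r s) \<le> 1"
      if pq: "distinct [p, q, r, s]" "{p, q} \<in> M" "{r, s} \<in> M" for p q r s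
    proof (rule card_le1I)
      show "finite (Att p q r s)" by (rule fA)
      fix x y assume x: "x \<in> Att p q r s"
        and y: "y \<in> Att p q r s"
      obtain zx where zx: "zx \<in> {p, q}" "{x, zx} \<in> M" using x unfolding Att_def by blast
      obtain zy where zy: "zy \<in> {p, q}" "{y, zy} \<in> M" using y unfolding Att_def by blast
      have xy: "x \<notin> {p, q, r, s}" "y \<notin> {p, q, r, s}" using x y unfolding Att_def by auto
      show "x = y"
      proof (rule ccontr)
        assume ne: "x \<noteq> y"
        show False
        proof (cases "zx = zy")
          case True
          define q' where "q' = (if zx = p then q else p)"
          have "{zx, q'} \<in> M" "q' \<noteq> x" "q' \<noteq> y" using pq zx xy unfolding q'_def by (auto simp: insert_commute)
          moreover have "{zx, x} \<in> M" "{zx, y} \<in> M" using zx zy True by (simp_all add: insert_commute)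
          ultimately show False using d3[of zx x y q'] ne by simp
        next
          case False
          have "distinct [x, zx, y, zy, r, s]" using False ne xy zx zy pq by auto
          thus False using no zx zy pq(3) unfolding disjoint_edges3_def by blast
        qed
      qed
    qed
    have "N \<subseteq> {a, b, c, d} \<union> (Att a b c d \<union> Att c d a b)"
    proof
      fix x assume x: "x \<in> N"
      then obtain z where z: "{x, z} \<in> M" unfolding N_def nbh_def by (auto simp: insert_commute)
      show "x \<in> {a, b, c, d} \<union> (Att a b c d \<union> Att c d a b)"
      proof (cases "x \<in> {a, b, c, d} \<or> z \<in> {a, b, c, d}")
        case True thus ?thesis using x z unfolding Att_def by auto
      next
        case False
        moreover have "x \<noteq> z" using sgraph_edgeD[OF g z] by blast
        ultimately have "distinct [a, b, c, d, x, z]" using abcd by auto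
        thus ?thesis using no abcd z unfolding disjoint_edges3_def by blast
      qed
    qed
    hence "card N \<le> card ({a, b, c, d} \<union> (Att a b c d \<union> Att c d a b))"
      using fA by (intro card_mono) auto
    also have "\<dots> \<le> card {a, b, c, d} + (card (Att a b c d) + card (Att c d a b))"
      by (meson add_left_mono card_Un_le le_trans)
    also have "\<dots> \<le> 4 + (1 + 1)"
      using one[of a b c d] one[of c d a b] abcd by (intro add_mono) auto
    finally show ?thesis unfolding N_def by simp
  next
    case False
    show ?thesis
    proof (cases "N = {}")
      case True
      thus ?thesis unfolding N_def[symmetric] by simp
    next
      case Nne: False
      then obtain a b where ab: "{a, b} \<in> M" unfolding N_def nbh_def by (auto simp: insert_commute)
      have "N \<subseteq> {a, b} \<union> (nbh M a \<union> nbh M b)"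
      proof
        fix x assume x: "x \<in> N"
        then obtain z where z: "{x, z} \<in> M" unfolding N_def nbh_def by (auto simp: insert_commute)
        have "x \<noteq> z" "a \<noteq> b" using sgraph_edgeD[OF g] z ab by blast+
        hence "x \<in> {a, b} \<or> z \<in> {a, b}" using False ab z by auto
        thus "x \<in> {a, b} \<union> (nbh M a \<union> nbh M b)" using z unfolding nbh_def by auto
      qed
      hence "card N \<le> card ({a, b} \<union> (nbh M a \<union> nbh M b))" using finite_nbh[OF g] by (intro card_mono) auto
      also have "\<dots> \<le> card {a, b} + (card (nbh M a) + card (nbh M b))" by (meson add_left_mono card_Un_le le_trans)
      also have "\<dots> \<le> 2 + (2 + 2)"
        using deg sgraph_edgeD[OF g ab] by (intro add_mono) (auto simp: card_insert_if)
      finally show ?thesis unfolding N_def by simp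
    qed
  qed
qed

text \<open>In the degree sum each of the at most six non-isolated vertices counts once, and once
  more if its degree is two. The first bound later supplies many vertices of inner degree
  two.\<close>

lemma card_edges_le_degree2:
  assumes g: "sgraph X M" and deg: "\<And>x. x \<in> X \<Longrightarrow> card (nbh M x) \<le> 2" and no: "\<not> disjoint_edges3 M"
  shows "2 * card M \<le> card {x\<in>X. card (nbh M x) = 2} + 6" and "card M \<le> 6"
proof -
  define N where "N = {x\<in>X. nbh M x \<noteq> {}}"
  have fX: "finite X" using g sgraph_finite by blast
  have N6: "card N \<le> 6" unfolding N_def by (rule card_nonisolated_le6[OF assms])
  have "2 * card M = (\<Sum>x\<in>X. card (nbh M x))" using sum_degrees[OF g] by simp
  also have "\<dots> \<le> (\<Sum>x\<in>X. (if x \<in> N then 1 else 0) + (if card (nbh M x) = 2 then 1 else 0))"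
  proof (rule sum_mono)
    fix x assume x: "x \<in> X"
    have "card (nbh M x) \<noteq> 0 \<Longrightarrow> x \<in> N" using x unfolding N_def by force
    thus "card (nbh M x) \<le> (if x \<in> N then 1 else 0) + (if card (nbh M x) = 2 then 1 else 0)"
      using deg[OF x] by (cases "x \<in> N") auto
  qed
  also have "\<dots> = card N + card {x\<in>X. card (nbh M x) = 2}"
    using fX by (simp add: sum.distrib sum.If_cases N_def Int_def)
  finally have 1: "2 * card M \<le> card N + card {x\<in>X. card (nbh M x) = 2}" .
  thus "2 * card M \<le> card {x\<in>X. card (nbh M x) = 2} + 6" using N6 by linarith
  have "card {x\<in>X. card (nbh M x) = 2} \<le> card N" unfolding N_def using fX by (intro card_mono) auto
  thus "card M \<le> 6" using 1 N6 by linarith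
qed

text \<open>Pairwise disjoint edges would form a matching, so among three edges two must
  meet.\<close>

lemma exists_degree2:
  assumes g: "sgraph X M" and no: "\<not> disjoint_edges3 M" and e: "card M \<ge> 3"
  shows "\<exists>u v w. v \<noteq> w \<and> {u, v} \<in> M \<and> {u, w} \<in> M"
proof (rule ccontr)
  assume neg: "\<not> ?thesis"
  have disj: "e \<inter> f = {}" if ef: "e \<in> M" "f \<in> M" "e \<noteq> f" for e f
  proof (rule ccontr)
    assume "e \<inter> f \<noteq> {}"
    then obtain u where u: "u \<in> e" "u \<in> f" by blast
    have other: "\<exists>v. h = {u, v}" if h: "h \<in> M" "u \<in> h" for h
    proof -
      obtain p q where "p \<noteq> q" and pq: "h = {p, q}" using sgraph_edgeE[OF g h(1)] .
      have "h = {q, p}" using pq by (simp only: insert_commute)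
      moreover have "u = p \<or> u = q" using h(2) pq by blast
      ultimately show ?thesis using pq by blast
    qed
    obtain v where v: "e = {u, v}" using other[OF ef(1) u(1)] by blast
    obtain w where w: "f = {u, w}" using other[OF ef(2) u(2)] by blast
    have "v \<noteq> w" "{u, v} \<in> M" "{u, w} \<in> M" using v w ef by auto
    thus False using neg by blast
  qed
  obtain S where S: "S \<subseteq> M" "card S = 3" using obtain_subset_with_card_n[OF e] by metis
  then obtain e1 e2 e3 where S3: "S = {e1, e2, e3}" "e1 \<noteq> e2" "e1 \<noteq> e3" "e2 \<noteq> e3" by (metis card_3_iff)
  have m: "e1 \<in> M" "e2 \<in> M" "e3 \<in> M" using S S3 by auto
  have two: "\<exists>a b. a \<noteq> b \<and> h = {a, b}" if "h \<in> M" for h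
    by (rule sgraph_edgeE[OF g that]) (intro exI conjI)
  obtain a1 b1 where 1: "a1 \<noteq> b1" "e1 = {a1, b1}" using two[OF m(1)] by blast
  obtain a2 b2 where 2: "a2 \<noteq> b2" "e2 = {a2, b2}" using two[OF m(2)] by blast
  obtain a3 b3 where 3: "a3 \<noteq> b3" "e3 = {a3, b3}" using two[OF m(3)] by blast
  have "distinct [a1, b1, a2, b2, a3, b3]"
    using disj[OF m(1,2) S3(2)] disj[OF m(1,3) S3(3)] disj[OF m(2,3) S3(4)] 1 2 3 by auto
  thus False using no m 1 2 3 unfolding disjoint_edges3_def by blast
qed

text \<open>An upper bound for the proportion of vertex subsets that may occur when both ends of each of \<open>e\<close>
  edges are unshattered; from three edges on, some vertex lies on two of them.\<close>
definition edge_ratio :: "nat \<Rightarrow> real" where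
  "edge_ratio e = (if e = 1 then 3 / 4 else if e = 2 then 5 / 8 else if e = 3 then 1 / 2 else 7 / 16)"

lemma card_le_edge_ratio:
  assumes g: "sgraph X M" and deg: "\<And>x. x \<in> X \<Longrightarrow> card (nbh M x) \<le> 2" and no: "\<not> disjoint_edges3 M"
    and e: "card M \<ge> 1" and N: "finite N" "F \<subseteq> Pow N" "M \<subseteq> Pow N"
    and un: "\<And>u v. {u, v} \<in> M \<Longrightarrow> unsh F u v"
  shows "real (card F) \<le> edge_ratio (card M) * 2 ^ card N"
proof -
  have fM: "finite M" using sgraph_finite_edges[OF g] .
  have two: "card h = 2" if "h \<in> M" for h
    by (rule sgraph_edgeE[OF g that]) simp
  have real: "real (a * card F) \<le> real (b * 2 ^ card N)" if "a * card F \<le> b * 2 ^ card N" for a b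
    using that by (rule of_nat_mono)
  consider "card M = 1" | "card M = 2" | "card M \<ge> 3" using e by linarith
  thus ?thesis
  proof cases
    case 1
    then obtain h where h: "h \<in> M" by (metis card_1_singletonE insertI1)
    obtain u v where uv: "h = {u, v}" "u \<noteq> v" using two[OF h] by (auto simp: card_2_iff)
    have "4 * card F \<le> 3 * 2 ^ card N"
      using h uv N un by (intro card_le_unsh1[of N F u v]) auto
    thus ?thesis using real[of 4 3] 1 unfolding edge_ratio_def by simp
  next
    case 2
    then obtain h h' where h: "h \<in> M" "h' \<in> M" "h \<noteq> h'" by (metis card_2_iff')
    have "8 * card F \<le> 5 * 2 ^ card N" by (rule card_le_unsh2[OF N two un h])
    thus ?thesis using real[of 8 5] 2 unfolding edge_ratio_def by simp
  next
    case 3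
    obtain u v w where uvw: "v \<noteq> w" "{u, v} \<in> M" "{u, w} \<in> M" using exists_degree2[OF g no 3] by blast
    have uX: "u \<in> X" using sgraph_edgeD[OF g uvw(2)] by blast
    define A where "A = del M {u}"
    \<comment> \<open>Deleting \<open>u\<close> removes at most two edges, so one edge avoids
      \<open>u\<close> if there are three, and two do if there are at least four.\<close>
    have cA: "card A + 2 \<ge> card M" using del_single[OF g uX] deg[OF uX] unfolding A_def by linarith
    have Amem: "h \<in> M" "u \<notin> h" if "h \<in> A" for h using that unfolding A_def del_def by auto
    have "A \<noteq> {}" using cA 3 by auto
    then obtain h where h: "h \<in> A" by blast
    have half: "2 * card F \<le> 2 ^ card N"
      by (rule card_le_unsh3(1)[OF N two un uvw(2,3,1) Amem[OF h]])
    show ?thesis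
    proof (cases "card M = 3")
      case True
      thus ?thesis using real[of 2 1] half unfolding edge_ratio_def by simp
    next
      case False
      have "card (A - {h}) \<ge> 1" using False 3 cA h by (simp add: card_Diff_singleton)
      hence "A - {h} \<noteq> {}" by (metis card.empty not_one_le_zero)
      then obtain h' where h': "h' \<in> A" "h \<noteq> h'" by blast
      have "16 * card F \<le> 7 * 2 ^ card N"
        by (rule card_le_unsh3(2)[OF N two un uvw(2,3,1) Amem[OF h] Amem[OF h'(1)] h'(2)])
      thus ?thesis using real[of 16 7] False 3 unfolding edge_ratio_def by simp
    qed
  qed
qed

text \<open>Here \<open>j\<close> is the number of edges beyond \<open>n\<^sup>2 div 4 + 6\<close>, \<open>miss\<close> the number of missing cross edges, \<open>p\<close> the
  number of vertices of inner degree two in the class with \<open>ey\<close> inner edges, and \<open>q\<close> the number of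
  those joined to all ends of the \<open>ex\<close> inner edges of the other class.\<close>
lemma edge_ratio_power_le:
  assumes e: "1 \<le> ex" "ex \<le> ey" "ey \<le> 6" and j: "1 \<le> j" "j + miss + 6 \<le> ex + ey" and q: "p \<le> q + miss" "2 * ey \<le> p + 6"
  shows "edge_ratio ex ^ q \<le> 7 / 8 * (1 / 2) ^ j"
proof -
  \<comment> \<open>A ratio of 7/16 = 7/8 * 1/2 for each excess edge suffices; as \<open>j\<close>
    is positive, one factor 7/8 survives and reserves 1/8 for the rare orientations.\<close>
  have gen: "s ^ j \<le> 7 / 8 * (1 / 2) ^ j" if s: "0 \<le> s" "s \<le> 7 / 16" for s :: real
  proof -
    have "s ^ j \<le> (7 / 8 * (1 / 2)) ^ j" using s by (intro power_mono) auto
    also have "\<dots> = (7 / 8) ^ j * (1 / 2) ^ j" by (rule power_mult_distrib)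
    also have "\<dots> \<le> 7 / 8 * (1 / 2) ^ j" using power_decreasing[of 1 j "7 / 8 :: real"] j(1) by simp
    finally show ?thesis .
  qed
  consider "ex = 1" | "ex = 2" | "ex = 3" | "ex \<ge> 4" using e by linarith
  thus ?thesis
  proof cases
    case 1
    \<comment> \<open>With \<open>ex = 1\<close> the constraints force \<open>ey = 6\<close>,
      \<open>j = 1\<close> and \<open>miss = 0\<close>, so \<open>q\<close> is at least 6.\<close>
    have "3 * j \<le> q" using 1 e j q by linarith
    hence "(3 / 4 :: real) ^ q \<le> (3 / 4) ^ (3 * j)" by (intro power_decreasing) auto
    also have "\<dots> = ((3 / 4) ^ 3) ^ j" by (rule power_mult)
    also have "\<dots> \<le> 7 / 8 * (1 / 2) ^ j" by (rule gen) (simp_all add: power_divide)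
    finally show ?thesis using 1 unfolding edge_ratio_def by simp
  next
    case 2
    have "2 * j \<le> q" using 2 e j q by linarith
    hence "(5 / 8 :: real) ^ q \<le> (5 / 8) ^ (2 * j)" by (intro power_decreasing) auto
    also have "\<dots> = ((5 / 8) ^ 2) ^ j" by (rule power_mult)
    also have "\<dots> \<le> 7 / 8 * (1 / 2) ^ j" by (rule gen) (simp_all add: power_divide)
    finally show ?thesis using 2 unfolding edge_ratio_def by simp
  next
    case 3
    have "j + 1 \<le> q" using 3 e j q by linarith
    hence "(1 / 2 :: real) ^ q \<le> (1 / 2) ^ (j + 1)" by (intro power_decreasing) auto
    also have "\<dots> \<le> 7 / 8 * (1 / 2) ^ j" by simp
    finally show ?thesis using 3 unfolding edge_ratio_def by simp
  next
    case 4
    have "j \<le> q" using 4 e j q by linarith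
    hence "(7 / 16 :: real) ^ q \<le> (7 / 16) ^ j" by (intro power_decreasing) auto
    also have "\<dots> \<le> 7 / 8 * (1 / 2) ^ j" by (rule gen) simp_all
    finally show ?thesis using 4 unfolding edge_ratio_def by simp
  qed
qed

subsection \<open>The final count\<close>

context fan_types
begin

lemma balanced_sym: "balanced V E X Y \<Longrightarrow> balanced V E Y X"
  unfolding balanced_def by blast

text \<open>A vertex has at most six neighbours in its own class, so each class has at least
  \<open>n div 2 - 6\<close> vertices and the other at most \<open>n div 2 + 7\<close>, where one
  unit is the parity of n. Missing cross neighbours are at most 7 + 6 = 13.\<close>

lemma balanced_bounds:
  assumes g: "sgraph V E" and n: "card V = n" "n \<ge> 100" and b: "balanced V E X Y"
  shows "n div 2 \<le> card Y + 6" "card Y \<le> n div 2 + 7"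
    and "\<And>v. v \<in> V \<Longrightarrow> card (nbh E v) \<le> n div 2 + 13"
    and "\<And>x. x \<in> X \<Longrightarrow> card (Y - nbh E x) \<le> 13"
proof -
  have fV: "finite V" using g sgraph_finite by blast
  have low: "n div 2 \<le> card Y' + 6 \<and> card (Y' - nbh E x) + n div 2 \<le> card Y' + 6"
    if b': "balanced V E X' Y'" and x: "x \<in> X'" for X' Y' x
  proof -
    have fY: "finite Y'" using b' fV unfolding balanced_def by (metis finite_Un)
    have "nbh E x = (nbh E x \<inter> X') \<union> (nbh E x \<inter> Y')" using nbh_sub[OF g, of x] b' unfolding balanced_def by blast
    hence "card (nbh E x) \<le> card (nbh E x \<inter> X') + card (nbh E x \<inter> Y')" by (metis card_Un_le)
    moreover have "card (nbh E x \<inter> X') \<le> 6" "n div 2 \<le> card (nbh E x)"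
      using b' x n unfolding balanced_def by auto
    moreover have "card (Y' - nbh E x) = card Y' - card (Y' \<inter> nbh E x)" using fY by (simp add: card_Diff_subset_Int)
    moreover have "card (Y' \<inter> nbh E x) \<le> card Y'" using fY by (intro card_mono) auto
    ultimately show ?thesis by (simp add: Int_commute)
  qed
  have fXY: "finite X" "finite Y" using b fV unfolding balanced_def by (metis finite_Un)+
  have sum: "card X + card Y = n" using b n card_Un_disjoint[OF fXY] unfolding balanced_def by simp
  have "X \<noteq> {}"
  proof
    assume e: "X = {}"
    hence V: "V = Y" using b unfolding balanced_def by blast
    have "Y \<noteq> {}" using sum n e by auto
    then obtain y where y: "y \<in> Y" by blast
    have "nbh E y \<inter> Y = nbh E y" using nbh_sub[OF g, of y] V by blast
    hence "card (nbh E y) \<le> 6" using b y unfolding balanced_def by metis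
    moreover have "n div 2 \<le> card (nbh E y)" using b y n V unfolding balanced_def by auto
    ultimately show False using n by linarith
  qed
  then obtain x where x: "x \<in> X" by blast
  show Y1: "n div 2 \<le> card Y + 6" using low[OF b x] by blast
  have "Y \<noteq> {}" using Y1 n by auto
  then obtain y where y: "y \<in> Y" by blast
  have X1: "n div 2 \<le> card X + 6" using low[OF balanced_sym[OF b] y] by blast
  show Y2: "card Y \<le> n div 2 + 7" using X1 sum by linarith
  have X2: "card X \<le> n div 2 + 7" using Y1 sum by linarith
  show "card (nbh E v) \<le> n div 2 + 13" if v: "v \<in> V" for v
  proof -
    have *: "card (nbh E v) \<le> n div 2 + 13" if "balanced V E X' Y'" "v \<in> X'" "card Y' \<le> n div 2 + 7" "finite Y'" for X' Y'
    proof -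
      have "nbh E v \<subseteq> (nbh E v \<inter> X') \<union> Y'" using nbh_sub[OF g, of v] that(1) unfolding balanced_def by blast
      hence "card (nbh E v) \<le> card ((nbh E v \<inter> X') \<union> Y')" using that(4) finite_nbh[OF g] by (intro card_mono) auto
      also have "\<dots> \<le> card (nbh E v \<inter> X') + card Y'" by (rule card_Un_le)
      also have "card (nbh E v \<inter> X') \<le> 6" using that(1,2) unfolding balanced_def by blast
      finally show ?thesis using that(3) by linarith
    qed
    have "v \<in> X \<or> v \<in> Y" using v b unfolding balanced_def by blast
    thus ?thesis using *[OF b _ Y2 fXY(2)] *[OF balanced_sym[OF b] _ X2 fXY(1)] by blast
  qed
  show "card (Y - nbh E x) \<le> 13" if "x \<in> X" for x using low[OF b that] Y2 by linarith
qed

text \<open>84 = 6 * 13 + 6: thirteen non-neighbours for each of six vertices, and the possible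
  deficit of the class.\<close>

lemma balanced_common:
  assumes g: "sgraph V E" and n: "card V = n" "n \<ge> 100" and b: "balanced V E X Y"
    and S: "S \<subseteq> X" "finite S" "card S \<le> 6"
  shows "n div 2 \<le> card {w\<in>Y. S \<subseteq> nbh E w} + 84"
proof -
  have fV: "finite V" using g sgraph_finite by blast
  have fY: "finite Y" using b fV unfolding balanced_def by (metis finite_Un)
  have "Y - (\<Union>x\<in>S. Y - nbh E x) \<subseteq> {w\<in>Y. S \<subseteq> nbh E w}" using nbh_sym[of _ E] by blast
  hence "card (Y - (\<Union>x\<in>S. Y - nbh E x)) \<le> card {w\<in>Y. S \<subseteq> nbh E w}" using fY by (intro card_mono) auto
  moreover have "card Y - card (\<Union>x\<in>S. Y - nbh E x) \<le> card (Y - (\<Union>x\<in>S. Y - nbh E x))"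
    using S fY by (intro diff_card_le_card_Diff) auto
  moreover have "card (\<Union>x\<in>S. Y - nbh E x) \<le> (\<Sum>x\<in>S. card (Y - nbh E x))" by (rule card_UN_le[OF S(2)])
  moreover have "(\<Sum>x\<in>S. card (Y - nbh E x)) \<le> (\<Sum>x\<in>S. 13)"
    using S(1) balanced_bounds(4)[OF g n b] by (intro sum_mono) blast
  ultimately show ?thesis using S(3) balanced_bounds(1)[OF g n b] by simp
qed

text \<open>The two conditions under which a class has at most six inner edges.\<close>

definition tame :: "nat set set \<Rightarrow> nat set \<Rightarrow> bool" where
  "tame E X \<longleftrightarrow> (\<forall>x\<in>X. card (nbh E x \<inter> X) \<le> 2) \<and> \<not> disjoint_edges3 {e\<in>E. e \<subseteq> X}"

lemma tame_if_no_gain: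
  assumes big: "large n" and g: "sgraph V E" and n: "card V = n" and b: "balanced V E X Y" and ng: "\<not> gain V E"
  shows "tame E X"
proof -
  have n100: "n \<ge> 100" and n1000: "real n \<ge> 1000" using largeD(1)[OF big] by simp_all
  have fV: "finite V" using g sgraph_finite by blast
  have XYV: "X \<union> Y = V" using b unfolding balanced_def by blast
  have fX: "finite X" "X \<subseteq> V" and fY: "finite Y" "Y \<subseteq> V" using XYV fV by auto
  have degr: "real (card (nbh E u)) \<le> real n / 2 + 20" if "u \<in> V" for u
  proof -
    have "real (card (nbh E u)) \<le> real (n div 2 + 13)"
      using balanced_bounds(3)[OF g n n100 b that] by (rule of_nat_mono)
    moreover have "real (n div 2) \<le> real n / 2" by linarith
    ultimately show ?thesis by simp
  qed
  have comm: "real n / 4 \<le> real (card {w\<in>Y. S \<subseteq> nbh E w})" if "S \<subseteq> X" "finite S" "card S \<le> 6" for S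
  proof -
    have "real (n div 2) \<le> real (card {w\<in>Y. S \<subseteq> nbh E w} + 84)"
      using balanced_common[OF g n n100 b that] by (rule of_nat_mono)
    thus ?thesis using half_le_div[of n] n1000 by simp
  qed
  have "card (nbh E v \<inter> X) \<le> 2" if v: "v \<in> X" for v
  proof (rule ccontr)
    assume "\<not> ?thesis"
    hence "3 \<le> card (nbh E v \<inter> X)" by simp
    then obtain S where S: "S \<subseteq> nbh E v \<inter> X" "card S = 3" using obtain_subset_with_card_n by metis
    then obtain x1 x2 x3 where x: "S = {x1, x2, x3}" "distinct [x1, x2, x3]" by (auto simp: card_3_iff)
    have "gain V E"
    proof (rule inner3_gain[OF big g n x(2)])
      fix z assume z: "z \<in> {x1, x2, x3}"
      have "{w\<in>Y. {v, z} \<subseteq> nbh E w} \<subseteq> nbh E v \<inter> nbh E z" using nbh_sym[of _ E] by blast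
      hence "card {w\<in>Y. {v, z} \<subseteq> nbh E w} \<le> card (nbh E v \<inter> nbh E z)"
        using finite_nbh[OF g] by (intro card_mono) auto
      moreover have "real n / 4 \<le> real (card {w\<in>Y. {v, z} \<subseteq> nbh E w})"
        using S x v z by (intro comm) (auto simp: card_insert_if)
      ultimately show "real n / 4 \<le> real (card (nbh E v \<inter> nbh E z))" by linarith
    next
      show "{x1, x2, x3} \<subseteq> nbh E v" using S x by blast
      show "real (card (nbh E u)) \<le> real n / 2 + 20" if "u \<in> {v, x1, x2, x3}" for u
        using that S x v fX by (intro degr) blast
    qed
    thus False using ng by blast
  qed
  moreover have "\<not> disjoint_edges3 {e\<in>E. e \<subseteq> X}"
  proof
    assume "disjoint_edges3 {e\<in>E. e \<subseteq> X}"
    then obtain a1 b1 a2 b2 a3 b3 where d: "distinct [a1, b1, a2, b2, a3, b3]"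
      and e: "{a1, b1} \<in> {e\<in>E. e \<subseteq> X}" "{a2, b2} \<in> {e\<in>E. e \<subseteq> X}" "{a3, b3} \<in> {e\<in>E. e \<subseteq> X}"
      unfolding disjoint_edges3_def by (elim exE conjE)
    let ?S = "{a1, b1, a2, b2, a3, b3}"
    have SX: "?S \<subseteq> X" using e by blast
    have "real n / 4 \<le> real (card {w\<in>Y. ?S \<subseteq> nbh E w})"
      using SX by (intro comm) (auto simp: card_insert_if)
    also have "\<dots> \<le> real (card {w\<in>V. ?S \<subseteq> nbh E w})"
      using fV fY by (intro of_nat_mono card_mono) auto
    finally have c: "real n / 4 \<le> real (card {w\<in>V. ?S \<subseteq> nbh E w})" .
    have "gain V E"
    proof (rule matching_gain[OF big g n d _ _ _ _ c])
      show "real (card (nbh E u)) \<le> real n / 2 + 20" if "u \<in> ?S" for u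
        using that SX fX by (intro degr) blast
    qed (use e in blast)+
    thus False using ng by blast
  qed
  ultimately show ?thesis unfolding tame_def by blast
qed

text \<open>The vertices of \<open>F\<close> are joined to all of \<open>K\<close> and are never
  centres of a first-type triangle on an edge of \<open>M\<close>. So each such edge is unshattered
  at each vertex of \<open>F\<close>, which costs \<open>edge_ratio\<close> per vertex.\<close>

lemma card_typical:
  assumes g: "sgraph V E" and X: "X \<subseteq> V" and t: "tame E X"
    and M: "M = {e\<in>E. e \<subseteq> X}" "card M \<ge> 1" and K: "K = {x\<in>X. nbh E x \<inter> X \<noteq> {}}"
    and F: "F \<subseteq> V - X" "\<And>y. y \<in> F \<Longrightarrow> K \<subseteq> nbh E y"
  shows "real (card {R\<in>FO E. \<forall>y\<in>F. \<forall>a b. {a, b} \<in> M \<longrightarrow> \<not> tri R t1 y a b}) \<le> edge_ratio (card M) ^ card F * 2 ^ card E"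
proof -
  define U where "U = {R\<in>FO E. \<forall>y\<in>F. \<forall>a b. {a, b} \<in> M \<longrightarrow> \<not> tri R t1 y a b}"
  have fV: "finite V" using g sgraph_finite by blast
  have fX: "finite X" using X fV finite_subset by blast
  have KX: "K \<subseteq> X" unfolding K by blast
  have KV: "K \<subseteq> V" using KX X by blast
  have fK: "finite K" using KX fX finite_subset by blast
  have gM: "sgraph X M" unfolding M(1) by (rule sgraph_induced[OF g X])
  have nM: "nbh M x = nbh E x \<inter> X" if "x \<in> X" for x using that unfolding M(1) nbh_def by auto
  have MK: "a \<in> K \<and> b \<in> K" if ab: "{a, b} \<in> M" for a b
  proof -
    have "{a, b} \<in> E" "a \<in> X" "b \<in> X" using ab unfolding M(1) by auto
    thus ?thesis unfolding K nbh_def by (auto simp: insert_commute)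
  qed
  have MK': "M = {e\<in>E. e \<subseteq> K}"
  proof
    show "M \<subseteq> {e\<in>E. e \<subseteq> K}"
    proof
      fix h assume h: "h \<in> M"
      obtain a b where "h = {a, b}" using sgraph_edgeE[OF gM h] by blast
      thus "h \<in> {e\<in>E. e \<subseteq> K}" using MK h unfolding M(1) by auto
    qed
    show "{e\<in>E. e \<subseteq> K} \<subseteq> M" unfolding M(1) using KX by blast
  qed
  have r0: "0 \<le> edge_ratio (card M)" unfolding edge_ratio_def by simp
  define s where "s = (\<Sum>w\<in>V - K. card (nbh E w \<inter> K))"
  \<comment> \<open>The patterns inside \<open>K\<close> are counted exactly,
    \<open>2 ^ card M\<close> instead of all relations on \<open>K\<close>, since no constant may be
    lost here.\<close>
  let ?Is = "{I. orientation_of M I}"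
  have fI: "finite ?Is" by (rule finite_orientations[OF gM])
  have inI: "R \<inter> K \<times> K \<in> ?Is" if "R \<in> FO E" for R
    using FO_orient[OF that] unfolding MK' orientation_of_def by auto
  have cls: "real (card {R\<in>U. R \<inter> K \<times> K = I}) \<le> edge_ratio (card M) ^ card F * 2 ^ s * real (cnt (del E K))" for I
  proof -
    define T where "T = {R\<in>U. R \<inter> K \<times> K = I}"
    have T: "T \<subseteq> FO E" unfolding T_def U_def by blast
    have agree: "agree_on K T" unfolding agree_on_def T_def by blast
    show ?thesis unfolding T_def[symmetric] s_def
    proof (rule card_class_ratio[OF g KV T agree r0])
      show "F \<subseteq> V - K" using F(1) KX by blast
      fix w assume w: "w \<in> F"
      have Kw: "nbh E w \<inter> K = K" using F(2)[OF w] by blast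
      have "real (card (traces K T w)) \<le> edge_ratio (card M) * 2 ^ card K"
      proof (rule card_le_edge_ratio[OF gM _ _ M(2) fK])
        show "card (nbh M x) \<le> 2" if "x \<in> X" for x using t that nM unfolding tame_def by simp
        show "\<not> disjoint_edges3 M" using t unfolding tame_def M(1) by blast
        show "traces K T w \<subseteq> Pow K" unfolding traces_def sv_def by blast
        show "M \<subseteq> Pow K" unfolding MK' by blast
        fix u v assume uv: "{u, v} \<in> M"
        have uvK: "u \<in> K" "v \<in> K" "{u, v} \<in> E" using MK[OF uv] uv unfolding M(1) by auto
        have uw: "{u, w} \<in> E" "{v, w} \<in> E" using F(2)[OF w] uvK unfolding nbh_def by auto
        show "unsh (traces K T w) u v"
        proof (rule unsh_spoke[OF g T agree uvK uw])
          show "(\<forall>R\<in>T. \<not> tri R t1 u v w) \<or> (\<forall>R\<in>T. \<not> tri R t1 w u v)"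
            using w uv unfolding T_def U_def by blast
        qed
      qed
      thus "real (card (traces K T w)) \<le> edge_ratio (card M) * 2 ^ card (nbh E w \<inter> K)" unfolding Kw .
    qed
  qed
  have UF: "U \<subseteq> FO E" unfolding U_def by blast
  have "U = (\<Union>I\<in>?Is. {R\<in>U. R \<inter> K \<times> K = I})" using inI UF by blast
  hence "card U \<le> (\<Sum>I\<in>?Is. card {R\<in>U. R \<inter> K \<times> K = I})"
    using card_UN_le[OF fI, of "\<lambda>I. {R\<in>U. R \<inter> K \<times> K = I}"] by (simp only:)
  hence "real (card U) \<le> (\<Sum>I\<in>?Is. real (card {R\<in>U. R \<inter> K \<times> K = I}))"
    by (simp only: of_nat_sum[symmetric] of_nat_le_iff)
  also have "\<dots> \<le> (\<Sum>I\<in>?Is. edge_ratio (card M) ^ card F * 2 ^ s * real (cnt (del E K)))" by (intro sum_mono cls)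
  also have "\<dots> = 2 ^ card M * (edge_ratio (card M) ^ card F * 2 ^ s * real (cnt (del E K)))"
    using card_orientations[OF gM] by simp
  also have "\<dots> \<le> 2 ^ card M * (edge_ratio (card M) ^ card F * 2 ^ s * 2 ^ card (del E K))"
    using r0 of_nat_mono[OF cnt_le[OF sgraph_del[OF g, of K]], where 'a = real] by (intro mult_left_mono) simp_all
  also have "\<dots> = edge_ratio (card M) ^ card F * 2 ^ (card M + s + card (del E K))" by (simp add: power_add)
  also have "card M + s + card (del E K) = card E" using card_edges_split[OF g KV] unfolding MK' s_def by simp
  finally show ?thesis unfolding U_def .
qed

text \<open>With \<open>j\<close> excess edges all orientations exceed the target by the factor
  \<open>2 ^ j\<close>. Typical ones are at most 7/8 and atypical ones at most 1/8 of the target.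
  \<open>Y\<close> is the class with more inner edges because this guarantees enough vertices of
  inner degree two.\<close>

lemma endgame:
  assumes big: "large n" and g: "sgraph V E" and n: "card V = n" and b: "balanced V E X Y" and tX: "tame E X" and tY: "tame E Y"
    and le: "card {e\<in>E. e \<subseteq> X} \<le> card {e\<in>E. e \<subseteq> Y}"
    and excess: "\<not> card E \<le> n\<^sup>2 div 4 + 6"
  shows "cnt E \<le> 2 ^ (n\<^sup>2 div 4 + 6)"
proof -
  have e1: "90 + 1 * log 2 (real n) \<le> (1 / 5) * real n" and e2: "n \<ge> 1000"
    using largeD[OF big] by (linarith, simp)
  have n100: "n \<ge> 100" using e2 by simp
  have fV: "finite V" using g sgraph_finite by blast
  have XY: "X \<union> Y = V" "X \<inter> Y = {}" using b unfolding balanced_def by auto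
  have fXY: "finite X" "finite Y" using XY(1) fV by auto
  define MX where "MX = {e\<in>E. e \<subseteq> X}"
  define MY where "MY = {e\<in>E. e \<subseteq> Y}"
  have gX: "sgraph X MX" unfolding MX_def using XY by (intro sgraph_induced[OF g]) blast
  have gY: "sgraph Y MY" unfolding MY_def using XY by (intro sgraph_induced[OF g]) blast
  have nX: "nbh MX x = nbh E x \<inter> X" if "x \<in> X" for x using that unfolding MX_def nbh_def by auto
  have nY: "nbh MY y = nbh E y \<inter> Y" if "y \<in> Y" for y using that unfolding MY_def nbh_def by auto
  have dX: "card (nbh MX x) \<le> 2" if "x \<in> X" for x using tX that nX unfolding tame_def by simp
  have dY: "card (nbh MY y) \<le> 2" if "y \<in> Y" for y using tY that nY unfolding tame_def by simp
  have oX: "\<not> disjoint_edges3 MX" using tX unfolding tame_def MX_def by blast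
  have oY: "\<not> disjoint_edges3 MY" using tY unfolding tame_def MY_def by blast
  define Dy where "Dy = {y\<in>Y. card (nbh MY y) = 2}"
  have p: "2 * card MY \<le> card Dy + 6" and eY: "card MY \<le> 6"
    using card_edges_le_degree2[OF gY dY oY] unfolding Dy_def by blast+
  define j where "j = card E - (n\<^sup>2 div 4 + 6)"
  have jE: "card E = n\<^sup>2 div 4 + 6 + j" "1 \<le> j" using excess unfolding j_def by auto
  define miss where "miss = (\<Sum>y\<in>Y. card (X - nbh E y))"
  have split: "card E + miss = card MX + card MY + card X * card Y"
  proof -
    have "V - X = Y" using XY by blast
    hence "card E = card MX + (\<Sum>w\<in>Y. card (nbh E w \<inter> X)) + card (del E X)"
      using card_edges_split[OF g, of X] XY unfolding MX_def by auto
    moreover have "del E X = MY"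
    proof -
      have "e \<subseteq> V" if "e \<in> E" for e using sgraph_edgeE[OF g that] sgraph_edgeD[OF g] that by (metis empty_subsetI insert_subset)
      thus ?thesis unfolding del_def MY_def using XY by blast
    qed
    moreover have "(\<Sum>w\<in>Y. card (nbh E w \<inter> X)) + miss = (\<Sum>w\<in>Y. card X)"
      unfolding miss_def sum.distrib[symmetric]
    proof (rule sum.cong)
      fix w
      have "X = (nbh E w \<inter> X) \<union> (X - nbh E w)" by blast
      hence "card X = card ((nbh E w \<inter> X) \<union> (X - nbh E w))" by (rule arg_cong)
      also have "\<dots> = card (nbh E w \<inter> X) + card (X - nbh E w)"
        by (rule card_Un_disjoint) (use fXY in auto)
      finally show "card (nbh E w \<inter> X) + card (X - nbh E w) = card X" by (rule sym)
    qed simp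
    ultimately show ?thesis by simp
  qed
  have "card X + card Y = n" using n XY card_Un_disjoint[OF fXY] by simp
  hence "(int n)\<^sup>2 = 4 * (int (card X) * int (card Y)) + (int (card X) - int (card Y))\<^sup>2"
    by (auto simp: power2_eq_square algebra_simps)
  hence "4 * (int (card X) * int (card Y)) \<le> (int n)\<^sup>2"
    using zero_le_power2[of "int (card X) - int (card Y)"] by linarith
  hence "int (4 * (card X * card Y)) \<le> int (n\<^sup>2)" by simp
  hence "4 * (card X * card Y) \<le> n\<^sup>2" by (simp only: of_nat_le_iff)
  hence "card X * card Y \<le> n\<^sup>2 div 4" by linarith
  hence jm: "j + miss + 6 \<le> card MX + card MY" using split jE by linarith
  have leM: "card MX \<le> card MY" using le unfolding MX_def MY_def .
  \<comment> \<open>\<open>Y\<close> has at most six inner edges, so any excess forces an inner edge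
    in \<open>X\<close>.\<close>
  have eX: "1 \<le> card MX" using jm jE eY by linarith
  define K where "K = {x\<in>X. nbh E x \<inter> X \<noteq> {}}"
  have fK: "finite K" unfolding K_def using fXY by simp
  define F where "F = {y\<in>Dy. K \<subseteq> nbh E y}"
  have fF: "finite F" "finite Dy" unfolding F_def Dy_def using fXY by auto
  have FY: "F \<subseteq> Y" unfolding F_def Dy_def by blast
  \<comment> \<open>Each discarded vertex of \<open>Dy\<close> lacks a cross edge of its own, so
    losses in \<open>F\<close> are paid for by missing edges.\<close>
  have "card (Dy - F) \<le> miss"
  proof -
    have "card (Dy - F) = (\<Sum>y\<in>Dy - F. 1)" by simp
    also have "\<dots> \<le> (\<Sum>y\<in>Dy - F. card (X - nbh E y))"
    proof (rule sum_mono)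
      fix y assume "y \<in> Dy - F"
      then obtain x where "x \<in> X - nbh E y" unfolding F_def K_def by blast
      thus "1 \<le> card (X - nbh E y)" using fXY by (metis One_nat_def Suc_leI card_gt_0_iff empty_iff finite_Diff)
    qed
    also have "\<dots> \<le> miss" unfolding miss_def Dy_def using fXY by (intro sum_mono2) auto
    finally show ?thesis .
  qed
  moreover have "card (Dy - F) = card Dy - card F" using fF F_def by (intro card_Diff_subset) auto
  ultimately have q: "card Dy \<le> card F + miss" by linarith
  have ratio: "edge_ratio (card MX) ^ card F \<le> 7 / 8 * (1 / 2) ^ j"
    by (rule edge_ratio_power_le[OF eX leM eY jE(2) jm q p])
  define Typ where "Typ = {R\<in>FO E. \<forall>y\<in>F. \<forall>a b. {a, b} \<in> MX \<longrightarrow> \<not> tri R t1 y a b}"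
  define Aty where "Aty = (\<lambda>(y, a, b). {R\<in>FO E. tri R t1 y a b})"
  define Ix where "Ix = {(y, a, b). y \<in> F \<and> {a, b} \<in> MX}"
  have typc: "real (card Typ) \<le> edge_ratio (card MX) ^ card F * 2 ^ card E"
    unfolding Typ_def
  proof (rule card_typical[OF g _ tX MX_def eX K_def])
    show "F \<subseteq> V - X" using FY XY by blast
  qed (use XY in \<open>auto simp: F_def\<close>)
  have K6: "card K \<le> 6"
  proof -
    have "K = {x\<in>X. nbh MX x \<noteq> {}}" unfolding K_def using nX by auto
    thus ?thesis using card_nonisolated_le6[OF gX dX oX] by simp
  qed
  have F6: "card F \<le> 6"
  proof -
    have "F \<subseteq> {y\<in>Y. nbh MY y \<noteq> {}}" unfolding F_def Dy_def by auto
    hence "card F \<le> card {y\<in>Y. nbh MY y \<noteq> {}}" using fXY by (intro card_mono) auto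
    thus ?thesis using card_nonisolated_le6[OF gY dY oY] by simp
  qed
  have Ixs: "Ix \<subseteq> F \<times> K \<times> K"
  proof
    fix x assume "x \<in> Ix"
    then obtain y a b where x: "x = (y, a, b)" "y \<in> F" "{a, b} \<in> MX" unfolding Ix_def by blast
    have "a \<in> nbh MX b" "b \<in> nbh MX a" "a \<in> X" "b \<in> X"
      using x(3) sgraph_edgeD[OF gX x(3)] unfolding nbh_def by (auto simp: insert_commute)
    hence "a \<in> K" "b \<in> K" unfolding K_def using nX by blast+
    thus "x \<in> F \<times> K \<times> K" using x by blast
  qed
  have fIx: "finite Ix" by (rule finite_subset[OF Ixs]) (use fF fK in simp)
  have "card Ix \<le> card (F \<times> K \<times> K)" using Ixs fF fK by (intro card_mono) auto
  also have "\<dots> = card F * (card K * card K)" by (simp add: card_cartesian_product)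
  also have "\<dots> \<le> 6 * (6 * 6)" using F6 K6 by (intro mult_le_mono)
  finally have cIx: "card Ix \<le> 216" by simp
  \<comment> \<open>92 = 84 + 8: the deficit in \<open>balanced_common\<close> and the margin
    required by \<open>atypical_bound\<close>.\<close>
  define m where "m = n div 2 - 92"
  have aty: "real (card (Aty x)) \<le> 2 ^ 9 * (4 * real n) * ((3 / 4) ^ m * 2 ^ card E)" if x: "x \<in> Ix" for x
  proof -
    obtain y a b where yab: "x = (y, a, b)" "y \<in> F" "{a, b} \<in> MX" using x unfolding Ix_def by blast
    have yY: "y \<in> Y" "card (nbh MY y) = 2" using yab(2) unfolding F_def Dy_def by auto
    obtain x2 x3 where x23: "nbh MY y = {x2, x3}" "x2 \<noteq> x3" using yY(2) by (auto simp: card_2_iff)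
    hence x23': "x2 \<in> nbh E y \<inter> Y" "x3 \<in> nbh E y \<inter> Y" using nY[OF yY(1)] by auto
    have ab: "a \<in> X" "b \<in> X" "a \<noteq> b" using sgraph_edgeD[OF gX yab(3)] by auto
    have S: "{y, x2, x3} \<subseteq> Y" using x23' yY by blast
    have mm: "m + 8 \<le> card (nbh E y \<inter> nbh E z)" if "z \<in> {x2, x3}" for z
    proof -
      have "{w\<in>X. {y, z} \<subseteq> nbh E w} \<subseteq> nbh E y \<inter> nbh E z" using nbh_sym[of _ E] by blast
      hence "card {w\<in>X. {y, z} \<subseteq> nbh E w} \<le> card (nbh E y \<inter> nbh E z)"
        using finite_nbh[OF g] by (intro card_mono) auto
      moreover have "n div 2 \<le> card {w\<in>X. {y, z} \<subseteq> nbh E w} + 84"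
        by (rule balanced_common[OF g n n100 balanced_sym[OF b]]) (use S that in \<open>auto simp: card_insert_if\<close>)
      ultimately show ?thesis unfolding m_def using e2 by linarith
    qed
    have d: "distinct [a, b, x2, x3]" using ab x23 x23' XY by auto
    show ?thesis unfolding Aty_def yab(1) prod.case n[symmetric]
      by (rule atypical_bound[OF g d _ _ mm]) (use x23' in auto)
  qed
  have "FO E \<subseteq> Typ \<union> (\<Union>x\<in>Ix. Aty x)" unfolding Typ_def Aty_def Ix_def by auto
  hence "cnt E \<le> card (Typ \<union> (\<Union>x\<in>Ix. Aty x))"
    unfolding cnt_def using finite_FO[OF g] fIx by (intro card_mono) (auto simp: Typ_def Aty_def)
  also have "\<dots> \<le> card Typ + card (\<Union>x\<in>Ix. Aty x)" by (rule card_Un_le)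
  also have "card (\<Union>x\<in>Ix. Aty x) \<le> (\<Sum>x\<in>Ix. card (Aty x))" by (rule card_UN_le[OF fIx])
  finally have "cnt E \<le> card Typ + (\<Sum>x\<in>Ix. card (Aty x))" by simp
  hence "real (cnt E) \<le> real (card Typ + (\<Sum>x\<in>Ix. card (Aty x)))" by (rule of_nat_mono)
  also have "\<dots> = real (card Typ) + (\<Sum>x\<in>Ix. real (card (Aty x)))" by simp
  also have "(\<Sum>x\<in>Ix. real (card (Aty x))) \<le> (\<Sum>x\<in>Ix. 2 ^ 9 * (4 * real n) * ((3 / 4) ^ m * 2 ^ card E))"
    by (intro sum_mono aty)
  also have "\<dots> = real (card Ix) * (2 ^ 9 * (4 * real n) * ((3 / 4) ^ m * 2 ^ card E))" by simp
  also have "\<dots> \<le> 256 * (2 ^ 9 * (4 * real n) * ((3 / 4) ^ m * 2 ^ card E))"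
    using cIx by (intro mult_right_mono) simp_all
  also have "\<dots> = (2 ^ 19 * real n * (3 / 4) ^ m) * 2 ^ card E" by simp
  also have "\<dots> \<le> (1 / 8 * (1 / 2) ^ j) * 2 ^ card E"
  proof (rule mult_right_mono)
    have n0: "n > 0" using e2 by simp
    have "real m \<ge> n / 2 - 93"
      unfolding m_def using half_le_div[of n] e2 by (simp add: of_nat_diff)
    hence mr: "19 + 1 * log 2 (real n) + real m * (- (2 / 5)) \<le> - 9" using e1 by simp
    have "(3 / 4 :: real) ^ m \<le> (2 powr (- (2 / 5))) ^ m" using three_quarters_le by (intro power_mono) auto
    also have "\<dots> = 2 powr (real m * (- (2 / 5)))" by (subst powr_power) simp_all
    finally have "2 ^ 19 * real n * (3 / 4) ^ m \<le> 2 ^ 19 * real n * 2 powr (real m * (- (2 / 5)))"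
      by (intro mult_left_mono) simp_all
    also have "\<dots> = 2 powr (19 + 1 * log 2 (real n) + real m * (- (2 / 5)))"
      using n0 unfolding powr_add by simp
    also have "\<dots> \<le> 2 powr (- 9)" using mr by (intro powr_mono) simp_all
    \<comment> \<open>The exponent -9 was chosen for the largest possible excess,
      \<open>j = 6\<close>.\<close>
    also have "\<dots> = 1 / 8 * (1 / 2) ^ 6" by (simp add: powr_minus power_divide)
    also have "\<dots> \<le> 1 / 8 * (1 / 2) ^ j"
    proof -
      have "j \<le> 6" using jm leM eY by linarith
      hence "(1 / 2 :: real) ^ 6 \<le> (1 / 2) ^ j" by (intro power_decreasing) simp_all
      thus ?thesis by simp
    qed
    finally show "2 ^ 19 * real n * (3 / 4) ^ m \<le> 1 / 8 * (1 / 2) ^ j" .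
  qed simp
  finally have "real (cnt E) \<le> real (card Typ) + (1 / 8 * (1 / 2) ^ j) * 2 ^ card E" by simp
  also have "real (card Typ) \<le> (7 / 8 * (1 / 2) ^ j) * 2 ^ card E"
    by (rule order_trans[OF typc mult_right_mono[OF ratio]]) simp
  finally have "real (cnt E) \<le> (1 / 2) ^ j * 2 ^ card E" by (simp add: mult.commute)
  also have "\<dots> = real (2 ^ (n\<^sup>2 div 4 + 6))" unfolding jE(1) by (simp add: power_add power_divide)
  finally show ?thesis by (simp only: of_nat_le_iff)
qed

theorem cnt_upper_bound:
  "\<exists>N. \<forall>V E. sgraph V E \<longrightarrow> card V \<ge> N \<longrightarrow> cnt E \<le> 2 ^ ((card V)\<^sup>2 div 4 + 6)"
proof -
  have th: "(1 / 12800000000 :: real) > 0" by simp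
  have "\<forall>\<^sub>F n in sequentially. \<forall>V E. sgraph V E \<longrightarrow> card V = n \<longrightarrow> cnt E \<le> 2 ^ ((card V)\<^sup>2 div 4 + 6) \<or> gain V E"
    using dense_gain[OF th] eventually_large
  proof eventually_elim
    case (elim n)
    note big = elim(2)
    show ?case
    proof (intro allI impI)
      fix V E assume g: "sgraph V E" and n: "card V = n"
      show "cnt E \<le> 2 ^ ((card V)\<^sup>2 div 4 + 6) \<or> gain V E"
      proof (cases "gain V E")
        case ng: False
        have "real (card E) \<le> (1 / 4 + 1 / 12800000000) * real n ^ 2"
          using elim(1)[rule_format, OF g n] ng by argo
        then obtain X Y where b: "balanced V E X Y" using balanced_if_no_gain[OF big g n ng] by blast
        note b' = balanced_sym[OF b]
        note t = tame_if_no_gain[OF big g n b ng] and t' = tame_if_no_gain[OF big g n b' ng]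
        show ?thesis
        proof (cases "card E \<le> n\<^sup>2 div 4 + 6")
          case True
          hence "(2::nat) ^ card E \<le> 2 ^ (n\<^sup>2 div 4 + 6)" by (intro power_increasing) simp_all
          thus ?thesis using cnt_le[OF g] unfolding n by linarith
        next
          case False
          show ?thesis
            \<comment> \<open>The classes may be exchanged, so either one may be the class with
              fewer inner edges.\<close>
            using endgame[OF big g n b t t' _ False] endgame[OF big g n b' t' t _ False] unfolding n by linarith
        qed
      qed simp
    qed
  qed
  then obtain n0 where n0: "\<And>n V E. n \<ge> n0 \<Longrightarrow> sgraph V E \<Longrightarrow> card V = n \<Longrightarrow>
      cnt E \<le> 2 ^ ((card V)\<^sup>2 div 4 + 6) \<or> gain V E"
    unfolding eventually_sequentially by blast
  \<comment> \<open>From this order on the surplus of \<open>cnt_bound_from_step\<close> is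
    zero.\<close>
  have "cnt E \<le> 2 ^ ((card V)\<^sup>2 div 4 + 6)" if "sgraph V E" "card V \<ge> n0\<^sup>2 + n0" for V E
    using cnt_bound_from_step[of n0 V E, OF n0 that(1)] that(2) by simp
  thus ?thesis by blast
qed

end

subsection \<open>The extremal graph and the theorem\<close>

lemma graph_on_sgraph: "graph_on n E \<longleftrightarrow> sgraph {..<n} E"
  unfolding graph_on_def sgraph_def by auto

lemma finite_graphs: "finite {E. graph_on n E}"
proof (rule finite_subset)
  show "{E. graph_on n E} \<subseteq> Pow (Pow {..<n})" unfolding graph_on_def by fastforce
qed simp

text \<open>The balanced complete bipartite graph with two disjoint triangles added to the lower
  class.\<close>

definition spindle :: "nat \<Rightarrow> nat set set" where
  "spindle n = {e. \<exists>x y. x < n div 2 \<and> n div 2 \<le> y \<and> y < n \<and> e = {x, y}} \<union>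
     {{0, 1}, {0, 2}, {1, 2}, {3, 4}, {3, 5}, {4, 5}}"

lemma spindle_graph: "n \<ge> 12 \<Longrightarrow> graph_on n (spindle n)"
  unfolding graph_on_def
proof
  fix e assume n: "n \<ge> 12" and eS: "e \<in> spindle n"
  from eS have "(\<exists>x y. x < n div 2 \<and> n div 2 \<le> y \<and> y < n \<and> e = {x, y}) \<or>
      e \<in> {{0, 1}, {0, 2}, {1, 2}, {3, 4}, {3, 5}, {4, 5}}" unfolding spindle_def Un_iff mem_Collect_eq .
  then consider x y where "x < n div 2" "n div 2 \<le> y" "y < n" "e = {x, y}" |
    "e \<in> {{0, 1}, {0, 2}, {1, 2}, {3, 4}, {3, 5}, {4, 5}}" by (elim disjE exE conjE)
  thus "\<exists>u v. u < n \<and> v < n \<and> u \<noteq> v \<and> e = {u, v}"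
  proof cases
    case 1
    hence "x < n \<and> y < n \<and> x \<noteq> y \<and> e = {x, y}" by linarith
    thus ?thesis by (intro exI)
  next
    case 2
    have *: "\<exists>u v. u < n \<and> v < n \<and> u \<noteq> v \<and> {a, b} = {u, v}" if "a < b" "b < 6" for a b
    proof -
      have "a < n \<and> b < n \<and> a \<noteq> b \<and> {a, b} = {a, b}" using that n by simp
      thus ?thesis by (intro exI)
    qed
    from 2 show ?thesis by (elim insertE emptyE) (simp_all only: *)
  qed
qed

lemma spindle_edge:
  assumes "n \<ge> 12" "{u, v} \<in> spindle n"
  shows "(u < n div 2 \<and> n div 2 \<le> v) \<or> (v < n div 2 \<and> n div 2 \<le> u) \<or>
    (u \<in> {0, 1, 2} \<and> v \<in> {0, 1, 2}) \<or> (u \<in> {3, 4, 5} \<and> v \<in> {3, 4, 5})"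
  using assms unfolding spindle_def by (auto simp: doubleton_eq_iff)

lemma spindle_card: "n \<ge> 12 \<Longrightarrow> card (spindle n) = n\<^sup>2 div 4 + 6"
proof -
  assume n: "n \<ge> 12"
  define C where "C = {e. \<exists>x y. x < n div 2 \<and> n div 2 \<le> y \<and> y < n \<and> e = {x, y}}"
  let ?T = "{{0, 1}, {0, 2}, {1, 2}, {3, 4}, {3, 5}, {4, 5}} :: nat set set"
  have C: "C = (\<lambda>(x, y). {x, y}) ` ({..<n div 2} \<times> {n div 2..<n})"
  proof
    show "C \<subseteq> (\<lambda>(x, y). {x, y}) ` ({..<n div 2} \<times> {n div 2..<n})"
    proof
      fix e assume "e \<in> C"
      then obtain x y where "x < n div 2" "n div 2 \<le> y" "y < n" "e = {x, y}"
        unfolding C_def mem_Collect_eq by (elim exE conjE)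
      hence "(x, y) \<in> {..<n div 2} \<times> {n div 2..<n}" "e = (\<lambda>(x, y). {x, y}) (x, y)" by simp_all
      thus "e \<in> (\<lambda>(x, y). {x, y}) ` ({..<n div 2} \<times> {n div 2..<n})" by (rule rev_image_eqI)
    qed
    show "(\<lambda>(x, y). {x, y}) ` ({..<n div 2} \<times> {n div 2..<n}) \<subseteq> C"
    proof
      fix e assume "e \<in> (\<lambda>(x, y). {x, y}) ` ({..<n div 2} \<times> {n div 2..<n})"
      then obtain x y where "x < n div 2 \<and> n div 2 \<le> y \<and> y < n \<and> e = {x, y}" by auto
      thus "e \<in> C" unfolding C_def mem_Collect_eq by (intro exI)
    qed
  qed
  have "inj_on (\<lambda>(x, y). {x, y}) ({..<n div 2} \<times> {n div 2..<n})"
    by (auto simp: inj_on_def doubleton_eq_iff)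
  hence cC: "card C = (n div 2) * (n - n div 2)"
    unfolding C by (simp add: card_image card_cartesian_product)
  have "C \<inter> ?T = {}"
  proof -
    have "e \<notin> ?T" if eC: "e \<in> C" for e
    proof -
      obtain x y where e: "n div 2 \<le> y" "e = {x, y}" using eC unfolding C_def by blast
      have "y \<in> e" "6 \<le> y" using e n by auto
      moreover have "\<Union>?T = {0, 1, 2, 3, 4, 5}" by auto
      ultimately show ?thesis by fastforce
    qed
    thus ?thesis by blast
  qed
  moreover have "finite C" unfolding C by simp
  ultimately have "card (C \<union> ?T) = card C + card ?T" by (intro card_Un_disjoint) auto
  moreover have "card ?T = 6" by (simp add: doubleton_eq_iff card_insert_if)
  moreover have "(n div 2) * (n - n div 2) = n\<^sup>2 div 4"
  proof (cases "even n")
    case True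
    then obtain i where "n = 2 * i" by blast
    thus ?thesis by (simp add: power2_eq_square)
  next
    case False
    then obtain i where i: "n = 2 * i + 1" by (metis oddE)
    have "n\<^sup>2 = 4 * (i * (i + 1)) + 1" unfolding i by (simp add: power2_eq_square algebra_simps)
    hence "n\<^sup>2 div 4 = i * (i + 1)" by linarith
    moreover have "n div 2 = i" unfolding i by simp
    ultimately show ?thesis using i by simp
  qed
  ultimately show ?thesis unfolding spindle_def C_def[symmetric] using cC by simp
qed

text \<open>A centre in the lower class would need three other vertices of its own added triangle,
  which has only two. A centre in the upper class would need three disjoint edges inside the lower
  class, but each added triangle has room for one.\<close>

lemma spindle_free:
  assumes n: "n \<ge> 12"
  shows "\<not> contains_copy F33_vertices F33_edges (spindle n)"
proof
  assume "contains_copy F33_vertices F33_edges (spindle n)"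
  then obtain f where inj: "inj_on f F33_vertices" and ed: "\<And>e. e \<in> F33_edges \<Longrightarrow> f ` e \<in> spindle n"
    unfolding contains_copy_def by blast
  have e: "{f a, f b} \<in> spindle n" if "{a, b} \<in> F33_edges" for a b using ed[OF that] by simp
  have ne: "f a \<noteq> f b" if "a < 7" "b < 7" "a \<noteq> b" for a b
    using inj_onD[OF inj, of a b] that unfolding F33_vertices_def by auto
  have tri: "{f 0, f a} \<in> spindle n \<and> {f 0, f b} \<in> spindle n \<and> {f a, f b} \<in> spindle n"
    if "(a, b) \<in> {(1, 2), (3, 4), (5, 6)}" for a b
    using that by (auto intro!: e simp: F33_edges_def)
  let ?A = "{0, 1, 2} :: nat set" and ?B = "{3, 4, 5} :: nat set"
  have small: "z < n div 2" if "z \<in> ?A \<union> ?B" for z using that n by auto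
  show False
  proof (cases "f 0 < n div 2")
    case True
    define S where "S = (if f 0 \<in> ?A then ?A else ?B)"
    have S3: "card S = 3" unfolding S_def by simp
    have in_S: "f 0 \<in> S \<and> (f a \<in> S \<or> f b \<in> S)" if "(a, b) \<in> {(1, 2), (3, 4), (5, 6)}" for a b
    proof -
      note t = tri[OF that]
      have "(n div 2 \<le> f a) \<or> (f 0 \<in> S \<and> f a \<in> S)"
        using spindle_edge[OF n, of "f 0" "f a"] t True unfolding S_def by auto
      moreover have "(n div 2 \<le> f b) \<or> (f 0 \<in> S \<and> f b \<in> S)"
        using spindle_edge[OF n, of "f 0" "f b"] t True unfolding S_def by auto
      moreover have "\<not> (n div 2 \<le> f a \<and> n div 2 \<le> f b)"
        using spindle_edge[OF n, of "f a" "f b"] t small by (meson UnCI leD)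
      ultimately show ?thesis by blast
    qed
    obtain a where a: "a \<in> {1, 2}" "f a \<in> S" using in_S[of 1 2] by auto
    obtain b where b: "b \<in> {3, 4}" "f b \<in> S" using in_S[of 3 4] by auto
    obtain c where c: "c \<in> {5, 6}" "f c \<in> S" using in_S[of 5 6] by auto
    have "f 0 \<in> S" using in_S[of 1 2] by auto
    hence "{f 0, f a, f b, f c} \<subseteq> S" using a b c by blast
    hence "card {f 0, f a, f b, f c} \<le> card S" by (intro card_mono) (auto simp: S_def)
    moreover have "a < 7" "b < 7" "c < 7" "0 \<noteq> a" "0 \<noteq> b" "0 \<noteq> c" "a \<noteq> b" "a \<noteq> c" "b \<noteq> c"
      using a(1) b(1) c(1) by auto
    hence "distinct [f 0, f a, f b, f c]" by (simp add: ne)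
    hence "card {f 0, f a, f b, f c} = 4" by simp
    ultimately show False using S3 by simp
  next
    case False
    have AB: "{f a, f b} \<subseteq> ?A \<or> {f a, f b} \<subseteq> ?B" if "(a, b) \<in> {(1, 2), (3, 4), (5, 6)}" for a b
    proof -
      note t = tri[OF that]
      have "f a < n div 2" "f b < n div 2"
        using spindle_edge[OF n, of "f 0" "f a"] spindle_edge[OF n, of "f 0" "f b"] t False small by (meson UnCI)+
      thus ?thesis using spindle_edge[OF n, of "f a" "f b"] t by auto
    qed
    have no: False if S: "S = ?A \<or> S = ?B" and "{f a, f b} \<subseteq> S" "{f c, f d} \<subseteq> S" "distinct [f a, f b, f c, f d]" for S a b c d
    proof -
      have "{f a, f b, f c, f d} \<subseteq> S" using that by blast
      moreover have "finite S" using S by auto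
      ultimately have "card {f a, f b, f c, f d} \<le> card S" by (intro card_mono)
      moreover have "card {f a, f b, f c, f d} = 4" using that(4) by simp
      moreover have "card S = 3" using S by auto
      ultimately show False by simp
    qed
    have d: "distinct [f 1, f 2, f 3, f 4]" "distinct [f 1, f 2, f 5, f 6]" "distinct [f 3, f 4, f 5, f 6]"
      by (simp_all add: ne)
    have "{f 1, f 2} \<subseteq> ?A \<or> {f 1, f 2} \<subseteq> ?B" "{f 3, f 4} \<subseteq> ?A \<or> {f 3, f 4} \<subseteq> ?B"
      "{f 5, f 6} \<subseteq> ?A \<or> {f 5, f 6} \<subseteq> ?B" by (rule AB, simp)+
    thus False using no[OF disjI1[OF refl] _ _ d(1)] no[OF disjI2[OF refl] _ _ d(1)]
        no[OF disjI1[OF refl] _ _ d(2)] no[OF disjI2[OF refl] _ _ d(2)]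
        no[OF disjI1[OF refl] _ _ d(3)] no[OF disjI2[OF refl] _ _ d(3)] by argo
  qed
qed

definition maps_triangle ::
    "(nat \<times> nat) set \<Rightarrow> (nat \<times> nat) set \<Rightarrow> nat \<Rightarrow> nat \<Rightarrow> nat \<Rightarrow> nat \<Rightarrow> nat \<Rightarrow> bool" where
  "maps_triangle A R c a b x y \<longleftrightarrow> (\<forall>(u, v)\<in>A. u \<in> {0, a, b} \<longrightarrow> v \<in> {0, a, b} \<longrightarrow>
     ((id(0 := c, a := x, b := y)) u, (id(0 := c, a := x, b := y)) v) \<in> R)"

text \<open>Up to exchanging \<open>a\<close> and \<open>b\<close>, an anti-directed triangle has
  the arcs from 0 to \<open>a\<close> and from \<open>b\<close> to 0, so a single bit remains. The
  exchange is why the ends reappear as \<open>x'\<close>, \<open>y'\<close>.\<close>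

lemma triangle_type:
  assumes o: "orientation_of F33_edges A" and ab: "(a, b) \<in> {(1, 2), (3, 4), (5, 6)}"
    and anti: "((a, 0) \<in> A \<or> (b, 0) \<in> A) \<and> ((0, a) \<in> A \<or> (0, b) \<in> A)"
  shows "\<exists>t. \<forall>R (c :: nat) x y. tri R t c x y \<longrightarrow>
    (\<exists>x' y'. {x', y'} = {x, y} \<and> maps_triangle A R c a b x' y')"
proof -
  have "(a = 1 \<and> b = 2) \<or> (a = 3 \<and> b = 4) \<or> (a = 5 \<and> b = 6)" using ab by simp
  hence "{a, b} \<in> F33_edges \<and> {0, a} \<in> F33_edges \<and> {0, b} \<in> F33_edges \<and> a \<noteq> b \<and> a \<noteq> 0 \<and> b \<noteq> 0"
    by (elim disjE conjE) (simp_all add: F33_edges_def doubleton_eq_iff)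
  hence E: "{a, b} \<in> F33_edges" "{0, a} \<in> F33_edges" "{0, b} \<in> F33_edges" "a \<noteq> b" "a \<noteq> 0" "b \<noteq> 0"
    by simp_all
  have x: "(u, v) \<in> A \<longleftrightarrow> (v, u) \<notin> A" if "{u, v} \<in> F33_edges" "u \<noteq> v" for u v
    using o that unfolding orientation_of_def by blast
  have loop: "(u, u) \<notin> A" for u
  proof
    assume "(u, u) \<in> A"
    hence "{u, u} \<in> F33_edges" by (rule orient_edge[OF o])
    moreover have "card e = 2" if "e \<in> F33_edges" for e
      using that unfolding F33_edges_def by (elim insertE emptyE) simp_all
    ultimately show False by fastforce
  qed
  have xab: "(a, b) \<in> A \<longleftrightarrow> (b, a) \<notin> A" "(0, a) \<in> A \<longleftrightarrow> (a, 0) \<notin> A" "(0, b) \<in> A \<longleftrightarrow> (b, 0) \<notin> A"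
    using x[OF E(1,4)] x[OF E(2) E(5)[symmetric]] x[OF E(3) E(6)[symmetric]] .
  define t where "t = (if (0, a) \<in> A then (a, b) \<in> A else (b, a) \<in> A)"
  show ?thesis
  proof (intro exI[of _ t] allI impI)
    fix R and c x y :: nat
    assume "tri R t c x y"
    hence "\<exists>p q. {p, q} = {x, y} \<and> (c, p) \<in> R \<and> (q, c) \<in> R \<and> (if t then (p, q) \<in> R else (q, p) \<in> R)"
      unfolding tri_def
    proof
      assume "(c, x) \<in> R \<and> (y, c) \<in> R \<and> (if t then (x, y) \<in> R else (y, x) \<in> R)"
      hence "{x, y} = {x, y} \<and> (c, x) \<in> R \<and> (y, c) \<in> R \<and> (if t then (x, y) \<in> R else (y, x) \<in> R)" by simp
      thus ?thesis by (intro exI)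
    next
      assume "(c, y) \<in> R \<and> (x, c) \<in> R \<and> (if t then (y, x) \<in> R else (x, y) \<in> R)"
      hence "{y, x} = {x, y} \<and> (c, y) \<in> R \<and> (x, c) \<in> R \<and> (if t then (y, x) \<in> R else (x, y) \<in> R)"
        by (simp add: insert_commute)
      thus ?thesis by (intro exI)
    qed
    then obtain p q where pq: "{p, q} = {x, y}" "(c, p) \<in> R" "(q, c) \<in> R" "if t then (p, q) \<in> R else (q, p) \<in> R"
      by (elim exE conjE)
    define x' y' where "x' = (if (0, a) \<in> A then p else q)" and "y' = (if (0, a) \<in> A then q else p)"
    have "{x', y'} = {x, y}" using pq(1) unfolding x'_def y'_def by (simp add: insert_commute)
    moreover have "maps_triangle A R c a b x' y'"
      unfolding maps_triangle_def
    proof clarify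
      fix u v assume uv: "(u, v) \<in> A" "u \<in> {0, a, b}" "v \<in> {0, a, b}"
      show "((id(0 := c, a := x', b := y')) u, (id(0 := c, a := x', b := y')) v) \<in> R"
      proof (cases "(0, a) \<in> A")
        case True
        hence h: "(b, 0) \<in> A" "(0, b) \<notin> A" "(a, 0) \<notin> A" "t = ((a, b) \<in> A)" "x' = p" "y' = q"
          using anti xab unfolding t_def x'_def y'_def by auto
        thus ?thesis using uv loop E(4-6) pq xab(1) True by (cases t) auto
      next
        case False
        hence h: "(a, 0) \<in> A" "(0, b) \<in> A" "(b, 0) \<notin> A" "t = ((b, a) \<in> A)" "x' = q" "y' = p"
          using anti xab unfolding t_def x'_def y'_def by auto
        thus ?thesis using uv loop E(4-6) pq xab(1) False by (cases t) auto
      qed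
    qed
    ultimately show "\<exists>x' y'. {x', y'} = {x, y} \<and> maps_triangle A R c a b x' y'" by blast
  qed
qed

text \<open>Every arc of \<open>A\<close> lies in one of the three triangles, so three embedded
  triangles with a common centre and otherwise disjoint glue to a copy of the pattern.\<close>

lemma anti_directed_types:
  assumes "anti_directed_F33 A"
  shows "\<exists>t1 t2 t3. \<forall>V E R. sgraph V E \<longrightarrow> orientation_of E R \<longrightarrow> \<not> contains_dicopy F33_vertices A R \<longrightarrow> fan_free t1 t2 t3 R"
proof -
  have o: "orientation_of F33_edges A" using assms unfolding anti_directed_F33_def by blast
  have anti: "((a, 0) \<in> A \<or> (b, 0) \<in> A) \<and> ((0, a) \<in> A \<or> (0, b) \<in> A)"
    if "(a, b) \<in> {(1, 2), (3, 4), (5, 6)}" for a b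
    using assms that unfolding anti_directed_F33_def by fast
  have "\<forall>d\<in>{(1, 2), (3, 4), (5, 6)}. \<exists>t. \<forall>R c x y. tri R t c x y \<longrightarrow>
      (\<exists>x' y'. {x', y'} = {x, y} \<and> maps_triangle A R c (fst d) (snd d) x' y')"
  proof
    fix d :: "nat \<times> nat" assume d: "d \<in> {(1, 2), (3, 4), (5, 6)}"
    show "\<exists>t. \<forall>R c x y. tri R t c x y \<longrightarrow> (\<exists>x' y'. {x', y'} = {x, y} \<and> maps_triangle A R c (fst d) (snd d) x' y')"
      by (rule triangle_type[OF o _ anti]) (use d in simp_all)
  qed
  then obtain \<tau> where \<tau>: "\<forall>d\<in>{(1, 2), (3, 4), (5, 6)}. \<forall>R c x y. tri R (\<tau> d) c x y \<longrightarrow>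
      (\<exists>x' y'. {x', y'} = {x, y} \<and> maps_triangle A R c (fst d) (snd d) x' y')"
    by (rule bchoice[THEN exE])
  define t1 t2 t3 where "t1 = \<tau> (1, 2)" and "t2 = \<tau> (3, 4)" and "t3 = \<tau> (5, 6)"
  have t1: "\<exists>x' y'. {x', y'} = {x, y} \<and> maps_triangle A R c 1 2 x' y'" if "tri R t1 c x y" for R c x y
    using \<tau> that unfolding t1_def by simp
  have t2: "\<exists>x' y'. {x', y'} = {x, y} \<and> maps_triangle A R c 3 4 x' y'" if "tri R t2 c x y" for R c x y
    using \<tau> that unfolding t2_def by simp
  have t3: "\<exists>x' y'. {x', y'} = {x, y} \<and> maps_triangle A R c 5 6 x' y'" if "tri R t3 c x y" for R c x y
    using \<tau> that unfolding t3_def by simp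
  show ?thesis
  proof (intro exI allI impI)
    fix V E R
    assume g: "sgraph V E" and R: "orientation_of E R" and nc: "\<not> contains_dicopy F33_vertices A R"
    show "fan_free t1 t2 t3 R" unfolding fan_free_def
    proof (intro notI, elim exE conjE)
      fix c a1 b1 a2 b2 a3 b3
      assume d: "distinct [a1, b1, a2, b2, a3, b3]" and tr: "tri R t1 c a1 b1" "tri R t2 c a2 b2" "tri R t3 c a3 b3"
      have c: "c \<notin> {a1, b1, a2, b2, a3, b3}"
        using fan_types.tri_edges(8,9)[OF g R tr(1)] fan_types.tri_edges(8,9)[OF g R tr(2)]
          fan_types.tri_edges(8,9)[OF g R tr(3)] by blast
      obtain x1 y1 where 1: "{x1, y1} = {a1, b1}" "maps_triangle A R c 1 2 x1 y1" using t1[OF tr(1)] by blast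
      obtain x2 y2 where 2: "{x2, y2} = {a2, b2}" "maps_triangle A R c 3 4 x2 y2" using t2[OF tr(2)] by blast
      obtain x3 y3 where 3: "{x3, y3} = {a3, b3}" "maps_triangle A R c 5 6 x3 y3" using t3[OF tr(3)] by blast
      define l where "l = [c, x1, y1, x2, y2, x3, y3]"
      define f where "f i = l ! i" for i
      have "distinct l" unfolding l_def using d c 1(1) 2(1) 3(1) by (auto simp: doubleton_eq_iff)
      hence "inj_on f F33_vertices"
        unfolding F33_vertices_def f_def by (auto simp: inj_on_def nth_eq_iff_index_eq l_def)
      moreover have "(f u, f v) \<in> R" if uv: "(u, v) \<in> A" for u v
      proof -
        have "{u, v} \<in> F33_edges" using o uv unfolding orientation_of_def by blast
        hence "(u \<in> {0, 1, 2} \<and> v \<in> {0, 1, 2}) \<or> (u \<in> {0, 3, 4} \<and> v \<in> {0, 3, 4}) \<or> (u \<in> {0, 5, 6} \<and> v \<in> {0, 5, 6})"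
          unfolding F33_edges_def by (auto simp: doubleton_eq_iff)
        moreover have ?thesis if "maps_triangle A R c a b x y" "u \<in> {0, a, b}" "v \<in> {0, a, b}" "f 0 = c" "f a = x" "f b = y"
          for a b x y
        proof -
          have "((id(0 := c, a := x, b := y)) u, (id(0 := c, a := x, b := y)) v) \<in> R"
            using that(1-3) uv unfolding maps_triangle_def by blast
          moreover have "(id(0 := c, a := x, b := y)) i = f i" if "i \<in> {0, a, b}" for i
            using that \<open>f 0 = c\<close> \<open>f a = x\<close> \<open>f b = y\<close> by auto
          ultimately show ?thesis using that(2,3) by simp
        qed
        moreover have "f 0 = c" "f 1 = x1" "f 2 = y1" "f 3 = x2" "f 4 = y2" "f 5 = x3" "f 6 = y3"
          unfolding f_def l_def by simp_all
        ultimately show ?thesis using 1(2) 2(2) 3(2) by blast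
      qed
      ultimately have "contains_dicopy F33_vertices A R" unfolding contains_dicopy_def by blast
      thus False using nc by blast
    qed
  qed
qed

text \<open>A copy of the oriented pattern would contain a copy of the undirected graph. This yields
  the lower bound on \<open>D\<close> and ties it to the extremal number.\<close>

lemma all_orientations_free:
  assumes A: "orientation_of F33_edges A" and g: "sgraph V E" and free: "\<not> contains_copy F33_vertices F33_edges E"
  shows "card {R. orientation_of E R \<and> \<not> contains_dicopy F33_vertices A R} = 2 ^ card E"
proof -
  have "\<not> contains_dicopy F33_vertices A R" if R: "orientation_of E R" for R
  proof
    assume "contains_dicopy F33_vertices A R"
    then obtain f where f: "inj_on f F33_vertices" "\<And>a b. (a, b) \<in> A \<Longrightarrow> (f a, f b) \<in> R"
      unfolding contains_dicopy_def by blast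
    have "f ` e \<in> E" if e: "e \<in> F33_edges" for e
    proof -
      have "\<exists>a b. e = {a, b} \<and> a \<noteq> b" using e unfolding F33_edges_def
        by (elim insertE emptyE) (rule exI, rule exI, rule conjI, assumption, simp)+
      then obtain a b where ab: "a \<noteq> b" "e = {a, b}" by blast
      hence "(a, b) \<in> A \<or> (b, a) \<in> A" using A e unfolding orientation_of_def by blast
      hence "(f a, f b) \<in> R \<or> (f b, f a) \<in> R" using f(2) by blast
      hence "{f a, f b} \<in> E" using orient_edge[OF R] by (metis insert_commute)
      thus ?thesis using ab by simp
    qed
    thus False using free f(1) unfolding contains_copy_def by blast
  qed
  hence "{R. orientation_of E R \<and> \<not> contains_dicopy F33_vertices A R} = {R. orientation_of E R}" by blast
  thus ?thesis using card_orientations[OF g] by simp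
qed

theorem mainTheorem5:
  fixes A :: "(nat \<times> nat) set"
  assumes "anti_directed_F33 A"
  shows "\<exists>N. \<forall>n\<ge>N.
           D n F33_vertices A = 2 ^ turan_ex n F33_vertices F33_edges \<and>
           turan_ex n F33_vertices F33_edges = n\<^sup>2 div 4 + 6"
proof -
  have A: "orientation_of F33_edges A" using assms unfolding anti_directed_F33_def by blast
  obtain t1 t2 t3 where t: "\<And>V E R. sgraph V E \<Longrightarrow> orientation_of E R \<Longrightarrow>
      \<not> contains_dicopy F33_vertices A R \<Longrightarrow> fan_free t1 t2 t3 R"
    using anti_directed_types[OF assms] by blast
  obtain N where N: "\<And>V E. sgraph V E \<Longrightarrow> card V \<ge> N \<Longrightarrow> fan_types.cnt t1 t2 t3 E \<le> 2 ^ ((card V)\<^sup>2 div 4 + 6)"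
    using fan_types.cnt_upper_bound by blast
  define free where "free E = {R. orientation_of E R \<and> \<not> contains_dicopy F33_vertices A R}" for E :: "nat set set"
  have "D n F33_vertices A = 2 ^ turan_ex n F33_vertices F33_edges \<and>
      turan_ex n F33_vertices F33_edges = n\<^sup>2 div 4 + 6" if n: "n \<ge> max N 12" for n
  proof -
    let ?m = "n\<^sup>2 div 4 + 6"
    have up: "card (free E) \<le> 2 ^ ?m" if E: "graph_on n E" for E
    proof -
      have g: "sgraph {..<n} E" using E unfolding graph_on_sgraph .
      have "free E \<subseteq> fan_types.FO t1 t2 t3 E"
        unfolding free_def fan_types.FO_def using t[OF g] by blast
      hence "card (free E) \<le> fan_types.cnt t1 t2 t3 E"
        unfolding fan_types.cnt_def using fan_types.finite_FO[OF g] by (intro card_mono)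
      also have "\<dots> \<le> 2 ^ ?m" using N[OF g] n by simp
      finally show ?thesis .
    qed
    have full: "card (free E) = 2 ^ card E" if "graph_on n E" "\<not> contains_copy F33_vertices F33_edges E" for E
      unfolding free_def using that by (intro all_orientations_free[OF A]) (auto simp: graph_on_sgraph)
    have sp: "graph_on n (spindle n)" "\<not> contains_copy F33_vertices F33_edges (spindle n)" "card (spindle n) = ?m"
      using n spindle_graph spindle_free spindle_card by simp_all
    have "turan_ex n F33_vertices F33_edges = ?m"
      unfolding turan_ex_def
    proof (rule Max_eqI)
      show "finite {card E |E. graph_on n E \<and> \<not> contains_copy F33_vertices F33_edges E}"
        by (rule finite_subset[of _ "card ` {E. graph_on n E}"]) (use finite_graphs in auto)
      show "?m \<in> {card E |E. graph_on n E \<and> \<not> contains_copy F33_vertices F33_edges E}"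
        using sp by (metis (mono_tags, lifting) mem_Collect_eq)
      fix k assume "k \<in> {card E |E. graph_on n E \<and> \<not> contains_copy F33_vertices F33_edges E}"
      then obtain E where E: "k = card E" "graph_on n E" "\<not> contains_copy F33_vertices F33_edges E" by blast
      \<comment> \<open>The upper bound on the extremal number is read off from the orientation
        count: all \<open>2 ^ k\<close> orientations of such a graph avoid the pattern.\<close>
      have "(2::nat) ^ k \<le> 2 ^ ?m" using up[OF E(2)] full[OF E(2,3)] E(1) by simp
      thus "k \<le> ?m" by (simp only: power_increasing_iff)
    qed
    moreover have "D n F33_vertices A = 2 ^ ?m"
      unfolding D_def free_def[symmetric]
    proof (rule Max_eqI)
      show "finite {card (free E) |E. graph_on n E}"
        by (rule finite_subset[of _ "(\<lambda>E. card (free E)) ` {E. graph_on n E}"]) (use finite_graphs in auto)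
      have "card (free (spindle n)) = 2 ^ ?m" using full[OF sp(1,2)] sp(3) by simp
      thus "2 ^ ?m \<in> {card (free E) |E. graph_on n E}" using sp(1) by (metis (mono_tags, lifting) mem_Collect_eq)
      show "k \<le> 2 ^ ?m" if "k \<in> {card (free E) |E. graph_on n E}" for k using that up by blast
    qed
    ultimately show ?thesis by simp
  qed
  thus ?thesis by blast
qed

end
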